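(* Assume that there is a countable transitive model of set theory. Let $T \subseteq \mathsf{IKP}^+ + \mathsf{MP} + \mathsf{AC}$ be a set theory. The relative first-order logic of $T$ is intuitionistic first-order logic $\mathbf{IQC}$, i.e., $\mathbf{QL}_E(T) = \mathbf{IQC}$. In particular, $\mathbf{QL}_E(\mathsf{IKP}) = \mathbf{IQC}$.
   Context: Set theories. $\mathcal{L}_\in$ is the first-order language with $\in$ and $=$; a set theory is a theory in $\mathcal{L}_\in$ based on intuitionistic first-order logic. A $\Delta_0$-formula (bounded formula) is one all of whose quantifiers are of the form $\forall x \in a$ or $\exists x \in a$. $\mathsf{IKP}$ consists of intuitionistic first-order logic for $\mathcal{L}_\in$ plus: Empty Set $\exists a\, \forall x \in a\, \bot$; Pairing $\forall a \forall b \exists y \forall x (x \in y \leftrightarrow (x = a \vee x = b))$; Union $\forall a \exists y \forall x (x \in y \leftrightarrow \exists u (u \in a \wedge x \in u))$; Extensionality $\forall a \forall b (\forall x (x \in a \leftrightarrow x \in b) \rightarrow a = b)$; Infinity $\exists x (\emptyset \in x \wedge \forall y (y \in x \rightarrow y \cup \{y\} \in x) \wedge \forall y (y \in x \rightarrow (y = \emptyset \vee \exists z \in y\; y = z \cup \{z\})))$; Set Induction $(\forall a (\forall x \in a\, \varphi(x) \rightarrow \varphi(a))) \rightarrow \forall a\, \varphi(a)$ for all formulas $\varphi$; $\Delta_0$-Separation $\forall a \exists y \forall x (x \in y \leftrightarrow x \in a \wedge \varphi(x))$ and $\Delta_0$-Collection $\forall a (\forall x \in a \exists y\, \varphi(x,y)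 \rightarrow \exists b \forall x \in a \exists y \in b\, \varphi(x,y))$ for $\Delta_0$-formulas $\varphi$. $\mathsf{IKP}^+$ is $\mathsf{IKP}$ plus Bounded Strong Collection, $\forall a (\forall x \in a \exists y\, \varphi(x,y) \rightarrow \exists b (\forall x \in a \exists y \in b\, \varphi(x,y) \wedge \forall y \in b \exists x \in a\, \varphi(x,y)))$ for $\Delta_0$-formulas $\varphi$, and Set-bounded Subset Collection, $\forall a \forall b \exists c \forall z (\forall x \in a \exists y \in b\, \psi(x,y,z) \rightarrow \exists d \in c (\forall x \in a \exists y \in d\, \psi(x,y,z) \wedge \forall y \in d \exists x \in a\, \psi(x,y,z)))$ for $\Delta_0$-formulas $\psi$ in which $z$ is set-bounded (i.e. from $\psi(x,y,z)$ one can intuitionistically derive $z \in t$ for some term $t$ appearing in $\psi$). $\mathsf{MP}$ (Markov's principle) is $\forall h : \mathbb{N} \to 2\, (\neg \forall n \in \mathbb{N}\; h(n) = 0 \rightarrow \exists n \in \mathbb{N}\; h(n) = 1)$. $\mathsf{AC}$ is $\forall a ((\forall x \in a \forall y \in a\, (x \neq y \rightarrow x \cap y = \emptyset)) \rightarrow \exists b \forall x \in a \exists! z \in b\; z \in x)$. First-order logic. $\mathbf{IQC}$ is intuitionistic first-order logic in a language without equality, identified with the set of its consequences. Only languages with relation symbols are considered: a function symbol $f$ is eliminated in favour of a relation symbol $R_f$ for its graph, and a translation $\sigma$ into a theory is then required to be such that the theory proves that $\sigma(R_f)$ is the graph of a function. Relative logic. Let $E$ be a fresh unary predicate symbol. The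 relative translation $\varphi^E$ acts non-trivially only on quantifiers: $(\exists x\, \varphi(x))^E = \exists x (Ex \wedge \varphi^E(x))$ and $(\forall x\, \varphi(x))^E = \forall x (Ex \rightarrow \varphi^E(x))$. A first-order translation $\sigma$ maps each $n$-ary relation symbol (here including $E$) to an $\mathcal{L}_\in$-formula with $n$ free variables, and is extended to all formulas in the obvious way, commuting with connectives and quantifiers. The relative first-order logic $\mathbf{QL}_E(T)$ of $T$ consists of the first-order formulas $\varphi$ such that $T \vdash (\varphi^E)^\sigma$ for all such first-order translations $\sigma$.
   Formalization: AC is stated for sets a whose members are inhabited (literally a = {∅} refutes it), and membership in QL_E(T) asks T ⊢ (∃x Ex → φ^E)^σ, with φ universally closed, since σ(E) = ⊥ would otherwise exclude theorems of IQC such as ∃x(Px → Px). *)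

theory Defs
  imports Main "HOL-Library.Countable_Set_Type"
begin

section \<open>First-order formulas over relational signatures\<close>

text \<open>
  De Bruijn syntax. There are no function symbols, so terms are just variables. The arities are
  given separately by a function on the relation symbols. There is no built-in equality.
\<close>

datatype 'r fm =
    Atom 'r "nat list"
  | Falsum  ("\<^bold>\<bottom>")
  | Conj "'r fm" "'r fm"  (infixr "\<^bold>\<and>" 35)
  | Disj "'r fm" "'r fm"  (infixr "\<^bold>\<or>" 30)
  | Impl "'r fm" "'r fm"  (infixr "\<^bold>\<longrightarrow>" 25)
  | Forall "'r fm"
  | Exists "'r fm"

abbreviation Neg :: "'r fm \<Rightarrow> 'r fm"  ("\<^bold>\<not> _" [40] 40)
  where "\<^bold>\<not> \<phi> \<equiv> \<phi> \<^bold>\<longrightarrow> \<^bold>\<bottom>"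

abbreviation Iff :: "'r fm \<Rightarrow> 'r fm \<Rightarrow> 'r fm"  (infixr "\<^bold>\<longleftrightarrow>" 25)
  where "\<phi> \<^bold>\<longleftrightarrow> \<psi> \<equiv> (\<phi> \<^bold>\<longrightarrow> \<psi>) \<^bold>\<and> (\<psi> \<^bold>\<longrightarrow> \<phi>)"

primrec wff :: "('r \<Rightarrow> nat) \<Rightarrow> 'r fm \<Rightarrow> bool" where
  "wff ar (Atom r ts) = (length ts = ar r)"
| "wff ar \<^bold>\<bottom> = True"
| "wff ar (\<phi> \<^bold>\<and> \<psi>) = (wff ar \<phi> \<and> wff ar \<psi>)"
| "wff ar (\<phi> \<^bold>\<or> \<psi>) = (wff ar \<phi> \<and> wff ar \<psi>)"
| "wff ar (\<phi> \<^bold>\<longrightarrow> \<psi>) = (wff ar \<phi> \<and> wff ar \<psi>)"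
| "wff ar (Forall \<phi>) = wff ar \<phi>"
| "wff ar (Exists \<phi>) = wff ar \<phi>"

primrec fv :: "'r fm \<Rightarrow> nat set" where
  "fv (Atom r ts) = set ts"
| "fv \<^bold>\<bottom> = {}"
| "fv (\<phi> \<^bold>\<and> \<psi>) = fv \<phi> \<union> fv \<psi>"
| "fv (\<phi> \<^bold>\<or> \<psi>) = fv \<phi> \<union> fv \<psi>"
| "fv (\<phi> \<^bold>\<longrightarrow> \<psi>) = fv \<phi> \<union> fv \<psi>"
| "fv (Forall \<phi>) = {n. Suc n \<in> fv \<phi>}"
| "fv (Exists \<phi>) = {n. Suc n \<in> fv \<phi>}"

fun lift_ren :: "(nat \<Rightarrow> nat) \<Rightarrow> nat \<Rightarrow> nat" where
  "lift_ren f 0 = 0"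
| "lift_ren f (Suc n) = Suc (f n)"

text \<open>Simultaneous capture-avoiding substitution of variables for the free variables.\<close>

primrec ren :: "(nat \<Rightarrow> nat) \<Rightarrow> 'r fm \<Rightarrow> 'r fm" where
  "ren f (Atom r ts) = Atom r (map f ts)"
| "ren f \<^bold>\<bottom> = \<^bold>\<bottom>"
| "ren f (\<phi> \<^bold>\<and> \<psi>) = (ren f \<phi> \<^bold>\<and> ren f \<psi>)"
| "ren f (\<phi> \<^bold>\<or> \<psi>) = (ren f \<phi> \<^bold>\<or> ren f \<psi>)"
| "ren f (\<phi> \<^bold>\<longrightarrow> \<psi>) = (ren f \<phi> \<^bold>\<longrightarrow> ren f \<psi>)"
| "ren f (Forall \<phi>) = Forall (ren (lift_ren f) \<phi>)"
| "ren f (Exists \<phi>) = Exists (ren (lift_ren f) \<phi>)"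

definition inst :: "nat \<Rightarrow> 'r fm \<Rightarrow> 'r fm" where
  "inst t = ren (case_nat t (\<lambda>n. n))"

definition uclose :: "'r fm \<Rightarrow> 'r fm" where
  "uclose \<phi> = (Forall ^^ (LEAST n. fv \<phi> \<subseteq> {..<n})) \<phi>"

definition sentence :: "('r \<Rightarrow> nat) \<Rightarrow> 'r fm \<Rightarrow> bool" where
  "sentence ar \<phi> \<longleftrightarrow> wff ar \<phi> \<and> fv \<phi> = {}"

section \<open>Intuitionistic first-order logic\<close>

text \<open>
  Natural deduction for intuitionistic logic without equality. Arities are not checked: an atom
  with the wrong number of arguments behaves like an atom of an additional relation symbol, so
  this makes no difference for which well-formed formulas are derivable from well-formed ones.
\<close>

inductive derives :: "'r fm set \<Rightarrow> 'r fm \<Rightarrow> bool"  (infix "\<turnstile>" 20) where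
  assm: "\<phi> \<in> \<Gamma> \<Longrightarrow> \<Gamma> \<turnstile> \<phi>"
| falsumE: "\<Gamma> \<turnstile> \<^bold>\<bottom> \<Longrightarrow> \<Gamma> \<turnstile> \<phi>"
| conjI: "\<Gamma> \<turnstile> \<phi> \<Longrightarrow> \<Gamma> \<turnstile> \<psi> \<Longrightarrow> \<Gamma> \<turnstile> (\<phi> \<^bold>\<and> \<psi>)"
| conjE1: "\<Gamma> \<turnstile> (\<phi> \<^bold>\<and> \<psi>) \<Longrightarrow> \<Gamma> \<turnstile> \<phi>"
| conjE2: "\<Gamma> \<turnstile> (\<phi> \<^bold>\<and> \<psi>) \<Longrightarrow> \<Gamma> \<turnstile> \<psi>"
| disjI1: "\<Gamma> \<turnstile> \<phi> \<Longrightarrow> \<Gamma> \<turnstile> (\<phi> \<^bold>\<or> \<psi>)"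
| disjI2: "\<Gamma> \<turnstile> \<psi> \<Longrightarrow> \<Gamma> \<turnstile> (\<phi> \<^bold>\<or> \<psi>)"
| disjE: "\<Gamma> \<turnstile> (\<phi> \<^bold>\<or> \<psi>) \<Longrightarrow> insert \<phi> \<Gamma> \<turnstile> \<chi> \<Longrightarrow> insert \<psi> \<Gamma> \<turnstile> \<chi> \<Longrightarrow> \<Gamma> \<turnstile> \<chi>"
| implI: "insert \<phi> \<Gamma> \<turnstile> \<psi> \<Longrightarrow> \<Gamma> \<turnstile> (\<phi> \<^bold>\<longrightarrow> \<psi>)"
| implE: "\<Gamma> \<turnstile> (\<phi> \<^bold>\<longrightarrow> \<psi>) \<Longrightarrow> \<Gamma> \<turnstile> \<phi> \<Longrightarrow> \<Gamma> \<turnstile> \<psi>"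
| forallI: "ren Suc ` \<Gamma> \<turnstile> \<phi> \<Longrightarrow> \<Gamma> \<turnstile> Forall \<phi>"
| forallE: "\<Gamma> \<turnstile> Forall \<phi> \<Longrightarrow> \<Gamma> \<turnstile> inst t \<phi>"
| existsI: "\<Gamma> \<turnstile> inst t \<phi> \<Longrightarrow> \<Gamma> \<turnstile> Exists \<phi>"
| existsE: "\<Gamma> \<turnstile> Exists \<phi> \<Longrightarrow> insert \<phi> (ren Suc ` \<Gamma>) \<turnstile> ren Suc \<chi> \<Longrightarrow> \<Gamma> \<turnstile> \<chi>"

definition IQC :: "('r \<Rightarrow> nat) \<Rightarrow> 'r fm set" where
  "IQC ar = {\<phi>. wff ar \<phi> \<and> ({} \<turnstile> \<phi>)}"

section \<open>The language of set theory\<close>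

datatype lset = Mem | Eq

definition set_ar :: "lset \<Rightarrow> nat" where
  "set_ar r = 2"

abbreviation mem_fm :: "nat \<Rightarrow> nat \<Rightarrow> lset fm"  (infix "\<^bold>\<in>" 50)
  where "x \<^bold>\<in> y \<equiv> Atom Mem [x, y]"

abbreviation eq_fm :: "nat \<Rightarrow> nat \<Rightarrow> lset fm"  (infix "\<^bold>=" 50)
  where "x \<^bold>= y \<equiv> Atom Eq [x, y]"

text \<open>
  Bounded quantifiers: the bound \<open>a\<close> is the index of a variable outside the scope of the
  quantifier. In particular, the bound variable cannot serve as its own bound.
\<close>

definition ForallIn :: "nat \<Rightarrow> lset fm \<Rightarrow> lset fm" where
  "ForallIn a \<phi> = Forall (0 \<^bold>\<in> Suc a \<^bold>\<longrightarrow> \<phi>)"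

definition ExistsIn :: "nat \<Rightarrow> lset fm \<Rightarrow> lset fm" where
  "ExistsIn a \<phi> = Exists (0 \<^bold>\<in> Suc a \<^bold>\<and> \<phi>)"

inductive delta0 :: "lset fm \<Rightarrow> bool" where
  "delta0 (Atom r ts)"
| "delta0 \<^bold>\<bottom>"
| "delta0 \<phi> \<Longrightarrow> delta0 \<psi> \<Longrightarrow> delta0 (\<phi> \<^bold>\<and> \<psi>)"
| "delta0 \<phi> \<Longrightarrow> delta0 \<psi> \<Longrightarrow> delta0 (\<phi> \<^bold>\<or> \<psi>)"
| "delta0 \<phi> \<Longrightarrow> delta0 \<psi> \<Longrightarrow> delta0 (\<phi> \<^bold>\<longrightarrow> \<psi>)"
| "delta0 \<phi> \<Longrightarrow> delta0 (ForallIn a \<phi>)"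
| "delta0 \<phi> \<Longrightarrow> delta0 (ExistsIn a \<phi>)"

text \<open>
  Set theories are based on intuitionistic logic with equality. Congruence with respect to the
  two atomic relations suffices for the full substitution property.
\<close>

definition eq_axioms :: "lset fm set" where
  "eq_axioms =
    {Forall (0 \<^bold>= 0),
     \<comment> \<open>\<open>\<forall>x y z. x = y \<longrightarrow> x = z \<longrightarrow> y = z\<close>\<close>
     Forall (Forall (Forall (2 \<^bold>= 1 \<^bold>\<longrightarrow> 2 \<^bold>= 0 \<^bold>\<longrightarrow> 1 \<^bold>= 0))),
     \<comment> \<open>\<open>\<forall>x y z. x = y \<longrightarrow> x \<in> z \<longrightarrow> y \<in> z\<close>\<close>
     Forall (Forall (Forall (2 \<^bold>= 1 \<^bold>\<longrightarrow> 2 \<^bold>\<in> 0 \<^bold>\<longrightarrow> 1 \<^bold>\<in> 0))),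
     \<comment> \<open>\<open>\<forall>x y z. x = y \<longrightarrow> z \<in> x \<longrightarrow> z \<in> y\<close>\<close>
     Forall (Forall (Forall (2 \<^bold>= 1 \<^bold>\<longrightarrow> 0 \<^bold>\<in> 2 \<^bold>\<longrightarrow> 0 \<^bold>\<in> 1)))}"

definition set_derives :: "lset fm set \<Rightarrow> lset fm \<Rightarrow> bool"  (infix "\<turnstile>\<^sub>=" 20) where
  "(T \<turnstile>\<^sub>= \<phi>) \<longleftrightarrow> (eq_axioms \<union> T \<turnstile> \<phi>)"

definition set_theory :: "lset fm set \<Rightarrow> bool" where
  "set_theory T \<longleftrightarrow> (\<forall>\<phi>\<in>T. sentence set_ar \<phi>)"

definition theorems :: "lset fm set \<Rightarrow> lset fm set" where
  "theorems T = {\<phi>. sentence set_ar \<phi> \<and> (T \<turnstile>\<^sub>= \<phi>)}"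

section \<open>Axioms\<close>

text \<open>
  In an axiom scheme for \<open>\<phi>(v\<^sub>0, \<dots>, v\<^sub>m)\<close>, the free variables \<open>0, \<dots>, m\<close> of \<open>\<phi>\<close> are the displayed
  ones, and all further free variables of \<open>\<phi>\<close> are parameters. \<open>args [i\<^sub>0, \<dots>, i\<^sub>m] k \<phi>\<close> is
  \<open>\<phi>(i\<^sub>0, \<dots>, i\<^sub>m)\<close> placed under \<open>k\<close> quantifiers, so that \<open>k, k + 1, \<dots>\<close> are the parameters.
\<close>

definition args :: "nat list \<Rightarrow> nat \<Rightarrow> lset fm \<Rightarrow> lset fm" where
  "args is k = ren (\<lambda>n. if n < length is then is ! n else n - length is + k)"

text \<open>
  The term-forming operations used in the axioms are eliminated as usual. The arguments are indices
  of variables: \<open>x = \<emptyset>\<close>, \<open>x = {\<emptyset>}\<close>, \<open>x = {u, v}\<close>, \<open>x = \<langle>u, v\<rangle>\<close> (Kuratowski pair) and \<open>x = y \<union> {y}\<close>.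
\<close>

definition is_empty :: "nat \<Rightarrow> lset fm" where
  "is_empty x = ForallIn x \<^bold>\<bottom>"

definition is_one :: "nat \<Rightarrow> lset fm" where
  "is_one x = Forall (0 \<^bold>\<in> Suc x \<^bold>\<longleftrightarrow> is_empty 0)"

definition is_upair :: "nat \<Rightarrow> nat \<Rightarrow> nat \<Rightarrow> lset fm" where
  "is_upair x u v = Forall (0 \<^bold>\<in> Suc x \<^bold>\<longleftrightarrow> (0 \<^bold>= Suc u \<^bold>\<or> 0 \<^bold>= Suc v))"

definition is_pair :: "nat \<Rightarrow> nat \<Rightarrow> nat \<Rightarrow> lset fm" where
  "is_pair x u v =
    Forall (0 \<^bold>\<in> Suc x \<^bold>\<longleftrightarrow> (is_upair 0 (Suc u) (Suc u) \<^bold>\<or> is_upair 0 (Suc u) (Suc v)))"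

definition is_succ :: "nat \<Rightarrow> nat \<Rightarrow> lset fm" where
  "is_succ x y = Forall (0 \<^bold>\<in> Suc x \<^bold>\<longleftrightarrow> (0 \<^bold>\<in> Suc y \<^bold>\<or> 0 \<^bold>= Suc y))"

subsection \<open>IKP\<close>

\<comment> \<open>\<open>\<exists>a. \<forall>x\<in>a. \<bottom>\<close>\<close>
definition ax_empty :: "lset fm" where
  "ax_empty = Exists (ForallIn 0 \<^bold>\<bottom>)"

\<comment> \<open>\<open>\<forall>a b. \<exists>y. \<forall>x. x \<in> y \<longleftrightarrow> x = a \<or> x = b\<close>\<close>
definition ax_pairing :: "lset fm" where
  "ax_pairing = Forall (Forall (Exists (Forall (0 \<^bold>\<in> 1 \<^bold>\<longleftrightarrow> (0 \<^bold>= 3 \<^bold>\<or> 0 \<^bold>= 2)))))"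

\<comment> \<open>\<open>\<forall>a. \<exists>y. \<forall>x. x \<in> y \<longleftrightarrow> (\<exists>u. u \<in> a \<and> x \<in> u)\<close>\<close>
definition ax_union :: "lset fm" where
  "ax_union = Forall (Exists (Forall (0 \<^bold>\<in> 1 \<^bold>\<longleftrightarrow> Exists (0 \<^bold>\<in> 3 \<^bold>\<and> 1 \<^bold>\<in> 0))))"

\<comment> \<open>\<open>\<forall>a b. (\<forall>x. x \<in> a \<longleftrightarrow> x \<in> b) \<longrightarrow> a = b\<close>\<close>
definition ax_extensionality :: "lset fm" where
  "ax_extensionality = Forall (Forall (Forall (0 \<^bold>\<in> 2 \<^bold>\<longleftrightarrow> 0 \<^bold>\<in> 1) \<^bold>\<longrightarrow> 1 \<^bold>= 0))"

\<comment> \<open>\<open>\<emptyset> \<in> x \<and> (\<forall>y. y \<in> x \<longrightarrow> y \<union> {y} \<in> x)\<close>\<close>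
definition is_inductive :: "nat \<Rightarrow> lset fm" where
  "is_inductive x =
    (ExistsIn x (is_empty 0) \<^bold>\<and> ForallIn x (ExistsIn (Suc x) (is_succ 0 1)))"

\<comment> \<open>\<open>\<exists>x. \<emptyset> \<in> x \<and> (\<forall>y. y \<in> x \<longrightarrow> y \<union> {y} \<in> x) \<and> (\<forall>y. y \<in> x \<longrightarrow> y = \<emptyset> \<or> (\<exists>z\<in>y. y = z \<union> {z}))\<close>\<close>
definition ax_infinity :: "lset fm" where
  "ax_infinity =
    Exists (is_inductive 0 \<^bold>\<and> ForallIn 0 (is_empty 0 \<^bold>\<or> ExistsIn 0 (is_succ 1 0)))"

\<comment> \<open>\<open>(\<forall>a. (\<forall>x\<in>a. \<phi>(x)) \<longrightarrow> \<phi>(a)) \<longrightarrow> (\<forall>a. \<phi>(a))\<close>\<close>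
definition set_induction :: "lset fm \<Rightarrow> lset fm" where
  "set_induction \<phi> =
    (Forall (ForallIn 0 (args [0] 2 \<phi>) \<^bold>\<longrightarrow> args [0] 1 \<phi>) \<^bold>\<longrightarrow> Forall (args [0] 1 \<phi>))"

\<comment> \<open>\<open>\<forall>a. \<exists>y. \<forall>x. x \<in> y \<longleftrightarrow> x \<in> a \<and> \<phi>(x)\<close>\<close>
definition separation :: "lset fm \<Rightarrow> lset fm" where
  "separation \<phi> = Forall (Exists (Forall (0 \<^bold>\<in> 1 \<^bold>\<longleftrightarrow> (0 \<^bold>\<in> 2 \<^bold>\<and> args [0] 3 \<phi>))))"

\<comment> \<open>\<open>\<forall>a. (\<forall>x\<in>a. \<exists>y. \<phi>(x, y)) \<longrightarrow> (\<exists>b. \<forall>x\<in>a. \<exists>y\<in>b. \<phi>(x, y))\<close>\<close>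
definition collection :: "lset fm \<Rightarrow> lset fm" where
  "collection \<phi> = Forall
    (ForallIn 0 (Exists (args [1, 0] 3 \<phi>)) \<^bold>\<longrightarrow>
     Exists (ForallIn 1 (ExistsIn 1 (args [1, 0] 4 \<phi>))))"

definition IKP :: "lset fm set" where
  "IKP =
    {ax_empty, ax_pairing, ax_union, ax_extensionality, ax_infinity}
    \<union> {uclose (set_induction \<phi>) | \<phi>. wff set_ar \<phi>}
    \<union> {uclose (separation \<phi>) | \<phi>. wff set_ar \<phi> \<and> delta0 \<phi>}
    \<union> {uclose (collection \<phi>) | \<phi>. wff set_ar \<phi> \<and> delta0 \<phi>}"

subsection \<open>Strong Collection and Subset Collection\<close>

\<comment> \<open>\<open>\<forall>a. (\<forall>x\<in>a. \<exists>y. \<phi>(x, y)) \<longrightarrow>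
      (\<exists>b. (\<forall>x\<in>a. \<exists>y\<in>b. \<phi>(x, y)) \<and> (\<forall>y\<in>b. \<exists>x\<in>a. \<phi>(x, y)))\<close>\<close>
definition strong_collection :: "lset fm \<Rightarrow> lset fm" where
  "strong_collection \<phi> = Forall
    (ForallIn 0 (Exists (args [1, 0] 3 \<phi>)) \<^bold>\<longrightarrow>
     Exists (ForallIn 1 (ExistsIn 1 (args [1, 0] 4 \<phi>)) \<^bold>\<and>
             ForallIn 0 (ExistsIn 2 (args [0, 1] 4 \<phi>))))"

\<comment> \<open>\<open>\<forall>a b. \<exists>c. \<forall>z. (\<forall>x\<in>a. \<exists>y\<in>b. \<psi>(x, y, z)) \<longrightarrow>
      (\<exists>d\<in>c. (\<forall>x\<in>a. \<exists>y\<in>d. \<psi>(x, y, z)) \<and> (\<forall>y\<in>d. \<exists>x\<in>a. \<psi>(x, y, z)))\<close>\<close>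
definition subset_collection :: "lset fm \<Rightarrow> lset fm" where
  "subset_collection \<psi> = Forall (Forall (Exists (Forall
    (ForallIn 3 (ExistsIn 3 (args [1, 0, 2] 6 \<psi>)) \<^bold>\<longrightarrow>
     ExistsIn 1 (ForallIn 4 (ExistsIn 1 (args [1, 0, 3] 7 \<psi>)) \<^bold>\<and>
                 ForallIn 0 (ExistsIn 5 (args [0, 1, 3] 7 \<psi>)))))))"

text \<open>The variable \<open>z\<close> of \<open>\<psi>(x, y, z)\<close> has index 2.\<close>

definition z_set_bounded :: "lset fm \<Rightarrow> bool" where
  "z_set_bounded \<psi> \<longleftrightarrow> (\<exists>t\<in>fv \<psi>. {\<psi>} \<turnstile>\<^sub>= 2 \<^bold>\<in> t)"

definition IKP_plus :: "lset fm set" where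
  "IKP_plus =
    IKP
    \<union> {uclose (strong_collection \<phi>) | \<phi>. wff set_ar \<phi> \<and> delta0 \<phi>}
    \<union> {uclose (subset_collection \<psi>) | \<psi>. wff set_ar \<psi> \<and> delta0 \<psi> \<and> z_set_bounded \<psi>}"

subsection \<open>Markov's principle\<close>

text \<open>
  The set of natural numbers is the least inductive set. The axiom of infinity above does not by
  itself determine the set whose existence it asserts.
\<close>

definition is_omega :: "nat \<Rightarrow> lset fm" where
  "is_omega w = (is_inductive w \<^bold>\<and> Forall (is_inductive 0 \<^bold>\<longrightarrow> ForallIn (Suc w) (0 \<^bold>\<in> 1)))"

\<comment> \<open>\<open>\<exists>p\<in>h. p = \<langle>u, v\<rangle>\<close>\<close>
definition pair_in :: "nat \<Rightarrow> nat \<Rightarrow> nat \<Rightarrow> lset fm" where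
  "pair_in u v h = ExistsIn h (is_pair 0 (Suc u) (Suc v))"

\<comment> \<open>\<open>h : w \<rightarrow> 2\<close>, i.e. \<open>(\<forall>p\<in>h. \<exists>n\<in>w. \<exists>i. (i = \<emptyset> \<or> i = {\<emptyset>}) \<and> p = \<langle>n, i\<rangle>) \<and>
      (\<forall>n\<in>w. \<exists>i. (i = \<emptyset> \<or> i = {\<emptyset>}) \<and> \<langle>n, i\<rangle> \<in> h \<and> (\<forall>j. \<langle>n, j\<rangle> \<in> h \<longrightarrow> j = i))\<close>\<close>
definition is_fun_to_two :: "nat \<Rightarrow> nat \<Rightarrow> lset fm" where
  "is_fun_to_two h w =
    (ForallIn h (ExistsIn (Suc w) (Exists ((is_empty 0 \<^bold>\<or> is_one 0) \<^bold>\<and> is_pair 2 1 0))) \<^bold>\<and>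
     ForallIn w (Exists ((is_empty 0 \<^bold>\<or> is_one 0) \<^bold>\<and> pair_in 1 0 (h + 2) \<^bold>\<and>
                         Forall (pair_in 2 0 (h + 3) \<^bold>\<longrightarrow> 0 \<^bold>= 1))))"

\<comment> \<open>\<open>\<forall>w. w = \<nat> \<longrightarrow> (\<forall>h : w \<rightarrow> 2. \<not> (\<forall>n\<in>w. h(n) = 0) \<longrightarrow> (\<exists>n\<in>w. h(n) = 1))\<close>\<close>
definition MP :: "lset fm" where
  "MP = Forall (is_omega 0 \<^bold>\<longrightarrow> Forall (is_fun_to_two 0 1 \<^bold>\<longrightarrow>
    \<^bold>\<not> ForallIn 1 (Exists (is_empty 0 \<^bold>\<and> pair_in 1 0 2)) \<^bold>\<longrightarrow>
    ExistsIn 1 (Exists (is_one 0 \<^bold>\<and> pair_in 1 0 2))))"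

subsection \<open>The axiom of choice\<close>

text \<open>
  The members of \<open>a\<close> are required to be inhabited; without this requirement, \<open>a = {\<emptyset>}\<close> would
  refute the axiom.
\<close>

\<comment> \<open>\<open>\<forall>a. (\<forall>x\<in>a. \<exists>z. z \<in> x) \<and> (\<forall>x\<in>a. \<forall>y\<in>a. x \<noteq> y \<longrightarrow> x \<inter> y = \<emptyset>) \<longrightarrow>
      (\<exists>b. \<forall>x\<in>a. \<exists>!z\<in>b. z \<in> x)\<close>\<close>
definition AC :: "lset fm" where
  "AC = Forall
    ((ForallIn 0 (Exists (0 \<^bold>\<in> 1)) \<^bold>\<and>
      ForallIn 0 (ForallIn 1 (\<^bold>\<not> (1 \<^bold>= 0) \<^bold>\<longrightarrow> ForallIn 1 (\<^bold>\<not> (0 \<^bold>\<in> 1))))) \<^bold>\<longrightarrow>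
     Exists (ForallIn 1 (ExistsIn 1 (0 \<^bold>\<in> 1 \<^bold>\<and> ForallIn 2 (0 \<^bold>\<in> 2 \<^bold>\<longrightarrow> 0 \<^bold>= 1)))))"

section \<open>Countable transitive models of ZFC\<close>

\<comment> \<open>\<open>\<forall>a. \<exists>y. \<forall>x. x \<in> y \<longleftrightarrow> (\<forall>z\<in>x. z \<in> a)\<close>\<close>
definition ax_power :: "lset fm" where
  "ax_power = Forall (Exists (Forall (0 \<^bold>\<in> 1 \<^bold>\<longleftrightarrow> ForallIn 0 (0 \<^bold>\<in> 3))))"

\<comment> \<open>\<open>\<forall>a. (\<exists>x. x \<in> a) \<longrightarrow> (\<exists>x\<in>a. \<forall>y\<in>x. y \<notin> a)\<close>\<close>
definition ax_foundation :: "lset fm" where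
  "ax_foundation =
    Forall (Exists (0 \<^bold>\<in> 1) \<^bold>\<longrightarrow> ExistsIn 0 (ForallIn 0 (\<^bold>\<not> (0 \<^bold>\<in> 2))))"

\<comment> \<open>\<open>\<forall>a. (\<forall>x\<in>a. \<exists>y. \<phi>(x, y) \<and> (\<forall>y'. \<phi>(x, y') \<longrightarrow> y' = y)) \<longrightarrow>
      (\<exists>b. \<forall>y. y \<in> b \<longleftrightarrow> (\<exists>x\<in>a. \<phi>(x, y)))\<close>\<close>
definition replacement :: "lset fm \<Rightarrow> lset fm" where
  "replacement \<phi> = Forall
    (ForallIn 0 (Exists (args [1, 0] 3 \<phi> \<^bold>\<and> Forall (args [2, 0] 4 \<phi> \<^bold>\<longrightarrow> 0 \<^bold>= 1))) \<^bold>\<longrightarrow>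
     Exists (Forall (0 \<^bold>\<in> 1 \<^bold>\<longleftrightarrow> ExistsIn 2 (args [0, 1] 4 \<phi>))))"

definition ZFC :: "lset fm set" where
  "ZFC =
    {ax_empty, ax_pairing, ax_union, ax_extensionality, ax_infinity, ax_power, ax_foundation, AC}
    \<union> {uclose (separation \<phi>) | \<phi>. wff set_ar \<phi>}
    \<union> {uclose (replacement \<phi>) | \<phi>. wff set_ar \<phi>}"

text \<open>
  The type of hereditarily countable sets. Every countable transitive set consists of hereditarily
  countable sets, so the countable transitive sets are precisely the countable transitive sets of
  elements of this type.
\<close>

datatype hcset = HCSet (elts: "hcset cset")

definition hcmem :: "hcset \<Rightarrow> hcset \<Rightarrow> bool" where
  "hcmem x y \<longleftrightarrow> cin x (elts y)"

text \<open>Classical satisfaction in the structure \<open>(M, \<in>)\<close> under an assignment \<open>e\<close>.\<close>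

primrec sat :: "hcset set \<Rightarrow> (nat \<Rightarrow> hcset) \<Rightarrow> lset fm \<Rightarrow> bool" where
  "sat M e (Atom r ts) =
    (case r of Mem \<Rightarrow> hcmem (e (ts ! 0)) (e (ts ! 1)) | Eq \<Rightarrow> e (ts ! 0) = e (ts ! 1))"
| "sat M e \<^bold>\<bottom> = False"
| "sat M e (\<phi> \<^bold>\<and> \<psi>) = (sat M e \<phi> \<and> sat M e \<psi>)"
| "sat M e (\<phi> \<^bold>\<or> \<psi>) = (sat M e \<phi> \<or> sat M e \<psi>)"
| "sat M e (\<phi> \<^bold>\<longrightarrow> \<psi>) = (sat M e \<phi> \<longrightarrow> sat M e \<psi>)"
| "sat M e (Forall \<phi>) = (\<forall>x\<in>M. sat M (case_nat x e) \<phi>)"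
| "sat M e (Exists \<phi>) = (\<exists>x\<in>M. sat M (case_nat x e) \<phi>)"

definition countable_transitive_model :: "hcset set \<Rightarrow> bool" where
  "countable_transitive_model M \<longleftrightarrow>
    M \<noteq> {} \<and> countable M \<and> (\<forall>y\<in>M. \<forall>x. hcmem x y \<longrightarrow> x \<in> M) \<and>
    (\<forall>\<phi>\<in>ZFC. \<forall>e. range e \<subseteq> M \<longrightarrow> sat M e \<phi>)"

section \<open>Relative first-order logic\<close>

text \<open>
  A signature with relation symbols \<open>'r\<close> is extended by the fresh unary predicate symbol \<open>None\<close>,
  which plays the role of \<open>E\<close>.
\<close>

definition ext_ar :: "('r \<Rightarrow> nat) \<Rightarrow> 'r option \<Rightarrow> nat" where
  "ext_ar ar = case_option 1 ar"

abbreviation E_fm :: "nat \<Rightarrow> 'r option fm" where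
  "E_fm x \<equiv> Atom None [x]"

primrec relativize :: "'r fm \<Rightarrow> 'r option fm" where
  "relativize (Atom r ts) = Atom (Some r) ts"
| "relativize \<^bold>\<bottom> = \<^bold>\<bottom>"
| "relativize (\<phi> \<^bold>\<and> \<psi>) = (relativize \<phi> \<^bold>\<and> relativize \<psi>)"
| "relativize (\<phi> \<^bold>\<or> \<psi>) = (relativize \<phi> \<^bold>\<or> relativize \<psi>)"
| "relativize (\<phi> \<^bold>\<longrightarrow> \<psi>) = (relativize \<phi> \<^bold>\<longrightarrow> relativize \<psi>)"
| "relativize (Forall \<phi>) = Forall (E_fm 0 \<^bold>\<longrightarrow> relativize \<phi>)"
| "relativize (Exists \<phi>) = Exists (E_fm 0 \<^bold>\<and> relativize \<phi>)"

text \<open>The free variables \<open>0, \<dots>, n - 1\<close> of \<open>\<sigma> r\<close> stand for the arguments of the \<open>n\<close>-ary symbol \<open>r\<close>.\<close>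

definition translation :: "('s \<Rightarrow> nat) \<Rightarrow> ('s \<Rightarrow> lset fm) \<Rightarrow> bool" where
  "translation ar \<sigma> \<longleftrightarrow> (\<forall>r. wff set_ar (\<sigma> r) \<and> fv (\<sigma> r) \<subseteq> {..<ar r})"

primrec translate :: "('s \<Rightarrow> lset fm) \<Rightarrow> 's fm \<Rightarrow> lset fm" where
  "translate \<sigma> (Atom r ts) = ren (\<lambda>n. ts ! n) (\<sigma> r)"
| "translate \<sigma> \<^bold>\<bottom> = \<^bold>\<bottom>"
| "translate \<sigma> (\<phi> \<^bold>\<and> \<psi>) = (translate \<sigma> \<phi> \<^bold>\<and> translate \<sigma> \<psi>)"
| "translate \<sigma> (\<phi> \<^bold>\<or> \<psi>) = (translate \<sigma> \<phi> \<^bold>\<or> translate \<sigma> \<psi>)"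
| "translate \<sigma> (\<phi> \<^bold>\<longrightarrow> \<psi>) = (translate \<sigma> \<phi> \<^bold>\<longrightarrow> translate \<sigma> \<psi>)"
| "translate \<sigma> (Forall \<phi>) = Forall (translate \<sigma> \<phi>)"
| "translate \<sigma> (Exists \<phi>) = Exists (translate \<sigma> \<phi>)"

text \<open>
  A formula with free variables is identified with its universal closure, so that its free
  variables range over \<open>E\<close> as well. As usual for first-order logic, domains are inhabited: the relative
  translation is considered under the hypothesis \<open>\<exists>x. E x\<close>. Otherwise, the translation mapping \<open>E x\<close>
  to \<open>\<bottom>\<close> would exclude theorems of intuitionistic first-order logic such as \<open>\<exists>x. P x \<longrightarrow> P x\<close>.
\<close>

definition QL_E :: "('r \<Rightarrow> nat) \<Rightarrow> lset fm set \<Rightarrow> 'r fm set" where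
  "QL_E ar T =
    {\<phi>. wff ar \<phi> \<and>
        (\<forall>\<sigma>. translation (ext_ar ar) \<sigma> \<longrightarrow>
             (T \<turnstile>\<^sub>= translate \<sigma> (Exists (E_fm 0) \<^bold>\<longrightarrow> relativize (uclose \<phi>))))}"

end

theory Submission
  imports Defs
begin

text \<open>If \<open>\<phi>\<close> is not intuitionistically valid, a Kripke model \<open>K\<close> with natural numbers as individuals refutes it.
  No forcing is needed to realize \<open>K\<close> by a Kripke model of set theory: a Kripke model whose domains are
  transitive sets with true membership evaluates bounded formulas classically, so it satisfies all of
  \<open>IKP\<^sup>+ + MP + AC\<close> as soon as each domain is closed under the set operations, satisfies bounded collection
  and choice, and domains grow along the order.
  Inside the countable transitive model take the domains \<open>H(|U\<^sub>t|\<^sup>+)\<close>, the sets of hereditary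
  cardinality at most \<open>|U\<^sub>t|\<close>, where the levels \<open>t\<close> are lists of naturals of a fixed length ordered
  lexicographically and each \<open>U\<^sub>s\<close> contains the power set of \<open>U\<^sub>t\<close> for \<open>t < s\<close>. The nodes are pairs of
  a node of \<open>K\<close> and a level. Whether the domain of some later node is exactly that of a given level is
  expressible, and levels code atoms, so the truth values of \<open>K\<close> can be read off from which levels occur above
  a node. The predicate \<open>E\<close> picks out the numerals of individuals of \<open>K\<close>.\<close>

section \<open>Renaming and derivations\<close>

text \<open>The frame of \<open>K\<close> need not belong to \<open>M\<close>: the axioms are
  checked in each domain separately and domains are compared only by inclusion, so only the levels
  and their domains have to be definable over \<open>M\<close>. \<open>M\<close> is there to supply
  power sets, replacement and choice, since all sets of the ambient type are countable. What a
  formula says must persist to later nodes, but being at a given level does not. An atom is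
  therefore read off negatively: it is true where no later node has a level whose tail codes it. For
  an untrue atom such a level must still lie ahead, however high the present one is; this is why the
  code occupies the tail and the leading entry is a free counter. Levels are lists, not numbers, so
  that a formula can receive the arguments of an atom as numerals entry by entry, without arithmetic
  on codes. The domains are \<open>HC (U t base)\<close> instead of \<open>U t base\<close> because
  collection needs a bound on cardinality, not on rank. Their size also separates the levels: by
  Cantor, no set including the power set of \<open>U t base\<close> is covered by
  \<open>U t base\<close>, so a domain never contains the \<open>U\<close> of a higher
  level.\<close>

lemma ren_cong: "(\<And>n. n \<in> fv \<phi> \<Longrightarrow> f n = g n) \<Longrightarrow> ren f \<phi> = ren g \<phi>"
proof (induction \<phi> arbitrary: f g)
  case (Forall \<phi>)
  have "ren (lift_ren f) \<phi> = ren (lift_ren g) \<phi>"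
  proof (rule Forall.IH)
    show "lift_ren f n = lift_ren g n" if "n \<in> fv \<phi>" for n
      using Forall.prems that by (cases n) auto
  qed
  then show ?case by simp
next
  case (Exists \<phi>)
  have "ren (lift_ren f) \<phi> = ren (lift_ren g) \<phi>"
  proof (rule Exists.IH)
    show "lift_ren f n = lift_ren g n" if "n \<in> fv \<phi>" for n
      using Exists.prems that by (cases n) auto
  qed
  then show ?case by simp
next
  case (Conj \<phi> \<psi>)
  from Conj.IH[of f g] Conj.prems show ?case by auto
next
  case (Disj \<phi> \<psi>)
  from Disj.IH[of f g] Disj.prems show ?case by auto
next
  case (Impl \<phi> \<psi>)
  from Impl.IH[of f g] Impl.prems show ?case by auto
qed auto

lemma lift_ren_comp: "lift_ren f \<circ> lift_ren g = lift_ren (f \<circ> g)"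
proof
  fix n show "(lift_ren f \<circ> lift_ren g) n = lift_ren (f \<circ> g) n" by (cases n) auto
qed

lemma ren_ren: "ren f (ren g \<phi>) = ren (f \<circ> g) \<phi>"
  by (induction \<phi> arbitrary: f g) (simp_all add: lift_ren_comp)

lemma lift_ren_id: "lift_ren (\<lambda>n. n) = (\<lambda>n. n)"
proof
  fix n show "lift_ren (\<lambda>n. n) n = n" by (cases n) auto
qed

lemma ren_id: "ren (\<lambda>n. n) \<phi> = \<phi>"
  by (induction \<phi>) (simp_all add: lift_ren_id)

lemma ren_idI: "(\<And>n. n \<in> fv \<phi> \<Longrightarrow> f n = n) \<Longrightarrow> ren f \<phi> = \<phi>"
  using ren_cong[of \<phi> f "\<lambda>n. n"] ren_id by metis

lemma fv_ren: "fv (ren f \<phi>) = f ` fv \<phi>"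
proof (induction \<phi> arbitrary: f)
  case (Forall \<phi>)
  show ?case
  proof (simp add: Forall.IH, rule set_eqI)
    fix n show "n \<in> {n. Suc n \<in> lift_ren f ` fv \<phi>} \<longleftrightarrow> n \<in> f ` {n. Suc n \<in> fv \<phi>}"
      by (auto simp: image_iff) (metis lift_ren.elims nat.distinct(1) nat.inject, metis lift_ren.simps(2))
  qed
next
  case (Exists \<phi>)
  show ?case
  proof (simp add: Exists.IH, rule set_eqI)
    fix n show "n \<in> {n. Suc n \<in> lift_ren f ` fv \<phi>} \<longleftrightarrow> n \<in> f ` {n. Suc n \<in> fv \<phi>}"
      by (auto simp: image_iff) (metis lift_ren.elims nat.distinct(1) nat.inject, metis lift_ren.simps(2))
  qed
qed (auto simp: image_Un)

lemma wff_ren [simp]: "wff ar (ren f \<phi>) = wff ar \<phi>"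
  by (induction \<phi> arbitrary: f) auto

lemma finite_fv: "finite (fv \<phi>)"
proof (induction \<phi>)
  case (Forall \<phi>)
  have "finite (Suc -` fv \<phi>)" by (rule finite_vimageI[OF Forall.IH]) simp
  then show ?case by (simp add: vimage_def)
next
  case (Exists \<phi>)
  have "finite (Suc -` fv \<phi>)" by (rule finite_vimageI[OF Exists.IH]) simp
  then show ?case by (simp add: vimage_def)
qed auto

lemma inst_ren: "ren f (inst t \<phi>) = inst (f t) (ren (lift_ren f) \<phi>)"
proof -
  have "f \<circ> case_nat t (\<lambda>n. n) = case_nat (f t) (\<lambda>n. n) \<circ> lift_ren f"
  proof
    fix n show "(f \<circ> case_nat t (\<lambda>n. n)) n = (case_nat (f t) (\<lambda>n. n) \<circ> lift_ren f) n"
      by (cases n) auto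
  qed
  then show ?thesis by (simp add: inst_def ren_ren)
qed

lemma ren_lift_Suc: "ren (lift_ren f) (ren Suc \<phi>) = ren Suc (ren f \<phi>)"
proof -
  have "lift_ren f \<circ> Suc = Suc \<circ> f" by auto
  then show ?thesis by (simp add: ren_ren)
qed

lemma image_ren_lift_Suc: "ren (lift_ren f) ` ren Suc ` \<Gamma> = ren Suc ` ren f ` \<Gamma>"
  by (auto simp: image_image ren_lift_Suc)

lemma derives_weaken: "\<Gamma> \<turnstile> \<phi> \<Longrightarrow> \<Gamma> \<subseteq> \<Delta> \<Longrightarrow> \<Delta> \<turnstile> \<phi>"
proof (induction arbitrary: \<Delta> rule: derives.induct)
  case (disjE \<Gamma> \<phi> \<psi> \<chi>)
  show ?case
    by (rule derives.disjE[OF disjE.IH(1)[OF disjE.prems]]; rule disjE.IH) (use disjE.prems in auto)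
next
  case (implI \<phi> \<Gamma> \<psi>)
  show ?case by (rule derives.implI, rule implI.IH) (use implI.prems in auto)
next
  case (forallI \<Gamma> \<phi>)
  show ?case by (rule derives.forallI, rule forallI.IH) (use forallI.prems in auto)
next
  case (existsE \<Gamma> \<phi> \<chi>)
  show ?case
    by (rule derives.existsE[OF existsE.IH(1)[OF existsE.prems]], rule existsE.IH) (use existsE.prems in auto)
qed (blast intro: derives.intros)+

lemma derives_ren: "\<Gamma> \<turnstile> \<phi> \<Longrightarrow> ren f ` \<Gamma> \<turnstile> ren f \<phi>"
proof (induction arbitrary: f rule: derives.induct)
  case (assm \<phi> \<Gamma>)
  then show ?case by (blast intro: derives.assm)
next
  case (disjE \<Gamma> \<phi> \<psi> \<chi>)
  then show ?case using derives.disjE[of "ren f ` \<Gamma>" "ren f \<phi>" "ren f \<psi>"] by simp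
next
  case (implE \<Gamma> \<phi> \<psi>)
  then show ?case using derives.implE[of "ren f ` \<Gamma>" "ren f \<phi>"] by simp
next
  case (forallI \<Gamma> \<phi>)
  then show ?case by (auto intro!: derives.forallI simp: image_ren_lift_Suc[symmetric])
next
  case (forallE \<Gamma> \<phi> t)
  then show ?case using derives.forallE[of "ren f ` \<Gamma>"] by (simp add: inst_ren)
next
  case (existsI \<Gamma> t \<phi>)
  then show ?case using derives.existsI[of "ren f ` \<Gamma>" "f t"] by (simp add: inst_ren)
next
  case (existsE \<Gamma> \<phi> \<chi>)
  have "insert (ren (lift_ren f) \<phi>) (ren Suc ` ren f ` \<Gamma>) \<turnstile> ren Suc (ren f \<chi>)"
    using existsE.IH(2)[of "lift_ren f"] by (simp add: image_ren_lift_Suc ren_lift_Suc)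
  then show ?case using existsE.IH(1)[of f] by (auto intro: derives.existsE)
next
  case (conjE1 \<Gamma> \<phi> \<psi>)
  then show ?case using derives.conjE1[of "ren f ` \<Gamma>" "ren f \<phi>" "ren f \<psi>"] by simp
next
  case (conjE2 \<Gamma> \<phi> \<psi>)
  then show ?case using derives.conjE2[of "ren f ` \<Gamma>" "ren f \<phi>" "ren f \<psi>"] by simp
qed (auto intro: derives.intros)

text \<open>Every derivation uses finitely many hypotheses; in the quantifier rules, a finite part
  of the shifted context comes from a finite part of the context. It serves the limit of the
  Lindenbaum chain and the replacement of hypotheses by derivations in
  \<open>derives_trans\<close>.\<close>

lemma derives_finite: "\<Gamma> \<turnstile> \<phi> \<Longrightarrow> \<exists>\<Gamma>'\<subseteq>\<Gamma>. finite \<Gamma>' \<and> (\<Gamma>' \<turnstile> \<phi>)"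
proof (induction rule: derives.induct)
  case (assm \<phi> \<Gamma>)
  then show ?case by (intro exI[of _ "{\<phi>}"]) (auto intro: derives.assm)
next
  case (conjI \<Gamma> \<phi> \<psi>)
  then obtain G1 G2 where "G1 \<subseteq> \<Gamma>" "finite G1" "G1 \<turnstile> \<phi>" "G2 \<subseteq> \<Gamma>" "finite G2" "G2 \<turnstile> \<psi>" by blast
  then show ?case
    by (intro exI[of _ "G1 \<union> G2"]) (auto intro!: derives.conjI elim: derives_weaken)
next
  case (implE \<Gamma> \<phi> \<psi>)
  then obtain G1 G2 where G: "G1 \<subseteq> \<Gamma>" "finite G1" "G1 \<turnstile> (\<phi> \<^bold>\<longrightarrow> \<psi>)" "G2 \<subseteq> \<Gamma>" "finite G2" "G2 \<turnstile> \<phi>" by blast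
  then have "G1 \<union> G2 \<turnstile> \<psi>"
    using derives.implE[of "G1 \<union> G2" \<phi> \<psi>] derives_weaken[of G1 _ "G1 \<union> G2"] derives_weaken[of G2 _ "G1 \<union> G2"] by auto
  then show ?case using G by (intro exI[of _ "G1 \<union> G2"]) auto
next
  case (disjE \<Gamma> \<phi> \<psi> \<chi>)
  then obtain G1 G2 G3 where G: "G1 \<subseteq> \<Gamma>" "finite G1" "G1 \<turnstile> (\<phi> \<^bold>\<or> \<psi>)"
    "G2 \<subseteq> insert \<phi> \<Gamma>" "finite G2" "G2 \<turnstile> \<chi>" "G3 \<subseteq> insert \<psi> \<Gamma>" "finite G3" "G3 \<turnstile> \<chi>" by blast
  let ?G = "G1 \<union> (G2 - {\<phi>}) \<union> (G3 - {\<psi>})"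
  have "?G \<turnstile> \<chi>"
    by (rule derives.disjE[of _ \<phi> \<psi>])
      (rule derives_weaken[OF G(3)] derives_weaken[OF G(6)] derives_weaken[OF G(9)]; blast)+
  then show ?case using G by (intro exI[of _ ?G]) auto
next
  case (implI \<phi> \<Gamma> \<psi>)
  then obtain G where G: "G \<subseteq> insert \<phi> \<Gamma>" "finite G" "G \<turnstile> \<psi>" by blast
  then have "G - {\<phi>} \<turnstile> (\<phi> \<^bold>\<longrightarrow> \<psi>)" by (intro derives.implI) (auto elim: derives_weaken)
  then show ?case using G by (intro exI[of _ "G - {\<phi>}"]) auto
next
  case (forallI \<Gamma> \<phi>)
  then obtain G where G: "G \<subseteq> ren Suc ` \<Gamma>" "finite G" "G \<turnstile> \<phi>" by blast
  then obtain G' where "G' \<subseteq> \<Gamma>" "finite G'" "G = ren Suc ` G'" by (metis finite_subset_image)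
  then show ?case using G by (intro exI[of _ G']) (auto intro: derives.forallI)
next
  case (existsE \<Gamma> \<phi> \<chi>)
  then obtain G1 G2 where G: "G1 \<subseteq> \<Gamma>" "finite G1" "G1 \<turnstile> Exists \<phi>"
    "G2 \<subseteq> insert \<phi> (ren Suc ` \<Gamma>)" "finite G2" "G2 \<turnstile> ren Suc \<chi>" by blast
  then have "G2 - {\<phi>} \<subseteq> ren Suc ` \<Gamma>" "finite (G2 - {\<phi>})" by auto
  then obtain G' where G': "G' \<subseteq> \<Gamma>" "finite G'" "G2 - {\<phi>} = ren Suc ` G'" by (metis finite_subset_image)
  have "G1 \<union> G' \<turnstile> \<chi>"
  proof (rule derives.existsE[of _ \<phi>])
    show "G1 \<union> G' \<turnstile> Exists \<phi>" by (rule derives_weaken[OF G(3)]) blast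
    show "insert \<phi> (ren Suc ` (G1 \<union> G')) \<turnstile> ren Suc \<chi>"
      by (rule derives_weaken[OF G(6)]) (use G'(3) in auto)
  qed
  then show ?case using G G' by (intro exI[of _ "G1 \<union> G'"]) auto
qed (blast intro: derives.intros)+

lemma derives_cut: "insert \<phi> \<Gamma> \<turnstile> \<psi> \<Longrightarrow> \<Gamma> \<turnstile> \<phi> \<Longrightarrow> \<Gamma> \<turnstile> \<psi>"
  by (rule derives.implE[OF derives.implI])

text \<open>Completeness needs a countable language, so the finitely many symbols of a formula are
  later moved to natural numbers and back.\<close>

lemma derives_map_fm: "\<Gamma> \<turnstile> \<phi> \<Longrightarrow> map_fm g ` \<Gamma> \<turnstile> map_fm g \<phi>"
proof (induction rule: derives.induct)
  have map_ren: "map_fm g (ren f \<phi>) = ren f (map_fm g \<phi>)" for f \<phi>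
    by (induction \<phi> arbitrary: f) auto
  then have im: "map_fm g ` ren Suc ` \<Gamma> = ren Suc ` map_fm g ` \<Gamma>" for \<Gamma>
    by (auto simp: image_image)
  {
    case (assm \<phi> \<Gamma>)
    then show ?case by (blast intro: derives.assm)
  next
    case (disjE \<Gamma> \<phi> \<psi> \<chi>)
    then show ?case using derives.disjE[of "map_fm g ` \<Gamma>" "map_fm g \<phi>" "map_fm g \<psi>"] by simp
  next
    case (forallI \<Gamma> \<phi>)
    then show ?case by (auto intro!: derives.forallI simp: im)
  next
    case (forallE \<Gamma> \<phi> t)
    then show ?case using derives.forallE[of "map_fm g ` \<Gamma>"] by (simp add: inst_def map_ren)
  next
    case (existsI \<Gamma> t \<phi>)
    then show ?case using derives.existsI[of "map_fm g ` \<Gamma>"] by (simp add: inst_def map_ren)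
  next
    case (existsE \<Gamma> \<phi> \<chi>)
    then show ?case using derives.existsE[of "map_fm g ` \<Gamma>" "map_fm g \<phi>"] by (simp add: im map_ren)
  next
    case (implE \<Gamma> \<phi> \<psi>)
    then show ?case using derives.implE[of "map_fm g ` \<Gamma>"] by simp
  next
    case (conjE1 \<Gamma> \<phi> \<psi>)
    then show ?case using derives.conjE1[of "map_fm g ` \<Gamma>"] by simp
  next
    case (conjE2 \<Gamma> \<phi> \<psi>)
    then show ?case using derives.conjE2[of "map_fm g ` \<Gamma>"] by simp
  }
qed (auto intro: derives.intros)

lemma fv_funpow_Forall: "fv ((Forall ^^ n) \<phi>) = {k. k + n \<in> fv \<phi>}"
proof (induction n)
  case (Suc n)
  then show ?case by simp
qed simp

lemma fv_uclose: "fv (uclose \<phi>) = {}"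
proof -
  obtain m where m: "fv \<phi> \<subseteq> {..<m}"
    using finite_fv[of \<phi>] by (meson finite_nat_iff_bounded)
  have "fv \<phi> \<subseteq> {..<LEAST n. fv \<phi> \<subseteq> {..<n}}" by (rule LeastI) (rule m)
  then show ?thesis unfolding uclose_def fv_funpow_Forall by auto
qed

lemma wff_uclose [simp]: "wff ar (uclose \<phi>) = wff ar \<phi>"
proof -
  have "wff ar ((Forall ^^ n) \<phi>) = wff ar \<phi>" for n by (induction n) auto
  then show ?thesis by (simp add: uclose_def)
qed

lemma derives_uclose: "{} \<turnstile> \<phi> \<Longrightarrow> {} \<turnstile> uclose \<phi>"
proof -
  assume a: "{} \<turnstile> \<phi>"
  have "{} \<turnstile> (Forall ^^ n) \<phi>" for n
  proof (induction n)
    case (Suc n)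
    then show ?case using derives.forallI[of "{}"] by simp
  qed (simp add: a)
  then show ?thesis by (simp add: uclose_def)
qed

section \<open>Relativized theorems of intuitionistic logic\<close>

lemma relativize_ren: "relativize (ren f \<phi>) = ren f (relativize \<phi>)"
  by (induction \<phi> arbitrary: f) auto

lemma wff_relativize [simp]: "wff (ext_ar ar) (relativize \<phi>) = wff ar \<phi>"
  by (induction \<phi>) (auto simp: ext_ar_def)

lemma fv_relativize [simp]: "fv (relativize \<phi>) = fv \<phi>"
  by (induction \<phi>) auto

text \<open>The hypotheses \<open>range E_fm\<close> keep all variables inside \<open>E\<close>.
  Below a quantifier they split into the shifted old ones and \<open>E_fm 0\<close> for the new
  variable, and the latter is exactly what the guard of the relativized quantifier provides.\<close>

lemma derives_relativize:
  "\<Gamma> \<turnstile> \<phi> \<Longrightarrow> relativize ` \<Gamma> \<union> range E_fm \<turnstile> relativize \<phi>"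
proof (induction rule: derives.induct)
  have im: "relativize ` ren Suc ` \<Gamma> = ren Suc ` relativize ` \<Gamma>" for \<Gamma> :: "'a fm set"
    by (auto simp: image_image relativize_ren)
  have rE: "range E_fm = insert (E_fm 0) (ren Suc ` range E_fm)" for x :: 'a
    by (auto simp: image_iff) (metis not0_implies_Suc)
  have up: "relativize ` ren Suc ` \<Gamma> \<union> range E_fm = insert (E_fm 0) (ren Suc ` (relativize ` \<Gamma> \<union> range E_fm))"
    for \<Gamma> :: "'a fm set"
    by (subst rE) (simp add: im image_Un)
  {
    case (assm \<phi> \<Gamma>)
    then show ?case by (blast intro: derives.assm)
  next
    case (disjE \<Gamma> \<phi> \<psi> \<chi>)
    then show ?case using derives.disjE[of "relativize ` \<Gamma> \<union> range E_fm" "relativize \<phi>"] by simp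
  next
    case (implE \<Gamma> \<phi> \<psi>)
    then show ?case using derives.implE[of "relativize ` \<Gamma> \<union> range E_fm" "relativize \<phi>"] by simp
  next
    case (forallI \<Gamma> \<phi>)
    then show ?case by (auto intro!: derives.forallI derives.implI simp: up)
  next
    case (forallE \<Gamma> \<phi> t)
    let ?G = "relativize ` \<Gamma> \<union> range E_fm"
    have "?G \<turnstile> inst t (E_fm 0 \<^bold>\<longrightarrow> relativize \<phi>)" using forallE.IH by (auto intro: derives.forallE)
    moreover have "?G \<turnstile> inst t (E_fm 0)" by (auto intro: derives.assm simp: inst_def)
    ultimately show ?case
      by (auto simp: inst_def relativize_ren intro: derives.implE)
  next
    case (existsI \<Gamma> t \<phi>)
    let ?G = "relativize ` \<Gamma> \<union> range E_fm"
    have "?G \<turnstile> inst t (E_fm 0)" by (auto intro: derives.assm simp: inst_def)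
    then have "?G \<turnstile> inst t (E_fm 0 \<^bold>\<and> relativize \<phi>)"
      using existsI.IH by (auto simp: inst_def relativize_ren intro: derives.conjI)
    then show ?case by (auto intro: derives.existsI)
  next
    case (existsE \<Gamma> \<phi> \<chi>)
    let ?G = "relativize ` \<Gamma> \<union> range E_fm"
    let ?H = "insert (E_fm 0 \<^bold>\<and> relativize \<phi>) (ren Suc ` ?G)"
    have "insert (relativize \<phi>) (insert (E_fm 0) (ren Suc ` ?G)) \<turnstile> ren Suc (relativize \<chi>)"
      using existsE.IH(2) by (simp add: up[symmetric] relativize_ren)
    then have 1: "insert (relativize \<phi>) (insert (E_fm 0) ?H) \<turnstile> ren Suc (relativize \<chi>)"
      by (rule derives_weaken) auto
    have a: "?H \<turnstile> (E_fm 0 \<^bold>\<and> relativize \<phi>)" by (rule derives.assm) simp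
    have "insert (E_fm 0) ?H \<turnstile> ren Suc (relativize \<chi>)"
      by (rule derives_cut[OF 1]) (rule derives_weaken[OF derives.conjE2[OF a]], auto)
    then have "?H \<turnstile> ren Suc (relativize \<chi>)"
      by (rule derives_cut) (rule derives.conjE1[OF a])
    then show ?case using existsE.IH(1) by (auto intro: derives.existsE)
  next
    case (conjE1 \<Gamma> \<phi> \<psi>)
    then show ?case using derives.conjE1[of "relativize ` \<Gamma> \<union> range E_fm" "relativize \<phi>"] by simp
  next
    case (conjE2 \<Gamma> \<phi> \<psi>)
    then show ?case using derives.conjE2[of "relativize ` \<Gamma> \<union> range E_fm" "relativize \<phi>"] by simp
  }
qed (auto intro: derives.intros)

text \<open>A derivation of a sentence may pass through free variables, so its relativization relies
  on hypotheses \<open>E x\<close> for them. Renaming all variables to \<open>0\<close> merges these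
  into one, which \<open>Exists (E_fm 0)\<close> discharges.\<close>

lemma derives_relativize_sentence:
  assumes "{} \<turnstile> \<phi>"
  shows "{} \<turnstile> (Exists (E_fm 0) \<^bold>\<longrightarrow> relativize (uclose \<phi>))"
proof -
  let ?c = "relativize (uclose \<phi>)"
  have ren: "ren f ?c = ?c" for f by (rule ren_idI) (simp add: fv_uclose)
  have "range E_fm \<turnstile> ?c" using derives_relativize[OF derives_uclose[OF assms]] by simp
  from derives_ren[OF this, of "\<lambda>_. 0"] have "{E_fm 0} \<turnstile> ?c" by (simp add: ren image_image)
  then have "insert (E_fm 0) (ren Suc ` {Exists (E_fm 0)}) \<turnstile> ren Suc ?c"
    by (auto simp: ren elim: derives_weaken)
  then show ?thesis by (blast intro: derives.implI derives.existsE derives.assm)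
qed

text \<open>Derivations may pass through atoms with the wrong number of arguments, on which
  \<^const>\<open>translate\<close> does not commute with renamings; these are sent to \<open>\<bottom>\<close>.\<close>

primrec safe_translate :: "('s \<Rightarrow> nat) \<Rightarrow> ('s \<Rightarrow> lset fm) \<Rightarrow> 's fm \<Rightarrow> lset fm" where
  "safe_translate ar \<sigma> (Atom r ts) = (if length ts = ar r then ren (\<lambda>n. ts ! n) (\<sigma> r) else \<^bold>\<bottom>)"
| "safe_translate ar \<sigma> \<^bold>\<bottom> = \<^bold>\<bottom>"
| "safe_translate ar \<sigma> (\<phi> \<^bold>\<and> \<psi>) = (safe_translate ar \<sigma> \<phi> \<^bold>\<and> safe_translate ar \<sigma> \<psi>)"
| "safe_translate ar \<sigma> (\<phi> \<^bold>\<or> \<psi>) = (safe_translate ar \<sigma> \<phi> \<^bold>\<or> safe_translate ar \<sigma> \<psi>)"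
| "safe_translate ar \<sigma> (\<phi> \<^bold>\<longrightarrow> \<psi>) = (safe_translate ar \<sigma> \<phi> \<^bold>\<longrightarrow> safe_translate ar \<sigma> \<psi>)"
| "safe_translate ar \<sigma> (Forall \<phi>) = Forall (safe_translate ar \<sigma> \<phi>)"
| "safe_translate ar \<sigma> (Exists \<phi>) = Exists (safe_translate ar \<sigma> \<phi>)"

lemma safe_translate_wff: "wff ar \<phi> \<Longrightarrow> safe_translate ar \<sigma> \<phi> = translate \<sigma> \<phi>"
  by (induction \<phi>) auto

lemma safe_translate_ren:
  assumes "translation ar \<sigma>"
  shows "safe_translate ar \<sigma> (ren f \<phi>) = ren f (safe_translate ar \<sigma> \<phi>)"
proof (induction \<phi> arbitrary: f)
  case (Atom r ts)
  then show ?case using assms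
    by (auto simp: ren_ren translation_def subset_iff intro!: ren_cong)
qed auto

lemma derives_safe_translate:
  assumes "translation ar \<sigma>"
  shows "\<Gamma> \<turnstile> \<phi> \<Longrightarrow> safe_translate ar \<sigma> ` \<Gamma> \<turnstile> safe_translate ar \<sigma> \<phi>"
proof (induction rule: derives.induct)
  note tr = safe_translate_ren[OF assms]
  have im: "safe_translate ar \<sigma> ` ren Suc ` \<Gamma> = ren Suc ` safe_translate ar \<sigma> ` \<Gamma>" for \<Gamma>
    by (auto simp: image_image tr)
  {
    case (assm \<phi> \<Gamma>)
    then show ?case by (blast intro: derives.assm)
  next
    case (disjE \<Gamma> \<phi> \<psi> \<chi>)
    then show ?case using derives.disjE[of "safe_translate ar \<sigma> ` \<Gamma>" "safe_translate ar \<sigma> \<phi>"] by simp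
  next
    case (forallI \<Gamma> \<phi>)
    then show ?case by (auto intro!: derives.forallI simp: im)
  next
    case (forallE \<Gamma> \<phi> t)
    then show ?case using derives.forallE[of "safe_translate ar \<sigma> ` \<Gamma>"] by (simp add: inst_def tr)
  next
    case (existsI \<Gamma> t \<phi>)
    then show ?case using derives.existsI[of "safe_translate ar \<sigma> ` \<Gamma>"] by (simp add: inst_def tr)
  next
    case (existsE \<Gamma> \<phi> \<chi>)
    then show ?case using derives.existsE[of "safe_translate ar \<sigma> ` \<Gamma>" "safe_translate ar \<sigma> \<phi>"]
      by (simp add: im tr)
  next
    case (implE \<Gamma> \<phi> \<psi>)
    then show ?case using derives.implE[of "safe_translate ar \<sigma> ` \<Gamma>"] by simp
  next
    case (conjE1 \<Gamma> \<phi> \<psi>)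
    then show ?case using derives.conjE1[of "safe_translate ar \<sigma> ` \<Gamma>"] by simp
  next
    case (conjE2 \<Gamma> \<phi> \<psi>)
    then show ?case using derives.conjE2[of "safe_translate ar \<sigma> ` \<Gamma>"] by simp
  }
qed (auto intro: derives.intros)

lemma IQC_subset_QL_E: "IQC ar \<subseteq> QL_E ar T"
proof (clarsimp simp: IQC_def QL_E_def)
  fix \<phi> :: "'a fm" and \<sigma>
  assume \<phi>: "wff ar \<phi>" "{} \<turnstile> \<phi>" and \<sigma>: "translation (ext_ar ar) \<sigma>"
  let ?c = "Exists (E_fm 0) \<^bold>\<longrightarrow> relativize (uclose \<phi>)"
  have "{} \<turnstile> safe_translate (ext_ar ar) \<sigma> ?c"
    using derives_safe_translate[OF \<sigma> derives_relativize_sentence[OF \<phi>(2)]] by simp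
  moreover have "wff (ext_ar ar) ?c" using \<phi>(1) by (simp, simp add: ext_ar_def)
  ultimately have "{} \<turnstile> translate \<sigma> ?c" by (metis safe_translate_wff)
  then have "T \<turnstile>\<^sub>= translate \<sigma> ?c" unfolding set_derives_def by (rule derives_weaken) simp
  then show "T \<turnstile>\<^sub>= (Exists (ren ((!) [0]) (\<sigma> None)) \<^bold>\<longrightarrow> translate \<sigma> (relativize (uclose \<phi>)))" by simp
qed

section \<open>Kripke semantics\<close>

lemma range_case_nat [simp]: "range (case_nat d e) \<subseteq> S \<longleftrightarrow> d \<in> S \<and> range e \<subseteq> S"
  by (auto simp: image_subset_iff split: nat.split)

text \<open>The nodes are the \<open>v\<close> with \<open>le v v\<close>, so no separate set of nodes is needed.\<close>

locale kripke =
  fixes le :: "'w \<Rightarrow> 'w \<Rightarrow> bool" and D :: "'w \<Rightarrow> 'd set" and I :: "'w \<Rightarrow> 'r \<Rightarrow> 'd list \<Rightarrow> bool"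
  assumes le_trans: "le u v \<Longrightarrow> le v w \<Longrightarrow> le u w"
    and le_refl1: "le u v \<Longrightarrow> le u u"
    and le_refl2: "le u v \<Longrightarrow> le v v"
    and D_mono: "le u v \<Longrightarrow> D u \<subseteq> D v"
    and I_mono: "le u v \<Longrightarrow> I u r ds \<Longrightarrow> I v r ds"
begin

primrec forces :: "'w \<Rightarrow> (nat \<Rightarrow> 'd) \<Rightarrow> 'r fm \<Rightarrow> bool" where
  "forces v e (Atom r ts) = I v r (map e ts)"
| "forces v e \<^bold>\<bottom> = False"
| "forces v e (\<phi> \<^bold>\<and> \<psi>) = (forces v e \<phi> \<and> forces v e \<psi>)"
| "forces v e (\<phi> \<^bold>\<or> \<psi>) = (forces v e \<phi> \<or> forces v e \<psi>)"
| "forces v e (\<phi> \<^bold>\<longrightarrow> \<psi>) = (\<forall>w. le v w \<longrightarrow> forces w e \<phi> \<longrightarrow> forces w e \<psi>)"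
| "forces v e (Forall \<phi>) = (\<forall>w. le v w \<longrightarrow> (\<forall>d\<in>D w. forces w (case_nat d e) \<phi>))"
| "forces v e (Exists \<phi>) = (\<exists>d\<in>D v. forces v (case_nat d e) \<phi>)"

lemma forces_mono: "forces u e \<phi> \<Longrightarrow> le u v \<Longrightarrow> forces v e \<phi>"
proof (induction \<phi> arbitrary: u v e)
  case (Exists \<phi>)
  then show ?case using D_mono by fastforce
qed (auto intro: I_mono le_trans)

lemma case_nat_lift_ren: "case_nat d e \<circ> lift_ren f = case_nat d (e \<circ> f)"
proof
  fix n show "(case_nat d e \<circ> lift_ren f) n = case_nat d (e \<circ> f) n" by (cases n) auto
qed

lemma forces_ren: "forces v e (ren f \<phi>) = forces v (e \<circ> f) \<phi>"
  by (induction \<phi> arbitrary: v e f) (auto simp: case_nat_lift_ren)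

lemma forces_cong: "(\<And>n. n \<in> fv \<phi> \<Longrightarrow> e n = e' n) \<Longrightarrow> forces v e \<phi> = forces v e' \<phi>"
proof (induction \<phi> arbitrary: v e e')
  case (Atom r ts)
  then have "map e ts = map e' ts" by simp
  then show ?case by (simp del: map_eq_conv)
next
  case (Conj \<phi> \<psi>)
  from Conj.IH[of e e'] Conj.prems show ?case by auto
next
  case (Disj \<phi> \<psi>)
  from Disj.IH[of e e'] Disj.prems show ?case by auto
next
  case (Impl \<phi> \<psi>)
  from Impl.IH[of e e'] Impl.prems show ?case by auto
next
  case (Forall \<phi>)
  have "forces w (case_nat d e) \<phi> = forces w (case_nat d e') \<phi>" for w d
    by (rule Forall.IH) (use Forall.prems in \<open>auto split: nat.split\<close>)
  then show ?case by simp
next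
  case (Exists \<phi>)
  have "forces w (case_nat d e) \<phi> = forces w (case_nat d e') \<phi>" for w d
    by (rule Exists.IH) (use Exists.prems in \<open>auto split: nat.split\<close>)
  then show ?case by simp
qed auto

lemma forces_ren_Suc [simp]: "forces v (case_nat d e) (ren Suc \<phi>) = forces v e \<phi>"
  unfolding forces_ren by (rule forces_cong) simp

lemma forces_inst: "forces v e (inst t \<phi>) = forces v (case_nat (e t) e) \<phi>"
  unfolding inst_def forces_ren by (rule forces_cong) (simp split: nat.split)

lemma soundness:
  "\<Gamma> \<turnstile> \<phi> \<Longrightarrow> le v v \<Longrightarrow> range e \<subseteq> D v \<Longrightarrow> (\<And>\<gamma>. \<gamma> \<in> \<Gamma> \<Longrightarrow> forces v e \<gamma>) \<Longrightarrow> forces v e \<phi>"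
proof (induction arbitrary: v e rule: derives.induct)
  case (disjE \<Gamma> \<phi> \<psi> \<chi>)
  have "forces v e (\<phi> \<^bold>\<or> \<psi>)" by (rule disjE.IH(1)[OF disjE.prems])
  then have "forces v e \<phi> \<or> forces v e \<psi>" by simp
  then show ?case
  proof
    assume "forces v e \<phi>" then show ?thesis using disjE.prems by (intro disjE.IH(2)) auto
  next
    assume "forces v e \<psi>" then show ?thesis using disjE.prems by (intro disjE.IH(3)) auto
  qed
next
  case (implI \<phi> \<Gamma> \<psi>)
  have "forces w e \<psi>" if w: "le v w" "forces w e \<phi>" for w
  proof (rule implI.IH)
    show "le w w" using w by (blast intro: le_refl2)
    show "range e \<subseteq> D w" using implI.prems D_mono w by blast
    show "forces w e \<gamma>" if "\<gamma> \<in> insert \<phi> \<Gamma>" for \<gamma>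
      using that w implI.prems by (auto intro: forces_mono)
  qed
  then show ?case by simp
next
  case (implE \<Gamma> \<phi> \<psi>)
  then have "forces v e (\<phi> \<^bold>\<longrightarrow> \<psi>)" "forces v e \<phi>" by blast+
  then show ?case using implE.prems by auto
next
  case (forallI \<Gamma> \<phi>)
  have "forces w (case_nat d e) \<phi>" if w: "le v w" "d \<in> D w" for w d
  proof (rule forallI.IH)
    show "le w w" using w by (blast intro: le_refl2)
    show "range (case_nat d e) \<subseteq> D w" using forallI.prems D_mono[OF w(1)] w by auto
    show "forces w (case_nat d e) \<gamma>" if "\<gamma> \<in> ren Suc ` \<Gamma>" for \<gamma>
      using that forallI.prems by (auto intro: forces_mono[OF _ w(1)])
  qed
  then show ?case by simp
next
  case (forallE \<Gamma> \<phi> t)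
  then have "forces v e (Forall \<phi>)" by blast
  moreover have "e t \<in> D v" using forallE.prems by blast
  ultimately show ?case using forallE.prems by (simp add: forces_inst)
next
  case (existsI \<Gamma> t \<phi>)
  then have "forces v e (inst t \<phi>)" by blast
  then show ?case using existsI.prems by (auto simp: forces_inst)
next
  case (existsE \<Gamma> \<phi> \<chi>)
  have "forces v e (Exists \<phi>)" by (rule existsE.IH(1)[OF existsE.prems])
  then obtain d where d: "d \<in> D v" "forces v (case_nat d e) \<phi>" by auto
  have "forces v (case_nat d e) (ren Suc \<chi>)"
  proof (rule existsE.IH(2))
    show "range (case_nat d e) \<subseteq> D v" using existsE.prems d by simp
    show "forces v (case_nat d e) \<gamma>" if "\<gamma> \<in> insert \<phi> (ren Suc ` \<Gamma>)" for \<gamma>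
      using that d existsE.prems by auto
  qed (rule existsE.prems)
  then show ?case by simp
qed fastforce+

lemma forces_funpow_Forall:
  "forces v e ((Forall ^^ n) \<phi>) \<Longrightarrow> le v v \<Longrightarrow> range e \<subseteq> D v \<Longrightarrow> range e' \<subseteq> D v \<Longrightarrow>
    forces v (\<lambda>k. if k < n then e' k else e (k - n)) \<phi>"
proof (induction n arbitrary: e)
  case (Suc n)
  \<comment> \<open>The outermost of the \<open>Suc n\<close> quantifiers binds the variable that
    has index \<open>n\<close> under all of them.\<close>
  let ?e = "case_nat (e' n) e"
  have "e' n \<in> D v" using Suc.prems(4) by blast
  then have "forces v ?e ((Forall ^^ n) \<phi>)" using Suc.prems by simp
  moreover have "range ?e \<subseteq> D v" using Suc.prems \<open>e' n \<in> D v\<close> by simp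
  ultimately have "forces v (\<lambda>k. if k < n then e' k else ?e (k - n)) \<phi>" using Suc by blast
  moreover have "(\<lambda>k. if k < n then e' k else ?e (k - n)) = (\<lambda>k. if k < Suc n then e' k else e (k - Suc n))"
    by (auto simp: fun_eq_iff less_Suc_eq split: nat.split) (metis Suc_diff_Suc nat.inject not_less_eq linorder_neqE_nat diff_is_0_eq' diff_Suc_Suc zero_less_diff)+
  ultimately show ?case by simp
qed simp

lemma forces_funpow_ForallI:
  "(\<And>w e. le v w \<Longrightarrow> range e \<subseteq> D w \<Longrightarrow> forces w e \<phi>) \<Longrightarrow> le v v \<Longrightarrow> range e \<subseteq> D v \<Longrightarrow>
    forces v e ((Forall ^^ n) \<phi>)"
proof (induction n arbitrary: v e)
  case (Suc n)
  have "forces w (case_nat d e) ((Forall ^^ n) \<phi>)" if "le v w" "d \<in> D w" for w d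
  proof (rule Suc.IH)
    show "range (case_nat d e) \<subseteq> D w" using Suc.prems(3) that D_mono[OF that(1)] by auto
  qed (use Suc.prems that in \<open>auto intro: le_trans le_refl2\<close>)
  then show ?case by simp
qed simp

text \<open>As a closure has no free variables, its assignment can be exchanged at will:
  \<open>e'\<close> is used both for the instances and for the variables beyond them, and a constant
  assignment into the inhabited domain starts the converse.\<close>

lemma forces_uclose:
  assumes "le v v" "D v \<noteq> {}"
  shows "forces v e (uclose \<phi>) \<longleftrightarrow> (\<forall>w e. le v w \<longrightarrow> range e \<subseteq> D w \<longrightarrow> forces w e \<phi>)"
proof -
  define n where "n = (LEAST n. fv \<phi> \<subseteq> {..<n})"
  obtain m where m: "fv \<phi> \<subseteq> {..<m}"
    using finite_fv[of \<phi>] by (meson finite_nat_iff_bounded)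
  have n: "fv \<phi> \<subseteq> {..<n}" unfolding n_def by (rule LeastI) (rule m)
  obtain d where d: "d \<in> D v" using assms by blast
  have closed: "forces w e (uclose \<phi>) = forces w e' (uclose \<phi>)" for w e e'
    by (rule forces_cong) (simp add: fv_uclose)
  have "forces w e' \<phi>" if f: "forces v e (uclose \<phi>)" and w: "le v w" "range e' \<subseteq> D w" for w e'
  proof -
    have "forces w e' ((Forall ^^ n) \<phi>)"
      using forces_mono[OF f w(1)] closed[of w e e'] by (simp add: uclose_def n_def)
    from forces_funpow_Forall[OF this le_refl2[OF w(1)] w(2) w(2)]
    show ?thesis by (subst forces_cong) (use n in auto)
  qed
  moreover have "forces v e (uclose \<phi>)"
    if "\<And>w e. le v w \<Longrightarrow> range e \<subseteq> D w \<Longrightarrow> forces w e \<phi>"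
  proof -
    have "forces v (\<lambda>_. d) (uclose \<phi>)"
      unfolding uclose_def n_def[symmetric] by (rule forces_funpow_ForallI) (use that assms d in auto)
    then show ?thesis using closed by blast
  qed
  ultimately show ?thesis by blast
qed

end

section \<open>Completeness of intuitionistic logic\<close>

instance fm :: (countable) countable
  by countable_datatype

text \<open>Variables double as individuals, with \<open>X\<close> as the domain of the node. It
  must be coinfinite to leave fresh names for the larger domains of later nodes. The clauses on
  disjunction and \<open>Exists\<close> are what forcing demands of these connectives.\<close>

definition prime_theory :: "nat set \<Rightarrow> 'r fm set \<Rightarrow> bool" where
  "prime_theory X \<Gamma> \<longleftrightarrow> (\<forall>\<phi>\<in>\<Gamma>. fv \<phi> \<subseteq> X) \<and> \<not> (\<Gamma> \<turnstile> \<^bold>\<bottom>) \<and> (\<forall>\<phi>. (\<Gamma> \<turnstile> \<phi>) \<longrightarrow> fv \<phi> \<subseteq> X \<longrightarrow> \<phi> \<in> \<Gamma>) \<and>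
    (\<forall>\<phi> \<psi>. (\<phi> \<^bold>\<or> \<psi>) \<in> \<Gamma> \<longrightarrow> \<phi> \<in> \<Gamma> \<or> \<psi> \<in> \<Gamma>) \<and>
    (\<forall>\<phi>. Exists \<phi> \<in> \<Gamma> \<longrightarrow> (\<exists>x\<in>X. inst x \<phi> \<in> \<Gamma>)) \<and> infinite (- X) \<and> X \<noteq> {}"

lemma fv_inst: "fv (inst t \<phi>) \<subseteq> insert t (fv (Exists \<phi>))"
  by (auto simp: inst_def fv_ren split: nat.split nat.split_asm)

text \<open>\<open>inst y\<close> replaces index \<open>0\<close> by the fresh variable
  \<open>y\<close>; this renaming sends \<open>y\<close> back to \<open>0\<close> and shifts
  everything else. It turns a named fresh variable into the eigenvariable of \<open>forallI\<close>
  and \<open>existsE\<close>.\<close>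

lemma ren_fresh:
  assumes "Suc y \<notin> fv \<phi>"
  shows "ren (\<lambda>n. if n = y then 0 else Suc n) (inst y \<phi>) = \<phi>"
  unfolding inst_def ren_ren by (rule ren_idI) (use assms in \<open>auto split: nat.split\<close>)

lemma ren_fresh_Suc:
  assumes "y \<notin> fv \<phi>"
  shows "ren (\<lambda>n. if n = y then 0 else Suc n) \<phi> = ren Suc \<phi>"
  by (rule ren_cong) (use assms in auto)

lemma image_ren_fresh_Suc:
  "(\<And>\<gamma>. \<gamma> \<in> \<Gamma> \<Longrightarrow> y \<notin> fv \<gamma>) \<Longrightarrow> ren (\<lambda>n. if n = y then 0 else Suc n) ` \<Gamma> = ren Suc ` \<Gamma>"
  by (rule image_cong) (auto intro: ren_fresh_Suc)

lemma derives_fresh_generalize: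
  assumes "\<Gamma> \<turnstile> inst y \<phi>" "Suc y \<notin> fv \<phi>" "\<And>\<gamma>. \<gamma> \<in> \<Gamma> \<Longrightarrow> y \<notin> fv \<gamma>"
  shows "\<Gamma> \<turnstile> Forall \<phi>"
  using derives_ren[OF assms(1), of "\<lambda>n. if n = y then 0 else Suc n"] assms
  by (intro derives.forallI) (simp add: ren_fresh image_ren_fresh_Suc)

lemma derives_fresh_witness:
  assumes "insert (inst y \<phi>) \<Gamma> \<turnstile> \<psi>" and e: "\<Gamma> \<turnstile> Exists \<phi>"
    and y: "y \<notin> fv (Exists \<phi>)" "\<And>\<gamma>. \<gamma> \<in> \<Gamma> \<Longrightarrow> y \<notin> fv \<gamma>" "y \<notin> fv \<psi>"
  shows "\<Gamma> \<turnstile> \<psi>"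
  using derives_ren[OF assms(1), of "\<lambda>n. if n = y then 0 else Suc n"] y
  by (intro derives.existsE[OF e]) (simp add: ren_fresh image_ren_fresh_Suc ren_fresh_Suc)

lemma infinite_split:
  assumes "infinite (S :: nat set)"
  obtains Y where "Y \<subseteq> S" "infinite Y" "infinite (S - Y)"
proof
  let ?g = "enumerate S"
  let ?Y = "?g ` {n. even n}" and ?Z = "?g ` {n. odd n}"
  have inj: "inj ?g" using assms by (simp add: inj_enumerate)
  have inf: "infinite {n::nat. even n}" "infinite {n::nat. odd n}"
    unfolding infinite_nat_iff_unbounded_le
    by (rule allI, rule_tac x = "2 * m" in exI, simp) (rule allI, rule_tac x = "Suc (2 * m)" in exI, simp)
  show "?Y \<subseteq> S" using assms by (auto intro: enumerate_in_set)
  show "infinite ?Y" using inf(1) inj by (meson finite_imageD inj_on_subset subset_UNIV)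
  have "?Z \<subseteq> S - ?Y" using assms inj by (auto intro: enumerate_in_set dest: injD)
  moreover have "infinite ?Z" using inf(2) inj by (meson finite_imageD inj_on_subset subset_UNIV)
  ultimately show "infinite (S - ?Y)" by (meson finite_subset)
qed

text \<open>Stage \<open>n\<close> decides the \<open>n\<close>-th formula, adding it if this keeps \<open>\<psi>\<close> underivable; an added existential
  formula is given a fresh witness.\<close>

primrec lindenbaum :: "nat set \<Rightarrow> 'r::countable fm set \<Rightarrow> 'r fm \<Rightarrow> nat \<Rightarrow> 'r fm set" where
  "lindenbaum X \<Gamma> \<psi> 0 = \<Gamma>"
| "lindenbaum X \<Gamma> \<psi> (Suc n) =
    (let \<Delta> = lindenbaum X \<Gamma> \<psi> n; \<chi> = from_nat n in
     if fv \<chi> \<subseteq> X \<and> \<not> (insert \<chi> \<Delta> \<turnstile> \<psi>)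
     then insert \<chi> \<Delta> \<union> (case \<chi> of Exists \<phi> \<Rightarrow>
       {inst (SOME y. y \<in> X \<and> y \<notin> fv \<chi> \<union> fv \<psi> \<union> \<Union> (fv ` \<Delta>)) \<phi>} | _ \<Rightarrow> {})
     else \<Delta>)"

text \<open>A stage adds one formula and at most one witness, so only finitely many variables
  outside \<open>X0\<close> occur so far and the infinite reserve \<open>Y - X0\<close> contains a
  fresh one. By \<open>derives_fresh_witness\<close>, a fresh witness for an existential formula
  already present does not make \<open>\<psi>\<close> derivable.\<close>

lemma lindenbaum_invariant:
  assumes "\<And>\<gamma>. \<gamma> \<in> \<Gamma> \<Longrightarrow> fv \<gamma> \<subseteq> X0" "X0 \<union> Y \<subseteq> X" "infinite (Y - X0)" "\<not> (\<Gamma> \<turnstile> \<psi>)"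
  defines "L \<equiv> lindenbaum X \<Gamma> \<psi>"
  shows "\<not> (L n \<turnstile> \<psi>) \<and> (\<forall>\<gamma>\<in>L n. fv \<gamma> \<subseteq> X) \<and> (\<exists>F. finite F \<and> (\<forall>\<gamma>\<in>L n. fv \<gamma> \<subseteq> X0 \<union> F)) \<and>
    (\<forall>\<phi>. from_nat n = Exists \<phi> \<longrightarrow> fv (Exists \<phi>) \<subseteq> X \<longrightarrow> \<not> (insert (Exists \<phi>) (L n) \<turnstile> \<psi>) \<longrightarrow> (\<exists>x\<in>X. inst x \<phi> \<in> L (Suc n)))"
proof (induction n)
  have step: "\<not> (L (Suc n) \<turnstile> \<psi>) \<and> (\<forall>\<gamma>\<in>L (Suc n). fv \<gamma> \<subseteq> X) \<and>
      (\<exists>F. finite F \<and> (\<forall>\<gamma>\<in>L (Suc n). fv \<gamma> \<subseteq> X0 \<union> F)) \<and>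
      (\<forall>\<phi>. from_nat n = Exists \<phi> \<longrightarrow> fv (Exists \<phi>) \<subseteq> X \<longrightarrow> \<not> (insert (Exists \<phi>) (L n) \<turnstile> \<psi>) \<longrightarrow> (\<exists>x\<in>X. inst x \<phi> \<in> L (Suc n)))"
    if IH: "\<not> (L n \<turnstile> \<psi>)" "\<forall>\<gamma>\<in>L n. fv \<gamma> \<subseteq> X" "\<exists>F. finite F \<and> (\<forall>\<gamma>\<in>L n. fv \<gamma> \<subseteq> X0 \<union> F)" for n
  proof -
    obtain F where F: "finite F" "\<forall>\<gamma>\<in>L n. fv \<gamma> \<subseteq> X0 \<union> F" using IH by blast
    define \<chi> :: "'a fm" where "\<chi> = from_nat n"
    show ?thesis
    proof (cases "fv \<chi> \<subseteq> X \<and> \<not> (insert \<chi> (L n) \<turnstile> \<psi>)")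
      case False
      then have "L (Suc n) = L n" by (auto simp: L_def Let_def \<chi>_def)
      then show ?thesis using IH False by (auto simp: \<chi>_def)
    next
      case True
      show ?thesis
      proof (cases "\<exists>\<phi>. \<chi> = Exists \<phi>")
        case False
        then have "L (Suc n) = insert \<chi> (L n)"
          using True by (auto simp: L_def Let_def \<chi>_def split: fm.split)
        moreover have "\<forall>\<gamma>\<in>insert \<chi> (L n). fv \<gamma> \<subseteq> X0 \<union> (F \<union> fv \<chi>)" using F by auto
        moreover have "finite (F \<union> fv \<chi>)" using F finite_fv by auto
        ultimately show ?thesis using IH True False by (auto simp: \<chi>_def)
      next
        case ex: True
        then obtain \<phi> where \<phi>: "\<chi> = Exists \<phi>" by blast
        define y where "y = (SOME y. y \<in> X \<and> y \<notin> fv \<chi> \<union> fv \<psi> \<union> \<Union> (fv ` L n))"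
        have "infinite ((Y - X0) - (F \<union> fv \<chi> \<union> fv \<psi>))" 
          by (rule Diff_infinite_finite[OF _ assms(3)]) (simp add: F(1) finite_fv)
        then obtain z where "z \<in> (Y - X0) - (F \<union> fv \<chi> \<union> fv \<psi>)" by (metis ex_in_conv finite.emptyI)
        then have "z \<in> X \<and> z \<notin> fv \<chi> \<union> fv \<psi> \<union> \<Union> (fv ` L n)" using F assms(2) by auto
        then have y: "y \<in> X" "y \<notin> fv \<chi> \<union> fv \<psi> \<union> \<Union> (fv ` L n)"
          unfolding y_def by (metis (mono_tags, lifting) someI)+
        have L: "L (Suc n) = insert (inst y \<phi>) (insert \<chi> (L n))"
          using True \<phi> by (auto simp: L_def Let_def \<chi>_def y_def)
        have "\<not> (L (Suc n) \<turnstile> \<psi>)"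
        proof
          assume "L (Suc n) \<turnstile> \<psi>"
          then have "insert (inst y \<phi>) (insert \<chi> (L n)) \<turnstile> \<psi>" using L by simp
          then have "insert \<chi> (L n) \<turnstile> \<psi>"
            by (rule derives_fresh_witness) (use y \<phi> in \<open>auto intro: derives.assm\<close>)
          then show False using True by blast
        qed
        moreover have fvy: "fv (inst y \<phi>) \<subseteq> insert y (fv \<chi>)" using fv_inst[of y \<phi>] \<phi> by simp
        have "\<forall>\<gamma>\<in>L (Suc n). fv \<gamma> \<subseteq> X" using L IH True y fvy by auto
        moreover have "\<exists>F. finite F \<and> (\<forall>\<gamma>\<in>L (Suc n). fv \<gamma> \<subseteq> X0 \<union> F)"
          using L F fvy by (intro exI[of _ "F \<union> insert y (fv \<chi>)"]) (auto simp: finite_fv)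
        moreover have "\<exists>x\<in>X. inst x \<phi>' \<in> L (Suc n)" if "from_nat n = Exists \<phi>'" for \<phi>'
          using L \<phi> that y(1) by (intro bexI[of _ y]) (simp_all add: \<chi>_def)
        ultimately show ?thesis by simp
      qed
    qed
  qed
  {
    case 0
    have a: "\<not> (L 0 \<turnstile> \<psi>)" "\<forall>\<gamma>\<in>L 0. fv \<gamma> \<subseteq> X" "\<exists>F. finite F \<and> (\<forall>\<gamma>\<in>L 0. fv \<gamma> \<subseteq> X0 \<union> F)"
      using assms by (auto intro: exI[of _ "{}"])
    show ?case using a step[OF a] by blast
  next
    case (Suc n)
    then have a: "\<not> (L (Suc n) \<turnstile> \<psi>)" "\<forall>\<gamma>\<in>L (Suc n). fv \<gamma> \<subseteq> X"
      "\<exists>F. finite F \<and> (\<forall>\<gamma>\<in>L (Suc n). fv \<gamma> \<subseteq> X0 \<union> F)"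
      using step[of n] by blast+
    show ?case using a step[OF a] by blast
  }
qed

text \<open>The limit of the chain is maximal among the sets over \<open>X\<close> that do not
  derive \<open>\<psi>\<close>. Maximality gives deductive closure, and it gives primality: if both
  disjuncts were missing, each would derive \<open>\<psi>\<close>, and so would the
  disjunction.\<close>

lemma prime_extension:
  fixes \<Gamma> :: "'r::countable fm set"
  assumes \<Gamma>: "\<And>\<gamma>. \<gamma> \<in> \<Gamma> \<Longrightarrow> fv \<gamma> \<subseteq> X0" and \<psi>: "fv \<psi> \<subseteq> X0" "\<not> (\<Gamma> \<turnstile> \<psi>)" and inf: "infinite (- X0)"
  obtains X \<Gamma>' where "X0 \<subseteq> X" "\<Gamma> \<subseteq> \<Gamma>'" "prime_theory X \<Gamma>'" "\<psi> \<notin> \<Gamma>'"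
proof -
  obtain Y where Y: "Y \<subseteq> - X0" "infinite Y" "infinite (- X0 - Y)" using infinite_split[OF inf] .
  define X where "X = X0 \<union> Y"
  define L where "L = lindenbaum X \<Gamma> \<psi>"
  define G where "G = (\<Union>n. L n)"
  have "Y - X0 = Y" using Y by auto
  then have inv: "\<not> (L n \<turnstile> \<psi>)" "\<forall>\<gamma>\<in>L n. fv \<gamma> \<subseteq> X"
    "\<forall>\<phi>. from_nat n = Exists \<phi> \<longrightarrow> fv (Exists \<phi>) \<subseteq> X \<longrightarrow> \<not> (insert (Exists \<phi>) (L n) \<turnstile> \<psi>) \<longrightarrow> (\<exists>x\<in>X. inst x \<phi> \<in> L (Suc n))" for n
    using lindenbaum_invariant[of \<Gamma> X0 Y X \<psi> n] \<Gamma> \<psi> Y unfolding L_def X_def by auto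
  have Lmono: "L n \<subseteq> L (Suc n)" for n by (auto simp: L_def Let_def)
  have mono: "L n \<subseteq> L m" if "n \<le> m" for n m using that Lmono by (rule lift_Suc_mono_le[rotated])
  have fin: "\<exists>n. F \<subseteq> L n" if "finite F" "F \<subseteq> G" for F
    using that
  proof (induction F)
    case (insert x F)
    then obtain n m where "F \<subseteq> L n" "x \<in> L m" by (auto simp: G_def)
    then have "insert x F \<subseteq> L (max n m)" using mono[of n "max n m"] mono[of m "max n m"] by auto
    then show ?case ..
  qed simp
  have notG: "\<not> (G \<turnstile> \<psi>)"
  proof
    assume "G \<turnstile> \<psi>"
    then obtain F where "F \<subseteq> G" "finite F" "F \<turnstile> \<psi>" using derives_finite by blast
    then show False using fin[of F] inv(1) derives_weaken by blast
  qed
  have Gfv: "fv \<gamma> \<subseteq> X" if "\<gamma> \<in> G" for \<gamma> using that inv(2) by (auto simp: G_def)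
  have max: "\<chi> \<in> G" if \<chi>: "fv \<chi> \<subseteq> X" "\<not> (insert \<chi> G \<turnstile> \<psi>)" for \<chi>
  proof -
    have "\<not> (insert \<chi> (L (to_nat \<chi>)) \<turnstile> \<psi>)"
      using \<chi>(2) derives_weaken[of "insert \<chi> (L (to_nat \<chi>))" \<psi> "insert \<chi> G"] by (auto simp: G_def)
    then have "\<chi> \<in> L (Suc (to_nat \<chi>))" using \<chi>(1) by (auto simp: L_def Let_def)
    then show ?thesis by (auto simp: G_def)
  qed
  have closed: "\<phi> \<in> G" if "G \<turnstile> \<phi>" "fv \<phi> \<subseteq> X" for \<phi>
    using max[OF that(2)] derives_cut[of \<phi> G \<psi>] that(1) notG by blast
  have disj: "\<phi> \<in> G \<or> \<chi> \<in> G" if "(\<phi> \<^bold>\<or> \<chi>) \<in> G" for \<phi> \<chi>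
  proof (rule ccontr)
    assume "\<not> (\<phi> \<in> G \<or> \<chi> \<in> G)"
    moreover have "fv \<phi> \<subseteq> X" "fv \<chi> \<subseteq> X" using Gfv[OF that] by auto
    ultimately have "insert \<phi> G \<turnstile> \<psi>" "insert \<chi> G \<turnstile> \<psi>" using max by blast+
    then have "G \<turnstile> \<psi>" using derives.disjE[OF derives.assm[OF that]] by blast
    then show False using notG by blast
  qed
  have ex: "\<exists>x\<in>X. inst x \<phi> \<in> G" if "Exists \<phi> \<in> G" for \<phi>
  proof -
    define n where "n = to_nat (Exists \<phi>)"
    \<comment> \<open>Membership alone gives no witness, for instance for formulas of
      \<open>\<Gamma>\<close>. But at its own stage the formula passes the test, and then a witness
      is added.\<close>
    have "\<not> (insert (Exists \<phi>) G \<turnstile> \<psi>)" using notG that by (simp add: insert_absorb)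
    then have new: "\<not> (insert (Exists \<phi>) (L n) \<turnstile> \<psi>)"
      using derives_weaken[of "insert (Exists \<phi>) (L n)" \<psi> "insert (Exists \<phi>) G"] by (auto simp: G_def)
    have "\<exists>x\<in>X. inst x \<phi> \<in> L (Suc n)"
      using inv(3)[of n] new Gfv[OF that] by (auto simp: n_def)
    then show ?thesis by (auto simp: G_def)
  qed
  have "\<not> (G \<turnstile> \<^bold>\<bottom>)" using notG derives.falsumE by blast
  moreover have "infinite (- X)" using Y(3) by (simp add: X_def Diff_eq)
  moreover have "X \<noteq> {}" using Y by (auto simp: X_def)
  ultimately have "prime_theory X G"
    using Gfv closed disj ex unfolding prime_theory_def by blast
  moreover have "\<psi> \<notin> G" using notG derives.assm by blast
  moreover have "\<Gamma> \<subseteq> G" unfolding G_def L_def by (metis UN_upper UNIV_I lindenbaum.simps(1))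
  moreover have "X0 \<subseteq> X" by (simp add: X_def)
  ultimately show thesis using that by blast
qed

section \<open>The canonical Kripke model\<close>

definition theory_le :: "nat set \<times> 'r fm set \<Rightarrow> nat set \<times> 'r fm set \<Rightarrow> bool" where
  "theory_le v w \<longleftrightarrow> prime_theory (fst v) (snd v) \<and> prime_theory (fst w) (snd w) \<and>
    fst v \<subseteq> fst w \<and> snd v \<subseteq> snd w"

definition theory_int :: "nat set \<times> 'r fm set \<Rightarrow> 'r \<Rightarrow> nat list \<Rightarrow> bool" where
  "theory_int v r ts \<longleftrightarrow> Atom r ts \<in> snd v"

interpretation canonical: kripke theory_le fst theory_int
  by unfold_locales (auto simp: theory_le_def theory_int_def)

lemma ren_case_nat_lift: "ren (case_nat d e) \<phi> = inst d (ren (lift_ren e) \<phi>)"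
  unfolding inst_def ren_ren canonical.case_nat_lift_ren by (simp add: comp_def)

lemma prime_theory_iff:
  "prime_theory X \<Gamma> \<Longrightarrow> fv \<phi> \<subseteq> X \<Longrightarrow> \<phi> \<in> \<Gamma> \<longleftrightarrow> (\<Gamma> \<turnstile> \<phi>)"
  unfolding prime_theory_def by (blast intro: derives.assm)

text \<open>An assignment of variables to variables is a renaming, so forcing at a node becomes
  membership of the renamed formula. Implication and \<open>Forall\<close> need later nodes, which
  \<open>prime_extension\<close> provides from underivability.\<close>

lemma truth_lemma:
  fixes \<phi> :: "'r::countable fm"
  assumes "theory_le v v" "range e \<subseteq> fst v"
  shows "canonical.forces v e \<phi> \<longleftrightarrow> ren e \<phi> \<in> snd v"
  using assms
proof (induction \<phi> arbitrary: v e)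
  case (Atom r ts)
  then show ?case by (simp only: canonical.forces.simps(1) ren.simps(1)) (simp only: theory_int_def)
next
  case Falsum
  then have "\<^bold>\<bottom> \<notin> snd v" by (auto simp: theory_le_def prime_theory_def intro: derives.assm)
  then show ?case by simp
next
  case (Conj \<phi> \<psi>)
  obtain X \<Gamma> where v: "v = (X, \<Gamma>)" by fastforce
  have p: "prime_theory X \<Gamma>" and fv: "fv (ren e \<chi>) \<subseteq> X" for \<chi> :: "'r fm"
    using Conj.prems by (auto simp: theory_le_def v fv_ren)
  have iff: "ren e \<chi> \<in> \<Gamma> \<longleftrightarrow> (\<Gamma> \<turnstile> ren e \<chi>)" for \<chi> by (rule prime_theory_iff[OF p fv])
  have "ren e (\<phi> \<^bold>\<and> \<psi>) \<in> \<Gamma> \<longleftrightarrow> ren e \<phi> \<in> \<Gamma> \<and> ren e \<psi> \<in> \<Gamma>"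
    unfolding iff by (auto intro: derives.intros)
  then show ?case using Conj by (simp add: v)
next
  case (Disj \<phi> \<psi>)
  obtain X \<Gamma> where v: "v = (X, \<Gamma>)" by fastforce
  have p: "prime_theory X \<Gamma>" and fv: "fv (ren e \<chi>) \<subseteq> X" for \<chi> :: "'r fm"
    using Disj.prems by (auto simp: theory_le_def v fv_ren)
  have iff: "ren e \<chi> \<in> \<Gamma> \<longleftrightarrow> (\<Gamma> \<turnstile> ren e \<chi>)" for \<chi> by (rule prime_theory_iff[OF p fv])
  have "ren e (\<phi> \<^bold>\<or> \<psi>) \<in> \<Gamma> \<Longrightarrow> ren e \<phi> \<in> \<Gamma> \<or> ren e \<psi> \<in> \<Gamma>"
    using p by (auto simp: prime_theory_def)
  moreover have "ren e \<phi> \<in> \<Gamma> \<or> ren e \<psi> \<in> \<Gamma> \<Longrightarrow> ren e (\<phi> \<^bold>\<or> \<psi>) \<in> \<Gamma>"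
    unfolding iff by (auto intro: derives.intros)
  ultimately show ?case using Disj by (auto simp: v)
next
  case (Impl \<phi> \<psi>)
  obtain X \<Gamma> where v: "v = (X, \<Gamma>)" by fastforce
  have p: "prime_theory X \<Gamma>" and fv: "fv (ren e \<chi>) \<subseteq> X" for \<chi> :: "'r fm"
    using Impl.prems by (auto simp: theory_le_def v fv_ren)
  have IH: "canonical.forces w e \<phi> \<longleftrightarrow> ren e \<phi> \<in> snd w" "canonical.forces w e \<psi> \<longleftrightarrow> ren e \<psi> \<in> snd w"
    if "theory_le v w" for w
  proof -
    have "theory_le w w" "range e \<subseteq> fst w"
      using that Impl.prems canonical.le_refl2 canonical.D_mono by blast+
    then show "canonical.forces w e \<phi> \<longleftrightarrow> ren e \<phi> \<in> snd w" "canonical.forces w e \<psi> \<longleftrightarrow> ren e \<psi> \<in> snd w"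
      using Impl.IH by blast+
  qed
  show ?case
  proof
    assume imp: "ren e (\<phi> \<^bold>\<longrightarrow> \<psi>) \<in> snd v"
    have "ren e \<psi> \<in> snd w" if w: "theory_le v w" "ren e \<phi> \<in> snd w" for w
    proof -
      have "ren e (\<phi> \<^bold>\<longrightarrow> \<psi>) \<in> snd w" using imp w by (auto simp: theory_le_def)
      then have "snd w \<turnstile> ren e \<psi>" using w by (auto intro: derives.implE derives.assm)
      moreover have "fv (ren e \<psi>) \<subseteq> fst w" using fv[of \<psi>] w v by (auto simp: theory_le_def)
      ultimately show ?thesis using w by (auto simp: theory_le_def prime_theory_def)
    qed
    then show "canonical.forces v e (\<phi> \<^bold>\<longrightarrow> \<psi>)" using IH by auto
  next
    assume f: "canonical.forces v e (\<phi> \<^bold>\<longrightarrow> \<psi>)"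
    have G: "fv \<gamma> \<subseteq> X" if "\<gamma> \<in> insert (ren e \<phi>) \<Gamma>" for \<gamma>
      using p that fv by (auto simp: prime_theory_def)
    have infX: "infinite (- X)" using p by (simp add: prime_theory_def)
    have "insert (ren e \<phi>) \<Gamma> \<turnstile> ren e \<psi>"
    proof (rule ccontr)
      assume "\<not> (insert (ren e \<phi>) \<Gamma> \<turnstile> ren e \<psi>)"
      then obtain X' \<Gamma>' where G: "X \<subseteq> X'" "insert (ren e \<phi>) \<Gamma> \<subseteq> \<Gamma>'" "prime_theory X' \<Gamma>'" "ren e \<psi> \<notin> \<Gamma>'"
        using prime_extension[of "insert (ren e \<phi>) \<Gamma>" X "ren e \<psi>"] fv G infX by blast
      then have "theory_le v (X', \<Gamma>')" using p by (simp add: theory_le_def v)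
      then show False using f G IH by auto
    qed
    then have "\<Gamma> \<turnstile> ren e (\<phi> \<^bold>\<longrightarrow> \<psi>)" by (simp add: derives.implI)
    then show "ren e (\<phi> \<^bold>\<longrightarrow> \<psi>) \<in> snd v" using prime_theory_iff[OF p fv] by (metis v snd_conv)
  qed
next
  case (Forall \<phi>)
  obtain X \<Gamma> where v: "v = (X, \<Gamma>)" by fastforce
  have p: "prime_theory X \<Gamma>" and fv: "fv (ren e \<chi>) \<subseteq> X" for \<chi> :: "'r fm"
    using Forall.prems by (auto simp: theory_le_def v fv_ren)
  have IH: "canonical.forces w (case_nat d e) \<phi> \<longleftrightarrow> inst d (ren (lift_ren e) \<phi>) \<in> snd w"
    if "theory_le v w" "d \<in> fst w" for w d
  proof -
    have "theory_le w w" by (rule canonical.le_refl2[OF that(1)])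
    moreover have "range e \<subseteq> fst w" using Forall.prems(2) canonical.D_mono[OF that(1)] by blast
    ultimately show ?thesis using Forall.IH[of w "case_nat d e"] that(2) by (simp add: ren_case_nat_lift)
  qed
  have fvi: "fv (inst d (ren (lift_ren e) \<phi>)) \<subseteq> Y" if "X \<subseteq> Y" "d \<in> Y" for d Y
    using fv_inst[of d "ren (lift_ren e) \<phi>"] fv[of "Forall \<phi>"] that by auto
  show ?case
  proof
    assume all: "ren e (Forall \<phi>) \<in> snd v"
    have "inst d (ren (lift_ren e) \<phi>) \<in> snd w" if w: "theory_le v w" "d \<in> fst w" for w d
    proof -
      have "ren e (Forall \<phi>) \<in> snd w" using all w by (auto simp: theory_le_def)
      then have "snd w \<turnstile> inst d (ren (lift_ren e) \<phi>)" by (auto intro: derives.forallE derives.assm)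
      moreover have "fv (inst d (ren (lift_ren e) \<phi>)) \<subseteq> fst w"
        using fvi w v by (auto simp: theory_le_def)
      ultimately show ?thesis using w by (auto simp: theory_le_def prime_theory_def)
    qed
    then show "canonical.forces v e (Forall \<phi>)" using IH by auto
  next
    assume f: "canonical.forces v e (Forall \<phi>)"
    have infX: "infinite (- X)" using p by (simp add: prime_theory_def)
    \<comment> \<open>A name outside the domain stands for an arbitrary individual of a later node;
      as it does not occur in \<open>\<Gamma>\<close>, it can be generalized.\<close>
    then obtain y where y: "y \<notin> X" using infinite_imp_nonempty by blast
    have G: "fv \<gamma> \<subseteq> X" if "\<gamma> \<in> \<Gamma>" for \<gamma> using p that by (auto simp: prime_theory_def)
    have "\<Gamma> \<turnstile> inst y (ren (lift_ren e) \<phi>)"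
    proof (rule ccontr)
      assume a: "\<not> (\<Gamma> \<turnstile> inst y (ren (lift_ren e) \<phi>))"
      have inf: "infinite (- insert y X)" using infX by (simp add: Compl_insert)
      obtain X' \<Gamma>' where G: "insert y X \<subseteq> X'" "\<Gamma> \<subseteq> \<Gamma>'" "prime_theory X' \<Gamma>'"
          "inst y (ren (lift_ren e) \<phi>) \<notin> \<Gamma>'"
        by (rule prime_extension[OF _ fvi[of "insert y X" y] a inf]) (use G that in blast)+
      then have "theory_le v (X', \<Gamma>')" using p by (simp add: theory_le_def v)
      then show False using f G IH[of "(X', \<Gamma>')" y] by auto
    qed
    moreover have "Suc y \<notin> fv (ren (lift_ren e) \<phi>)" using fv[of "Forall \<phi>"] y by auto
    ultimately have "\<Gamma> \<turnstile> Forall (ren (lift_ren e) \<phi>)"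
      using G y by (intro derives_fresh_generalize) auto
    then have "\<Gamma> \<turnstile> ren e (Forall \<phi>)" by simp
    then show "ren e (Forall \<phi>) \<in> snd v" using prime_theory_iff[OF p fv] by (metis v snd_conv)
  qed
next
  case (Exists \<phi>)
  obtain X \<Gamma> where v: "v = (X, \<Gamma>)" by fastforce
  have p: "prime_theory X \<Gamma>" and fv: "fv (ren e \<chi>) \<subseteq> X" for \<chi> :: "'r fm"
    using Exists.prems by (auto simp: theory_le_def v fv_ren)
  have IH: "canonical.forces v (case_nat d e) \<phi> \<longleftrightarrow> inst d (ren (lift_ren e) \<phi>) \<in> \<Gamma>" if "d \<in> X" for d
  proof -
    have "range (case_nat d e) \<subseteq> fst v" using that Exists.prems v by simp
    then show ?thesis using Exists.IH[OF Exists.prems(1)] by (simp add: ren_case_nat_lift v)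
  qed
  have "ren e (Exists \<phi>) \<in> \<Gamma>" if "inst d (ren (lift_ren e) \<phi>) \<in> \<Gamma>" for d
    unfolding prime_theory_iff[OF p fv] using that by (auto intro: derives.existsI derives.assm)
  moreover have "\<exists>d\<in>X. inst d (ren (lift_ren e) \<phi>) \<in> \<Gamma>" if "ren e (Exists \<phi>) \<in> \<Gamma>"
    using p that by (auto simp: prime_theory_def)
  ultimately show ?case using IH by (auto simp: v)
qed

theorem completeness:
  fixes \<phi> :: "'r::countable fm"
  assumes "\<not> ({} \<turnstile> \<phi>)"
  obtains v e where "theory_le v v" "range e \<subseteq> fst v" "\<not> canonical.forces v e \<phi>"
proof -
  have "infinite (- fv \<phi>)" by (simp add: finite_fv Compl_eq_Diff_UNIV Diff_infinite_finite)
  then obtain X \<Gamma> where G: "fv \<phi> \<subseteq> X" "prime_theory X \<Gamma>" "\<phi> \<notin> \<Gamma>"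
    using prime_extension[of "{}" "fv \<phi>" \<phi> thesis] assms that by auto
  then obtain x where x: "x \<in> X" by (auto simp: prime_theory_def)
  \<comment> \<open>Variables not free in \<open>\<phi>\<close> are sent to some \<open>x\<close> in
    \<open>X\<close>, so that the assignment stays within the domain.\<close>
  define e where "e n = (if n \<in> fv \<phi> then n else x)" for n
  have "ren e \<phi> = \<phi>" by (rule ren_idI) (simp add: e_def)
  moreover have "theory_le (X, \<Gamma>) (X, \<Gamma>)" "range e \<subseteq> fst (X, \<Gamma>)"
    using G x by (auto simp: theory_le_def e_def)
  ultimately show thesis using that[of "(X, \<Gamma>)" e] truth_lemma[of "(X, \<Gamma>)" e \<phi>] G by simp
qed

section \<open>Hereditarily countable sets\<close>

definition els :: "hcset \<Rightarrow> hcset set" where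
  "els x = {y. hcmem y x}"

text \<open>Meaningful only for countable \<open>S\<close>. For subsets of a countable model,
  countability comes from \<open>countable_sub\<close>.\<close>

definition hset :: "hcset set \<Rightarrow> hcset" where
  "hset S = HCSet (acset S)"

lemma hcmem_iff: "hcmem x y \<longleftrightarrow> x \<in> els y"
  by (simp add: els_def)

lemma els_rcset: "els x = rcset (elts x)"
  by (auto simp: els_def hcmem_def cin.rep_eq)

lemma countable_els [simp]: "countable (els x)"
  using rcset[of "elts x"] by (simp add: els_rcset)

lemma els_hset: "countable S \<Longrightarrow> els (hset S) = S"
  by (simp add: els_rcset hset_def acset_inverse)

lemma hcset_ext: "els x = els y \<Longrightarrow> x = y"
  by (cases x; cases y) (simp add: els_rcset rcset_inject)

lemma els_inject: "els x = els y \<longleftrightarrow> x = y"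
  using hcset_ext by blast

lemma hset_els [simp]: "hset (els x) = x"
  by (rule hcset_ext) (simp add: els_hset)

lemma hcset_induct [case_names step]:
  assumes "\<And>x. (\<And>y. y \<in> els x \<Longrightarrow> P y) \<Longrightarrow> P x"
  shows "P x"
proof (induction x)
  case (HCSet c)
  then show ?case by (rule_tac assms) (simp add: els_rcset)
qed

lemma not_in_els_self: "x \<notin> els x"
proof (induction x rule: hcset_induct)
  case (step x)
  then show ?case by blast
qed

definition upair :: "hcset \<Rightarrow> hcset \<Rightarrow> hcset" where "upair x y = hset {x, y}"
definition kpair :: "hcset \<Rightarrow> hcset \<Rightarrow> hcset" where "kpair x y = upair (upair x x) (upair x y)"
definition hunion :: "hcset \<Rightarrow> hcset" where "hunion x = hset (\<Union> (els ` els x))"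
definition hsucc :: "hcset \<Rightarrow> hcset" where "hsucc x = hset (insert x (els x))"
definition hempty :: hcset where "hempty = hset {}"

primrec num :: "nat \<Rightarrow> hcset" where
  "num 0 = hempty"
| "num (Suc n) = hsucc (num n)"

definition omega :: hcset where "omega = hset (range num)"

lemma els_simps [simp]:
  "els (upair x y) = {x, y}" "els (hunion x) = \<Union> (els ` els x)" "els (hsucc x) = insert x (els x)"
  "els hempty = {}" "els omega = range num"
  by (simp_all add: upair_def hunion_def hsucc_def hempty_def omega_def els_hset)

lemma upair_inject: "upair x y = upair u v \<longleftrightarrow> {x, y} = {u, v}"
  by (metis els_simps(1) upair_def)

lemma kpair_inject [simp]: "kpair x y = kpair u v \<longleftrightarrow> x = u \<and> y = v"
  by (auto simp: kpair_def upair_inject doubleton_eq_iff)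

lemma els_num: "els (num n) = num ` {..<n}"
  by (induction n) (auto simp: lessThan_Suc)

lemma num_inject [simp]: "num m = num n \<longleftrightarrow> m = n"
proof (induction m n rule: linorder_wlog)
  case (le a b)
  show ?case
  proof
    assume eq: "num a = num b"
    show "a = b"
    proof (rule ccontr)
      assume "a \<noteq> b"
      then have "num a \<in> els (num b)" using le by (auto simp: els_num)
      then show False using eq not_in_els_self by simp
    qed
  qed simp
qed auto

section \<open>Kripke models with classical domains\<close>

definition hc_int :: "lset \<Rightarrow> hcset list \<Rightarrow> bool" where
  "hc_int r ds = (case ds of [x, y] \<Rightarrow> (case r of Mem \<Rightarrow> x \<in> els y | Eq \<Rightarrow> x = y) | _ \<Rightarrow> False)"

lemma hc_int_simps [simp]: "hc_int Mem [x, y] \<longleftrightarrow> x \<in> els y" "hc_int Eq [x, y] \<longleftrightarrow> x = y"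
  by (simp_all add: hc_int_def)

locale set_kripke =
  fixes le :: "'w \<Rightarrow> 'w \<Rightarrow> bool" and A :: "'w \<Rightarrow> hcset set"
  assumes trans: "le u v \<Longrightarrow> le v w \<Longrightarrow> le u w"
    and refl1: "le u v \<Longrightarrow> le u u"
    and refl2: "le u v \<Longrightarrow> le v v"
    and A_mono: "le u v \<Longrightarrow> A u \<subseteq> A v"
    and A_trans: "le v v \<Longrightarrow> y \<in> A v \<Longrightarrow> els y \<subseteq> A v"

sublocale set_kripke \<subseteq> kripke le A "\<lambda>_. hc_int"
  by unfold_locales (blast intro: trans refl1 refl2 dest: A_mono)+

context set_kripke
begin

definition ok :: "'w \<Rightarrow> (nat \<Rightarrow> hcset) \<Rightarrow> bool" where
  "ok v e \<longleftrightarrow> le v v \<and> range e \<subseteq> A v"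

lemma ok_le: "ok v e \<Longrightarrow> le v v" by (simp add: ok_def)

lemma ok_in: "ok v e \<Longrightarrow> e i \<in> A v" by (auto simp: ok_def)

lemma ok_case_nat [simp]: "ok v (case_nat d e) \<longleftrightarrow> d \<in> A v \<and> ok v e"
  by (auto simp: ok_def)

lemma ok_mono: "ok v e \<Longrightarrow> le v w \<Longrightarrow> ok w e"
  using refl2 A_mono by (fastforce simp: ok_def)

lemma ok_els: "ok v e \<Longrightarrow> x \<in> els (e i) \<Longrightarrow> x \<in> A v"
  using A_trans[OF ok_le ok_in] by blast

lemma forces_Impl: "ok v e \<Longrightarrow>
    forces v e (\<phi> \<^bold>\<longrightarrow> \<psi>) \<longleftrightarrow> (\<forall>w. le v w \<longrightarrow> ok w e \<longrightarrow> forces w e \<phi> \<longrightarrow> forces w e \<psi>)"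
  using ok_mono by auto

lemma forces_Forall: "ok v e \<Longrightarrow>
    forces v e (Forall \<phi>) \<longleftrightarrow> (\<forall>w x. le v w \<longrightarrow> x \<in> A w \<longrightarrow> ok w e \<longrightarrow> forces w (case_nat x e) \<phi>)"
  using ok_mono by auto

lemma forces_Forall2:
  assumes "ok v e"
  shows "forces v e (Forall (Forall \<phi>)) \<longleftrightarrow>
    (\<forall>w x y. le v w \<longrightarrow> x \<in> A w \<longrightarrow> y \<in> A w \<longrightarrow> ok w e \<longrightarrow> forces w (case_nat y (case_nat x e)) \<phi>)" (is "?l = ?r")
proof
  assume ?l then show ?r using refl2 by auto
next
  assume r: ?r
  have "forces u (case_nat y (case_nat x e)) \<phi>" if "le v w" "x \<in> A w" "le w u" "y \<in> A u" for w x u y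
    using r trans[OF that(1,3)] A_mono[OF that(3)] ok_mono[OF assms, of u] that by blast
  then show ?l by simp
qed

text \<open>No later node has to be consulted: \<open>els (e a)\<close> is the same everywhere and
  lies in \<open>A v\<close> by transitivity, and what is forced at \<open>v\<close>
  persists.\<close>

lemma forces_ForallIn: "ok v e \<Longrightarrow>
    forces v e (ForallIn a \<phi>) \<longleftrightarrow> (\<forall>x. x \<in> els (e a) \<longrightarrow> x \<in> A v \<longrightarrow> forces v (case_nat x e) \<phi>)"
proof
  assume ok: "ok v e"
  show "\<forall>x. x \<in> els (e a) \<longrightarrow> x \<in> A v \<longrightarrow> forces v (case_nat x e) \<phi>" if "forces v e (ForallIn a \<phi>)"
    using that ok_le[OF ok] by (auto simp: ForallIn_def)
  show "forces v e (ForallIn a \<phi>)" if *: "\<forall>x. x \<in> els (e a) \<longrightarrow> x \<in> A v \<longrightarrow> forces v (case_nat x e) \<phi>"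
  proof (clarsimp simp: ForallIn_def)
    fix w x u assume "le v w" "x \<in> A w" "le w u" "x \<in> els (e a)"
    moreover from this have "forces v (case_nat x e) \<phi>" using * ok_els[OF ok] by blast
    ultimately show "forces u (case_nat x e) \<phi>" by (blast intro: forces_mono trans)
  qed
qed

lemma forces_ExistsIn: "ok v e \<Longrightarrow>
    forces v e (ExistsIn a \<phi>) \<longleftrightarrow> (\<exists>x. x \<in> els (e a) \<and> x \<in> A v \<and> forces v (case_nat x e) \<phi>)"
  by (auto simp: ExistsIn_def)

lemma forces_Exists: "forces v e (Exists \<phi>) \<longleftrightarrow> (\<exists>x. x \<in> A v \<and> forces v (case_nat x e) \<phi>)"
  by auto

lemma forces_Iff_stable:
  assumes "ok v e" "\<And>w. le v w \<Longrightarrow> ok w e \<Longrightarrow> forces w e \<phi> \<longleftrightarrow> P" "\<And>w. le v w \<Longrightarrow> ok w e \<Longrightarrow> forces w e \<psi> \<longleftrightarrow> Q"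
  shows "forces v e (\<phi> \<^bold>\<longleftrightarrow> \<psi>) \<longleftrightarrow> (P \<longleftrightarrow> Q)"
  using assms ok_le[OF assms(1)] ok_mono by auto

text \<open>Atoms are interpreted alike at all nodes, so an equivalence with a stable right side is
  classical. The quantifier sees only elements of the domains; \<open>S \<subseteq> A v\<close>
  ensures that no member of \<open>S\<close> goes unnoticed.\<close>

lemma forces_comprehension:
  assumes ok: "ok v e"
    and \<phi>: "\<And>w y. le v w \<Longrightarrow> y \<in> A w \<Longrightarrow> ok w e \<Longrightarrow> forces w (case_nat y e) \<phi> \<longleftrightarrow> y \<in> S"
    and S: "S \<subseteq> A v"
  shows "forces v e (Forall (0 \<^bold>\<in> Suc x \<^bold>\<longleftrightarrow> \<phi>)) \<longleftrightarrow> els (e x) = S"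
proof -
  have "forces v e (Forall (0 \<^bold>\<in> Suc x \<^bold>\<longleftrightarrow> \<phi>)) \<longleftrightarrow>
      (\<forall>w y. le v w \<longrightarrow> y \<in> A w \<longrightarrow> ok w e \<longrightarrow> (y \<in> els (e x) \<longleftrightarrow> y \<in> S))"
  proof -
    have "forces w (case_nat y e) (0 \<^bold>\<in> Suc x \<^bold>\<longleftrightarrow> \<phi>) \<longleftrightarrow> (y \<in> els (e x) \<longleftrightarrow> y \<in> S)"
      if "le v w" "y \<in> A w" "ok w e" for w y
      by (rule forces_Iff_stable) (use that in \<open>auto simp: \<phi>[OF trans]\<close>)
    then show ?thesis unfolding forces_Forall[OF ok] by meson
  qed
  also have "\<dots> \<longleftrightarrow> els (e x) = S"
    using ok ok_le[OF ok] S ok_els[OF ok] by blast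
  finally show ?thesis .
qed

lemma forces_is_empty [simp]: "ok v e \<Longrightarrow> forces v e (is_empty x) \<longleftrightarrow> e x = hempty"
  using ok_els hcset_ext[of "e x" hempty] by (fastforce simp: is_empty_def forces_ForallIn)

lemma forces_is_succ [simp]:
  assumes "ok v e"
  shows "forces v e (is_succ x y) \<longleftrightarrow> e x = hsucc (e y)"
proof -
  have "forces v e (is_succ x y) \<longleftrightarrow> els (e x) = els (hsucc (e y))"
    unfolding is_succ_def by (rule forces_comprehension) (use assms in \<open>auto intro: ok_in ok_els\<close>)
  then show ?thesis by (simp only: els_inject)
qed

lemma forces_is_upair [simp]:
  assumes "ok v e"
  shows "forces v e (is_upair x y z) \<longleftrightarrow> e x = upair (e y) (e z)"
proof -
  have "forces v e (is_upair x y z) \<longleftrightarrow> els (e x) = els (upair (e y) (e z))"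
    unfolding is_upair_def by (rule forces_comprehension) (use assms in \<open>auto intro: ok_in\<close>)
  then show ?thesis by (simp only: els_inject)
qed

text \<open>The domain must contain the unordered pairs that make up \<open>\<langle>y, z\<rangle>\<close>.\<close>

lemma forces_is_pair:
  assumes "ok v e" "upair (e y) (e y) \<in> A v" "upair (e y) (e z) \<in> A v"
  shows "forces v e (is_pair x y z) \<longleftrightarrow> e x = kpair (e y) (e z)"
proof -
  have "forces v e (is_pair x y z) \<longleftrightarrow> els (e x) = els (kpair (e y) (e z))"
    unfolding is_pair_def by (rule forces_comprehension) (use assms in \<open>auto simp: kpair_def\<close>)
  then show ?thesis by (simp only: els_inject)
qed

lemma forces_args:
  "forces v e (args is k \<phi>) = forces v (\<lambda>n. if n < length is then e (is ! n) else e (n - length is + k)) \<phi>"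
  by (auto simp: args_def forces_ren comp_def intro!: forces_cong)

lemma forces_args1:
  "forces v (case_nat x e) (args [0] 1 \<phi>) = forces v (case_nat x e) \<phi>"
  "forces v (case_nat x (case_nat a e)) (args [0] 2 \<phi>) = forces v (case_nat x e) \<phi>"
  "forces v (case_nat x (case_nat b (case_nat a e))) (args [0] 3 \<phi>) = forces v (case_nat x e) \<phi>"
  unfolding forces_args
  by (rule forces_cong; auto simp: numeral_eq_Suc split: nat.split)+

lemma forces_args2:
  "forces v (case_nat y (case_nat x (case_nat a e))) (args [1, 0] 3 \<phi>) =
    forces v (case_nat x (case_nat y e)) \<phi>"
  "forces v (case_nat y (case_nat x (case_nat a (case_nat b e)))) (args [1, 0] 4 \<phi>) =
    forces v (case_nat x (case_nat y e)) \<phi>"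
  "forces v (case_nat x (case_nat y (case_nat a (case_nat b e)))) (args [0, 1] 4 \<phi>) =
    forces v (case_nat x (case_nat y e)) \<phi>"
  "forces v (case_nat z (case_nat y (case_nat x (case_nat a e)))) (args [2, 0] 4 \<phi>) =
    forces v (case_nat x (case_nat z e)) \<phi>"
  unfolding forces_args
  by (rule forces_cong; auto simp: numeral_eq_Suc less_Suc_eq nth_Cons split: nat.split)+

lemma forces_args3:
  "forces v (case_nat y (case_nat x (case_nat z (case_nat c (case_nat b (case_nat a e)))))) (args [1, 0, 2] 6 \<phi>) =
    forces v (case_nat x (case_nat y (case_nat z e))) \<phi>"
  "forces v (case_nat y (case_nat x (case_nat d (case_nat z (case_nat c (case_nat b (case_nat a e))))))) (args [1, 0, 3] 7 \<phi>) =
    forces v (case_nat x (case_nat y (case_nat z e))) \<phi>"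
  "forces v (case_nat x (case_nat y (case_nat d (case_nat z (case_nat c (case_nat b (case_nat a e))))))) (args [0, 1, 3] 7 \<phi>) =
    forces v (case_nat x (case_nat y (case_nat z e))) \<phi>"
  unfolding forces_args
  by (rule forces_cong; auto simp: numeral_eq_Suc less_Suc_eq nth_Cons split: nat.split)+

end

text \<open>The one-node models: all hereditarily countable sets, and later the given model of ZFC.\<close>

locale transitive_class =
  fixes M :: "hcset set"
  assumes M_trans: "y \<in> M \<Longrightarrow> els y \<subseteq> M"

sublocale transitive_class \<subseteq> cl: set_kripke "\<lambda>(_::unit) _. True" "\<lambda>_. M"
  by unfold_locales (use M_trans in auto)

interpretation V: transitive_class UNIV
  by unfold_locales simp

abbreviation holds :: "(nat \<Rightarrow> hcset) \<Rightarrow> lset fm \<Rightarrow> bool" where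
  "holds \<equiv> V.cl.forces ()"

text \<open>The quantifiers of a bounded formula see the same elements in every transitive domain,
  so its truth value never changes along the order and the clause for implication becomes the
  classical one. \<open>holds\<close> is the value in the universe of all hereditarily countable
  sets.\<close>

lemma (in set_kripke) delta0_absolute:
  "delta0 \<phi> \<Longrightarrow> ok v e \<Longrightarrow> forces v e \<phi> \<longleftrightarrow> holds e \<phi>"
proof (induction arbitrary: v e rule: delta0.induct)
  case (5 \<phi> \<psi>)
  then show ?case using ok_mono ok_le[OF 5(5)] by auto
next
  case (6 \<phi> a)
  have "V.cl.ok () e" by (simp add: V.cl.ok_def)
  then show ?case using 6 ok_els by (auto simp: forces_ForallIn V.cl.forces_ForallIn)
next
  case (7 \<phi> a)
  have "V.cl.ok () e" by (simp add: V.cl.ok_def)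
  then show ?case using 7 ok_els by (auto simp: forces_ExistsIn V.cl.forces_ExistsIn)
qed auto

lemma ren_ForallIn: "ren f (ForallIn a \<phi>) = ForallIn (f a) (ren (lift_ren f) \<phi>)"
  by (simp add: ForallIn_def)

lemma ren_ExistsIn: "ren f (ExistsIn a \<phi>) = ExistsIn (f a) (ren (lift_ren f) \<phi>)"
  by (simp add: ExistsIn_def)

lemma wff_ForallIn [simp]: "wff set_ar (ForallIn a \<phi>) = wff set_ar \<phi>"
  by (simp add: ForallIn_def set_ar_def)

lemma wff_ExistsIn [simp]: "wff set_ar (ExistsIn a \<phi>) = wff set_ar \<phi>"
  by (simp add: ExistsIn_def set_ar_def)

lemma delta0_ren: "delta0 \<phi> \<Longrightarrow> delta0 (ren f \<phi>)"
  by (induction arbitrary: f rule: delta0.induct)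
     (auto simp: ren_ForallIn ren_ExistsIn intro: delta0.intros)

lemma delta0_args: "delta0 \<phi> \<Longrightarrow> delta0 (args is k \<phi>)"
  unfolding args_def by (rule delta0_ren)

lemma holds_ForallIn [simp]: "holds e (ForallIn a \<phi>) \<longleftrightarrow> (\<forall>x\<in>els (e a). holds (case_nat x e) \<phi>)"
  by (auto simp: V.cl.forces_ForallIn V.cl.ok_def)

lemma holds_ExistsIn [simp]: "holds e (ExistsIn a \<phi>) \<longleftrightarrow> (\<exists>x\<in>els (e a). holds (case_nat x e) \<phi>)"
  by (auto simp: V.cl.forces_ExistsIn V.cl.ok_def)

section \<open>Axioms in Kripke models whose domains are closed under set operations\<close>

lemma (in set_kripke) forces_eq_axioms:
  assumes "\<phi> \<in> eq_axioms"
  shows "forces v e \<phi>"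
  using assms unfolding eq_axioms_def
  by (auto simp: numeral_eq_Suc)

text \<open>All closure conditions concern one domain at a time and are classical statements.
  Bounded formulas enter through \<open>holds\<close>, which by \<open>delta0_absolute\<close> is
  their truth value at every node.\<close>

locale kp_kripke = set_kripke +
  assumes A_hempty: "le v v \<Longrightarrow> hempty \<in> A v"
    and A_upair: "le v v \<Longrightarrow> x \<in> A v \<Longrightarrow> y \<in> A v \<Longrightarrow> upair x y \<in> A v"
    and A_hunion: "le v v \<Longrightarrow> x \<in> A v \<Longrightarrow> hunion x \<in> A v"
    and A_omega: "le v v \<Longrightarrow> omega \<in> A v"
    and A_separation: "le v v \<Longrightarrow> range e \<subseteq> A v \<Longrightarrow> a \<in> A v \<Longrightarrow> wff set_ar \<phi> \<Longrightarrow> delta0 \<phi> \<Longrightarrow>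
      hset {x \<in> els a. holds (case_nat x e) \<phi>} \<in> A v"
    and A_collection: "le v v \<Longrightarrow> range e \<subseteq> A v \<Longrightarrow> a \<in> A v \<Longrightarrow> wff set_ar \<phi> \<Longrightarrow> delta0 \<phi> \<Longrightarrow>
      (\<And>x. x \<in> els a \<Longrightarrow> \<exists>y\<in>A v. holds (case_nat x (case_nat y e)) \<phi>) \<Longrightarrow>
      \<exists>b\<in>A v. \<forall>x\<in>els a. \<exists>y\<in>els b. holds (case_nat x (case_nat y e)) \<phi>"
    and A_choice: "le v v \<Longrightarrow> a \<in> A v \<Longrightarrow> (\<And>x. x \<in> els a \<Longrightarrow> els x \<noteq> {}) \<Longrightarrow>
      (\<And>x y. x \<in> els a \<Longrightarrow> y \<in> els a \<Longrightarrow> x \<noteq> y \<Longrightarrow> els x \<inter> els y = {}) \<Longrightarrow>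
      \<exists>b\<in>A v. \<forall>x\<in>els a. \<exists>!z. z \<in> els b \<and> z \<in> els x"
begin

lemma forces_ax_empty: "ok v e \<Longrightarrow> forces v e ax_empty"
  using A_hempty[OF ok_le] by (auto simp: ax_empty_def forces_ForallIn intro!: bexI[of _ hempty])

lemma forces_ax_pairing:
  assumes "ok v e"
  shows "forces v e ax_pairing"
proof -
  have "\<exists>y. y \<in> A w \<and> forces w (case_nat y (case_nat b (case_nat a e))) (Forall (0 \<^bold>\<in> 1 \<^bold>\<longleftrightarrow> (0 \<^bold>= 3 \<^bold>\<or> 0 \<^bold>= 2)))"
    if "ok w e" "a \<in> A w" "b \<in> A w" for w a b
    using A_upair[OF ok_le that(2,3)] that
    by (intro exI[of _ "upair a b"]) (auto simp: numeral_eq_Suc)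
  then show ?thesis
    unfolding ax_pairing_def forces_Forall2[OF assms] forces_Exists by blast
qed

lemma forces_ax_union:
  assumes "ok v e"
  shows "forces v e ax_union"
proof -
  have "\<exists>y. y \<in> A w \<and> forces w (case_nat y (case_nat a e)) (Forall (0 \<^bold>\<in> Suc 0 \<^bold>\<longleftrightarrow> Exists (0 \<^bold>\<in> 3 \<^bold>\<and> 1 \<^bold>\<in> 0)))"
    if "ok w e" "a \<in> A w" for w a
  proof (intro exI[of _ "hunion a"] HOL.conjI)
    note le = ok_le[OF \<open>ok w e\<close>]
    show A: "hunion a \<in> A w" by (rule A_hunion[OF le \<open>a \<in> A w\<close>])
    have "forces w (case_nat (hunion a) (case_nat a e)) (Forall (0 \<^bold>\<in> Suc 0 \<^bold>\<longleftrightarrow> Exists (0 \<^bold>\<in> 3 \<^bold>\<and> 1 \<^bold>\<in> 0))) \<longleftrightarrow>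
        els (case_nat (hunion a) (case_nat a e) 0) = \<Union> (els ` els a)"
    proof (rule forces_comprehension)
      show "\<Union> (els ` els a) \<subseteq> A w" using A_trans[OF le A] by simp
      fix u y assume "le w u"
      then have "els a \<subseteq> A u" using A_trans[OF le \<open>a \<in> A w\<close>] A_mono by blast
      then show "forces u (case_nat y (case_nat (hunion a) (case_nat a e))) (Exists (0 \<^bold>\<in> 3 \<^bold>\<and> 1 \<^bold>\<in> 0)) \<longleftrightarrow> y \<in> \<Union> (els ` els a)"
        by (auto simp: numeral_eq_Suc)
    qed (use that A in simp)
    then show "forces w (case_nat (hunion a) (case_nat a e)) (Forall (0 \<^bold>\<in> Suc 0 \<^bold>\<longleftrightarrow> Exists (0 \<^bold>\<in> 3 \<^bold>\<and> 1 \<^bold>\<in> 0)))"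
      by simp
  qed
  then show ?thesis
    unfolding ax_union_def forces_Forall[OF assms] forces_Exists by (metis One_nat_def)
qed

lemma forces_ax_extensionality: "ok v e \<Longrightarrow> forces v e ax_extensionality"
proof -
  assume ok: "ok v e"
  have "a = b" if w: "le v w" "le w u" "a \<in> A w" "b \<in> A u"
    and f: "forces u (case_nat b (case_nat a e)) (Forall (0 \<^bold>\<in> 2 \<^bold>\<longleftrightarrow> 0 \<^bold>\<in> 1))" for w u a b
  proof -
    have "le u u" and a: "a \<in> A u" using w refl2 A_mono by blast+
    then have "x \<in> els a \<longleftrightarrow> x \<in> els b" if "x \<in> A u" for x
      using f that by (auto simp: numeral_eq_Suc)
    then have "els a = els b" using A_trans[OF \<open>le u u\<close>] a w by blast
    then show ?thesis by (rule hcset_ext)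
  qed
  moreover define \<psi> where "\<psi> = Forall (0 \<^bold>\<in> 2 \<^bold>\<longleftrightarrow> 0 \<^bold>\<in> 1)"
  ultimately have "a = b"
    if "le v w" "a \<in> A w" "le w u" "b \<in> A u" "le u t" "forces t (case_nat b (case_nat a e)) \<psi>" for w u t a b
    using that trans[of w u t] A_mono[of u t] by blast
  then show ?thesis
    unfolding ax_extensionality_def \<psi>_def[symmetric] by simp
qed

lemma forces_ax_infinity: "ok v e \<Longrightarrow> forces v e ax_infinity"
proof -
  assume ok: "ok v e"
  have A: "omega \<in> A v" by (rule A_omega[OF ok_le[OF ok]])
  have n: "num n \<in> A v" for n using A_trans[OF ok_le[OF ok] A] by auto
  have "\<exists>x. x \<in> range num \<and> x \<in> A v \<and> x = hsucc (num k)" for k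
    using n[of "Suc k"] by (intro exI[of _ "num (Suc k)"] HOL.conjI rangeI) simp_all
  moreover have "num k = hempty \<or> (\<exists>x. x \<in> els (num k) \<and> x \<in> A v \<and> num k = hsucc x)" for k
  proof (cases k)
    case (Suc m)
    then show ?thesis using n by (intro HOL.disjI2 exI[of _ "num m"]) auto
  qed simp
  moreover have "\<exists>x. x \<in> range num \<and> x \<in> A v \<and> x = hempty"
    using n[of 0] by (intro exI[of _ "num 0"] HOL.conjI rangeI) simp_all
  ultimately have "forces v (case_nat omega e) (is_inductive 0)"
    "forces v (case_nat omega e) (ForallIn 0 (is_empty 0 \<^bold>\<or> ExistsIn 0 (is_succ 1 0)))"
    using ok A unfolding is_inductive_def
    by (simp_all add: forces_ForallIn forces_ExistsIn ball_simps del: forces.simps(5,6,7) num.simps cong: conj_cong) blast+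
  then show ?thesis using A unfolding ax_infinity_def by auto
qed

text \<open>Membership induction outside the model at a fixed node \<open>t\<close> suffices for all
  formulas: a bounded quantifier over \<open>a\<close> at \<open>t\<close> looks only at elements of
  \<open>a\<close>, to which the induction hypothesis at the same \<open>t\<close> applies.\<close>

lemma forces_set_induction:
  assumes "ok v e"
  shows "forces v e (set_induction \<phi>)"
proof -
  have "forces t (case_nat a e) \<phi>"
    if f: "forces w e (Forall (ForallIn 0 (args [0] 2 \<phi>) \<^bold>\<longrightarrow> args [0] 1 \<phi>))"
      and "ok w e" "le w t" "a \<in> A t" for w t a
    using \<open>le w t\<close> \<open>a \<in> A t\<close>
  proof (induction a rule: hcset_induct)
    case (step a)
    have t: "le t t" "ok t e" using step.prems ok_mono[OF \<open>ok w e\<close>] refl2 by blast+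
    have "forces t (case_nat a e) (ForallIn 0 (args [0] 2 \<phi>))"
      using step t by (auto simp: forces_ForallIn forces_args1)
    moreover have "forces t (case_nat a e) (ForallIn 0 (args [0] 2 \<phi>) \<^bold>\<longrightarrow> args [0] 1 \<phi>)"
      using f step.prems by (simp del: forces.simps(5))
    ultimately show ?case using t by (simp add: forces_args1 del: One_nat_def)
  qed
  then show ?thesis
    using assms ok_mono unfolding set_induction_def
    by (simp add: forces_args1 del: One_nat_def)
qed

lemma forces_separation:
  assumes "ok v e" "wff set_ar \<phi>" "delta0 \<phi>"
  shows "forces v e (separation \<phi>)"
proof -
  have "\<exists>y\<in>A w. forces w (case_nat y (case_nat a e)) (Forall (0 \<^bold>\<in> Suc 0 \<^bold>\<longleftrightarrow> (0 \<^bold>\<in> 2 \<^bold>\<and> args [0] 3 \<phi>)))"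
    if "ok w e" "a \<in> A w" for w a
  proof -
    let ?S = "{x \<in> els a. holds (case_nat x e) \<phi>}"
    have c: "countable ?S" by (rule countable_subset[OF _ countable_els[of a]]) auto
    have A: "hset ?S \<in> A w" using A_separation[of w e a \<phi>] that assms by (auto simp: ok_def)
    then show ?thesis
      using that A_trans[OF ok_le] assms
      by (intro bexI[of _ "hset ?S"], subst forces_comprehension[where S = ?S])
         (auto simp: els_hset[OF c] forces_args1 delta0_absolute dest: subsetD[OF A_mono])
  qed
  then show ?thesis
    unfolding separation_def forces_Forall[OF assms(1)] forces_Exists One_nat_def by blast
qed

text \<open>The set given by collection is cut down to those \<open>y\<close> that are related to
  some \<open>x\<close>; this is bounded separation with \<open>a\<close> as an additional
  parameter.\<close>

lemma A_strong_collection: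
  assumes "ok v e" "wff set_ar \<phi>" "delta0 \<phi>" "a \<in> A v"
    "\<And>x. x \<in> els a \<Longrightarrow> \<exists>y\<in>A v. holds (case_nat x (case_nat y e)) \<phi>"
  shows "\<exists>b\<in>A v. (\<forall>x\<in>els a. \<exists>y\<in>els b. holds (case_nat x (case_nat y e)) \<phi>) \<and>
    (\<forall>y\<in>els b. \<exists>x\<in>els a. holds (case_nat x (case_nat y e)) \<phi>)"
proof -
  obtain b where b: "b \<in> A v" "\<forall>x\<in>els a. \<exists>y\<in>els b. holds (case_nat x (case_nat y e)) \<phi>"
    using A_collection[of v e a \<phi>] assms unfolding ok_def by blast
  \<comment> \<open>Indices \<open>0\<close> and \<open>1\<close> stand for \<open>x\<close> and
    \<open>y\<close>; the parameters move up by one to make room for \<open>a\<close> at index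
    \<open>2\<close>.\<close>
  define f :: "nat \<Rightarrow> nat" where "f = (\<lambda>n. case n of 0 \<Rightarrow> 0 | Suc 0 \<Rightarrow> 1 | Suc (Suc n) \<Rightarrow> n + 3)"
  let ?\<psi> = "ExistsIn 1 (ren f \<phi>)"
  have h: "holds (case_nat y (case_nat a e)) ?\<psi> \<longleftrightarrow> (\<exists>x\<in>els a. holds (case_nat x (case_nat y e)) \<phi>)" for y
  proof -
    have "holds (case_nat x (case_nat y (case_nat a e))) (ren f \<phi>) = holds (case_nat x (case_nat y e)) \<phi>" for x
      unfolding V.cl.forces_ren by (rule V.cl.forces_cong) (auto simp: f_def numeral_eq_Suc split: nat.split)
    then show ?thesis by (auto simp: V.cl.forces_ExistsIn V.cl.ok_def)
  qed
  have w: "wff set_ar ?\<psi>" "delta0 ?\<psi>"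
    using assms by (auto intro: delta0.intros delta0_ren)
  let ?S = "{y \<in> els b. holds (case_nat y (case_nat a e)) ?\<psi>}"
  have "countable ?S" by (rule countable_subset[OF _ countable_els[of b]]) auto
  from els_hset[OF this] have "els (hset ?S) = {y \<in> els b. \<exists>x\<in>els a. holds (case_nat x (case_nat y e)) \<phi>}"
    unfolding h .
  moreover have "hset ?S \<in> A v"
    using A_separation[of v "case_nat a e" b ?\<psi>] assms b w by (auto simp: ok_def)
  ultimately show ?thesis
    using b(2) by (intro bexI[of _ "hset ?S"]) (auto, blast)
qed

text \<open>The two moves to later nodes made by \<open>Forall\<close> and implication merge into
  one, since an individual chosen at the first node persists to the second.\<close>

lemma forces_Forall_bounded:
  "ok v e \<Longrightarrow> forces v e (Forall (\<phi> \<^bold>\<longrightarrow> \<psi>)) \<longleftrightarrow>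
    (\<forall>w x. le v w \<longrightarrow> x \<in> A w \<longrightarrow> ok w e \<longrightarrow> forces w (case_nat x e) \<phi> \<longrightarrow> forces w (case_nat x e) \<psi>)"
proof -
  assume ok: "ok v e"
  show ?thesis
  proof
    assume *: "forces v e (Forall (\<phi> \<^bold>\<longrightarrow> \<psi>))"
    then show "\<forall>w x. le v w \<longrightarrow> x \<in> A w \<longrightarrow> ok w e \<longrightarrow> forces w (case_nat x e) \<phi> \<longrightarrow> forces w (case_nat x e) \<psi>"
      using ok_le by auto
  next
    assume *: "\<forall>w x. le v w \<longrightarrow> x \<in> A w \<longrightarrow> ok w e \<longrightarrow> forces w (case_nat x e) \<phi> \<longrightarrow> forces w (case_nat x e) \<psi>"
    have "forces u (case_nat x e) \<psi>"
      if "le v w" "x \<in> A w" "le w u" "forces u (case_nat x e) \<phi>" for w x u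
    proof -
      have "le v u" using that trans by blast
      moreover have "x \<in> A u" using that A_mono by blast
      ultimately show ?thesis using * that ok_mono[OF ok] by blast
    qed
    then show "forces v e (Forall (\<phi> \<^bold>\<longrightarrow> \<psi>))" by simp
  qed
qed

lemma forces_collections:
  assumes "ok v e" "wff set_ar \<phi>" "delta0 \<phi>"
  shows "forces v e (collection \<phi>)" "forces v e (strong_collection \<phi>)"
proof -
  have *: "\<exists>b. b \<in> A w \<and> (\<forall>x. x \<in> els a \<longrightarrow> x \<in> A w \<longrightarrow> (\<exists>y. y \<in> els b \<and> y \<in> A w \<and> holds (case_nat x (case_nat y e)) \<phi>)) \<and>
    (\<forall>y. y \<in> els b \<longrightarrow> y \<in> A w \<longrightarrow> (\<exists>x. x \<in> els a \<and> x \<in> A w \<and> holds (case_nat x (case_nat y e)) \<phi>))"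
    if "ok w e" "a \<in> A w" "\<forall>x. x \<in> els a \<longrightarrow> x \<in> A w \<longrightarrow> (\<exists>y. y \<in> A w \<and> holds (case_nat x (case_nat y e)) \<phi>)" for w a
  proof -
    note prem = that(3)
    have "\<exists>y\<in>A w. holds (case_nat x (case_nat y e)) \<phi>" if "x \<in> els a" for x
      using prem that \<open>a \<in> A w\<close> A_trans[OF ok_le[OF \<open>ok w e\<close>]] by blast
    from A_strong_collection[OF \<open>ok w e\<close> assms(2,3) \<open>a \<in> A w\<close> this]
    obtain b where "b \<in> A w" "\<forall>x\<in>els a. \<exists>y\<in>els b. holds (case_nat x (case_nat y e)) \<phi>"
      "\<forall>y\<in>els b. \<exists>x\<in>els a. holds (case_nat x (case_nat y e)) \<phi>" by blast
    then show ?thesis using A_trans[OF ok_le[OF \<open>ok w e\<close>]] \<open>a \<in> A w\<close> by (intro exI[of _ b]) blast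
  qed
  have "\<exists>b. b \<in> A w \<and> forces w (case_nat b (case_nat a e)) (ForallIn 1 (ExistsIn 1 (args [1, 0] 4 \<phi>))) \<and>
      forces w (case_nat b (case_nat a e)) (ForallIn 0 (ExistsIn 2 (args [0, 1] 4 \<phi>)))"
    if "ok w e" "a \<in> A w" "forces w (case_nat a e) (ForallIn 0 (Exists (args [1, 0] 3 \<phi>)))" for w a
  proof -
    have "\<forall>x. x \<in> els a \<longrightarrow> x \<in> A w \<longrightarrow> (\<exists>y. y \<in> A w \<and> holds (case_nat x (case_nat y e)) \<phi>)"
      using that assms by (auto simp: forces_ForallIn forces_Exists forces_args2[simplified] delta0_absolute
        simp del: forces.simps(5,6,7) cong: conj_cong)
    from *[OF that(1,2) this] obtain b where b: "b \<in> A w"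
      "\<forall>x. x \<in> els a \<longrightarrow> x \<in> A w \<longrightarrow> (\<exists>y. y \<in> els b \<and> y \<in> A w \<and> holds (case_nat x (case_nat y e)) \<phi>)"
      "\<forall>y. y \<in> els b \<longrightarrow> y \<in> A w \<longrightarrow> (\<exists>x. x \<in> els a \<and> x \<in> A w \<and> holds (case_nat x (case_nat y e)) \<phi>)"
      by blast
    show ?thesis
    proof (intro exI[of _ b] HOL.conjI)
      show "forces w (case_nat b (case_nat a e)) (ForallIn 1 (ExistsIn 1 (args [1, 0] 4 \<phi>)))"
        using that b assms by (simp add: forces_ForallIn forces_ExistsIn forces_args2[simplified] delta0_absolute
          del: forces.simps(5,6,7) cong: conj_cong)
      show "forces w (case_nat b (case_nat a e)) (ForallIn 0 (ExistsIn 2 (args [0, 1] 4 \<phi>)))"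
        using that b assms by (simp add: forces_ForallIn forces_ExistsIn forces_args2[simplified] delta0_absolute
          numeral_2_eq_2 del: forces.simps(5,6,7) cong: conj_cong)
    qed (rule b)
  qed
  then show "forces v e (collection \<phi>)" "forces v e (strong_collection \<phi>)"
    unfolding collection_def strong_collection_def forces_Forall_bounded[OF assms(1)] forces_Exists forces.simps(3)
    by blast+
qed

lemma A_insert: "le v v \<Longrightarrow> x \<in> A v \<Longrightarrow> y \<in> A v \<Longrightarrow> \<exists>z\<in>A v. els z = insert x (els y)"
  by (rule bexI[of _ "hunion (upair (upair x x) y)"]) (auto intro: A_hunion A_upair)

lemma A_union2: "le v v \<Longrightarrow> x \<in> A v \<Longrightarrow> y \<in> A v \<Longrightarrow> \<exists>z\<in>A v. els z = els x \<union> els y"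
  by (rule bexI[of _ "hunion (upair x y)"]) (auto intro: A_hunion A_upair)

text \<open>\<open>c\<close> is chosen now, while \<open>z\<close> may come from a later and larger
  domain; hence \<open>z\<close> ranges over all sets here. Set-boundedness resolves this: a
  \<open>z\<close> related to anything lies in a member of \<open>a\<close> or \<open>b\<close> or
  in a parameter, so the relevant \<open>z\<close> are in a set \<open>T\<close> that is already
  present, and the sets \<open>?D z\<close> for \<open>z\<close> in \<open>T\<close> can be
  collected.\<close>

lemma A_subset_collection:
  assumes ok: "ok v e" and \<psi>: "wff set_ar \<psi>" "delta0 \<psi>" "z_set_bounded \<psi>" and ab: "a \<in> A v" "b \<in> A v"
  shows "\<exists>c\<in>A v. \<forall>z. (\<forall>x\<in>els a. \<exists>y\<in>els b. holds (case_nat x (case_nat y (case_nat z e))) \<psi>) \<longrightarrow>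
    (\<exists>d\<in>els c. (\<forall>x\<in>els a. \<exists>y\<in>els d. holds (case_nat x (case_nat y (case_nat z e))) \<psi>) \<and>
      (\<forall>y\<in>els d. \<exists>x\<in>els a. holds (case_nat x (case_nat y (case_nat z e))) \<psi>))"
proof -
  note le = ok_le[OF ok]
  let ?D = "\<lambda>z. {y \<in> els b. \<exists>x\<in>els a. holds (case_nat x (case_nat y (case_nat z e))) \<psi>}"
  have cD: "countable (?D z)" for z by (rule countable_subset[OF _ countable_els[of b]]) auto
  obtain t where t: "\<And>x y z. holds (case_nat x (case_nat y (case_nat z e))) \<psi> \<Longrightarrow> z \<in> els x \<or> z \<in> els y \<or> z \<in> els (e t)"
  proof -
    \<comment> \<open>By soundness the derivable bound is true of the actual sets. Indices
      \<open>0\<close> and \<open>1\<close> of the bound mean \<open>x\<close> and \<open>y\<close>,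
      index \<open>2\<close> would put \<open>z\<close> into itself, and from \<open>3\<close> on
      there are the parameters.\<close>
    obtain t where t: "eq_axioms \<union> {\<psi>} \<turnstile> 2 \<^bold>\<in> t"
      using \<psi>(3) by (auto simp: z_set_bounded_def set_derives_def)
    have "z \<in> els x \<or> z \<in> els y \<or> z \<in> els (e (t - 3))"
      if "holds (case_nat x (case_nat y (case_nat z e))) \<psi>" (is "holds ?e \<psi>") for x y z
    proof -
      have "holds ?e (2 \<^bold>\<in> t)"
        by (rule V.cl.soundness[OF t]) (use that V.cl.forces_eq_axioms in auto)
      then have "z \<in> els (?e t)" by (simp add: numeral_eq_Suc)
      then show ?thesis using not_in_els_self
        by (auto simp: numeral_eq_Suc split: nat.split_asm)
    qed
    then show ?thesis using that by blast
  qed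
  obtain T0 where T0: "T0 \<in> A v" "els T0 = els (hunion a) \<union> els (hunion b)"
    using A_union2[OF le] A_hunion[OF le] ab by blast
  then obtain T where T: "T \<in> A v" "els T = els T0 \<union> els (e t)"
    using A_union2[OF le] ok_in[OF ok] by blast
  \<comment> \<open>Room is made for \<open>d\<close>, \<open>a\<close>, \<open>b\<close> at indices
    \<open>3\<close> to \<open>5\<close>, between \<open>z\<close> and the parameters.\<close>
  define f :: "nat \<Rightarrow> nat" where "f = (\<lambda>n. case n of 0 \<Rightarrow> 0 | Suc 0 \<Rightarrow> 1 | Suc (Suc 0) \<Rightarrow> 2 | Suc (Suc (Suc n)) \<Rightarrow> n + 6)"
  text \<open>\<open>?\<theta>\<close> says of \<open>z, d, a, b\<close> that \<open>d\<close> is the set \<open>?D z\<close>.\<close>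
  let ?\<delta> = "ExistsIn 3 (ren f \<psi>)"
  let ?\<theta> = "ForallIn 1 (0 \<^bold>\<in> 4 \<^bold>\<and> ?\<delta>) \<^bold>\<and> ForallIn 3 (?\<delta> \<^bold>\<longrightarrow> 0 \<^bold>\<in> 2)"
  have \<theta>: "holds (case_nat z (case_nat d (case_nat a (case_nat b e)))) ?\<theta> \<longleftrightarrow> els d = ?D z" for z d
  proof -
    let ?e = "case_nat z (case_nat d (case_nat a (case_nat b e)))"
    have "holds (case_nat x (case_nat y ?e)) (ren f \<psi>) =
        holds (case_nat x (case_nat y (case_nat z e))) \<psi>" for x y
      unfolding V.cl.forces_ren by (rule V.cl.forces_cong) (auto simp: f_def numeral_eq_Suc split: nat.split)
    then have "holds (case_nat y ?e) ?\<delta> \<longleftrightarrow> (\<exists>x\<in>els a. holds (case_nat x (case_nat y (case_nat z e))) \<psi>)" for y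
      by (auto simp: V.cl.forces_ExistsIn V.cl.ok_def numeral_eq_Suc)
    then show ?thesis
      by (auto simp: V.cl.forces_ForallIn V.cl.ok_def numeral_eq_Suc)
  qed
  have "wff set_ar ?\<theta>" "delta0 ?\<theta>"
    using \<psi> by (auto simp: set_ar_def intro!: delta0.intros delta0_ren)
  moreover have "range (case_nat a (case_nat b e)) \<subseteq> A v" using ok ab by (simp add: ok_def)
  moreover have "\<exists>d\<in>A v. holds (case_nat z (case_nat d (case_nat a (case_nat b e)))) ?\<theta>" if "z \<in> els T" for z
  proof -
    have "z \<in> A v" using A_trans[OF le T(1)] that by blast
    \<comment> \<open>The same property of \<open>y\<close> with only \<open>a\<close> inserted, in
      the form needed to separate \<open>?D z\<close> from \<open>b\<close>.\<close>
    define h :: "nat \<Rightarrow> nat" where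
      "h = (\<lambda>n. case n of 0 \<Rightarrow> 0 | Suc 0 \<Rightarrow> 1 | Suc (Suc 0) \<Rightarrow> 2 | Suc (Suc (Suc n)) \<Rightarrow> n + 4)"
    let ?\<delta>' = "ExistsIn 2 (ren h \<psi>)"
    have "holds (case_nat x (case_nat y (case_nat z (case_nat a e)))) (ren h \<psi>) =
        holds (case_nat x (case_nat y (case_nat z e))) \<psi>" for x y
      unfolding V.cl.forces_ren by (rule V.cl.forces_cong) (auto simp: h_def numeral_eq_Suc split: nat.split)
    then have "holds (case_nat y (case_nat z (case_nat a e))) ?\<delta>' \<longleftrightarrow> (\<exists>x\<in>els a. holds (case_nat x (case_nat y (case_nat z e))) \<psi>)" for y
      by (auto simp: V.cl.forces_ExistsIn V.cl.ok_def numeral_eq_Suc)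
    moreover have "wff set_ar ?\<delta>'" "delta0 ?\<delta>'" using \<psi> by (auto intro!: delta0.intros delta0_ren)
    ultimately have "hset (?D z) \<in> A v"
      using A_separation[of v "case_nat z (case_nat a e)" b ?\<delta>'] ok ab \<open>z \<in> A v\<close> by (simp add: ok_def)
    then show ?thesis using \<theta> els_hset[OF cD] by blast
  qed
  ultimately obtain c where c: "c \<in> A v" "\<And>z. z \<in> els T \<Longrightarrow> \<exists>d\<in>els c. els d = ?D z"
    using A_collection[OF le _ T(1), of "case_nat a (case_nat b e)" ?\<theta>] unfolding \<theta> by blast
  \<comment> \<open>If \<open>a\<close> is empty, the premise is true of every \<open>z\<close>,
    also outside \<open>T\<close>; then \<open>hempty\<close> is the required
    \<open>d\<close>.\<close>
  obtain c' where c': "c' \<in> A v" "els c' = insert hempty (els c)"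
    using A_insert[OF le A_hempty[OF le] c(1)] by blast
  have "\<exists>d\<in>els c'. (\<forall>x\<in>els a. \<exists>y\<in>els d. holds (case_nat x (case_nat y (case_nat z e))) \<psi>) \<and>
      (\<forall>y\<in>els d. \<exists>x\<in>els a. holds (case_nat x (case_nat y (case_nat z e))) \<psi>)"
    if z: "\<forall>x\<in>els a. \<exists>y\<in>els b. holds (case_nat x (case_nat y (case_nat z e))) \<psi>" for z
  proof (cases "els a = {}")
    case True
    then show ?thesis using c' by (intro bexI[of _ hempty]) auto
  next
    case False
    then obtain x y where xy: "x \<in> els a" "y \<in> els b" "holds (case_nat x (case_nat y (case_nat z e))) \<psi>"
      using z by blast
    have "z \<in> els T" using t[OF xy(3)] xy(1,2) T(2) T0(2) by auto
    then obtain d where "d \<in> els c" "els d = ?D z" using c(2) by blast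
    then show ?thesis using z c'(2) by (intro bexI[of _ d]) (auto, blast)
  qed
  then show ?thesis using c'(1) by blast
qed

lemma forces_subset_collection:
  assumes "ok v e" "wff set_ar \<psi>" "delta0 \<psi>" "z_set_bounded \<psi>"
  shows "forces v e (subset_collection \<psi>)"
proof -
  have "\<exists>c. c \<in> A w \<and> forces w (case_nat c (case_nat b (case_nat a e))) (Forall
    (ForallIn 3 (ExistsIn 3 (args [1, 0, 2] 6 \<psi>)) \<^bold>\<longrightarrow>
     ExistsIn 1 (ForallIn 4 (ExistsIn 1 (args [1, 0, 3] 7 \<psi>)) \<^bold>\<and>
                 ForallIn 0 (ExistsIn 5 (args [0, 1, 3] 7 \<psi>)))))"
    if w: "ok w e" "a \<in> A w" "b \<in> A w" for w a b
  proof -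
    obtain c where c: "c \<in> A w" and *: "\<And>z. (\<forall>x\<in>els a. \<exists>y\<in>els b. holds (case_nat x (case_nat y (case_nat z e))) \<psi>) \<Longrightarrow>
      (\<exists>d\<in>els c. (\<forall>x\<in>els a. \<exists>y\<in>els d. holds (case_nat x (case_nat y (case_nat z e))) \<psi>) \<and>
        (\<forall>y\<in>els d. \<exists>x\<in>els a. holds (case_nat x (case_nat y (case_nat z e))) \<psi>))"
      using A_subset_collection[OF w(1) assms(2-4) w(2,3)] by blast
    let ?e = "case_nat c (case_nat b (case_nat a e))"
    have ok': "ok w ?e" using w c by simp
    show ?thesis
    proof (intro exI[of _ c] HOL.conjI c, unfold forces_Forall_bounded[OF ok'], intro allI impI)
      fix u z
      assume u: "le w u" "z \<in> A u" "ok u ?e"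
        and prem: "forces u (case_nat z ?e) (ForallIn 3 (ExistsIn 3 (args [1, 0, 2] 6 \<psi>)))"
      note tr = A_trans[OF ok_le[OF u(3)]]
      have in_u: "a \<in> A u" "b \<in> A u" "c \<in> A u" "ok u e" using u by auto
      have "delta0 (ForallIn 3 (ExistsIn 3 (args [1, 0, 2] 6 \<psi>)))"
        using assms(3) by (intro delta0.intros delta0_args)
      then have "holds (case_nat z ?e) (ForallIn 3 (ExistsIn 3 (args [1, 0, 2] 6 \<psi>)))"
        using prem u in_u(4) by (simp add: delta0_absolute)
      then have "\<forall>x\<in>els a. \<exists>y\<in>els b. holds (case_nat x (case_nat y (case_nat z e))) \<psi>"
        by (simp add: V.cl.forces_args3[simplified])
      from *[OF this] obtain d where d: "d \<in> els c"
        "\<forall>x\<in>els a. \<exists>y\<in>els d. holds (case_nat x (case_nat y (case_nat z e))) \<psi>"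
        "\<forall>y\<in>els d. \<exists>x\<in>els a. holds (case_nat x (case_nat y (case_nat z e))) \<psi>" by blast
      have "d \<in> A u" using d(1) tr[OF in_u(3)] by blast
      let ?e' = "case_nat d (case_nat z ?e)"
      have "forces u ?e' (ForallIn 4 (ExistsIn 1 (args [1, 0, 3] 7 \<psi>)))"
        using assms(3) u(2,3) \<open>d \<in> A u\<close> d(2)
        by (subst delta0_absolute) (auto intro!: delta0.intros delta0_args simp: V.cl.forces_args3[simplified])
      moreover have "forces u ?e' (ForallIn 0 (ExistsIn 5 (args [0, 1, 3] 7 \<psi>)))"
        using assms(3) u(2,3) \<open>d \<in> A u\<close> d(3)
        by (subst delta0_absolute) (auto intro!: delta0.intros delta0_args simp: V.cl.forces_args3[simplified])
      ultimately show "forces u (case_nat z ?e) (ExistsIn 1 (ForallIn 4 (ExistsIn 1 (args [1, 0, 3] 7 \<psi>)) \<^bold>\<and>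
                 ForallIn 0 (ExistsIn 5 (args [0, 1, 3] 7 \<psi>))))"
        using u d(1) \<open>d \<in> A u\<close> by (subst forces_ExistsIn) auto
    qed
  qed
  then show ?thesis
    unfolding subset_collection_def forces_Forall2[OF assms(1)] forces_Exists by blast
qed

text \<open>At each node, \<open>h\<close> assigns 0 or 1 to every number. If no value 1 is found at
  \<open>u\<close>, all values are 0 at \<open>u\<close>; as bounded quantifiers look only at
  \<open>u\<close>, this contradicts the negated premise there.\<close>

lemma forces_MP:
  assumes "ok v e"
  shows "forces v e MP"
proof -
  let ?zero = "Exists (is_empty 0 \<^bold>\<and> pair_in 1 0 2)" and ?one = "Exists (is_one 0 \<^bold>\<and> pair_in 1 0 2)"
  have "forces u e' (ExistsIn 1 ?one)"
    if ok: "ok u e'" and f: "forces u e' (is_fun_to_two 0 1)" and n: "forces u e' (\<^bold>\<not> ForallIn 1 ?zero)" for u e'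
  proof (rule ccontr)
    assume not: "\<not> forces u e' (ExistsIn 1 ?one)"
    have "forces u (case_nat x e') ?zero" if x: "x \<in> els (e' 1)" "x \<in> A u" for x
    proof -
      have "forces u (case_nat x e') (Exists ((is_empty 0 \<^bold>\<or> is_one 0) \<^bold>\<and> pair_in 1 0 2 \<^bold>\<and> Forall (pair_in 2 0 3 \<^bold>\<longrightarrow> 0 \<^bold>= 1)))"
        using f x ok by (simp add: is_fun_to_two_def forces_ForallIn numeral_2_eq_2 del: forces.simps(5,6,7))
      then obtain i where "i \<in> A u" "forces u (case_nat i (case_nat x e')) (is_empty 0 \<^bold>\<or> is_one 0)"
        "forces u (case_nat i (case_nat x e')) (pair_in 1 0 2)" by auto
      moreover have "\<not> forces u (case_nat x e') ?one"
        using not x ok by (simp add: forces_ExistsIn del: forces.simps(5,6,7))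
      ultimately show ?thesis by auto
    qed
    then have "forces u e' (ForallIn 1 ?zero)" using ok by (simp add: forces_ForallIn del: forces.simps(5,6,7))
    then show False using n ok_le[OF ok] by simp
  qed
  note * = this
  have "forces u e' (\<^bold>\<not> ForallIn 1 ?zero \<^bold>\<longrightarrow> ExistsIn 1 ?one)" if "ok u e'" "forces u e' (is_fun_to_two 0 1)" for u e'
    using * that forces_mono ok_mono forces_Impl[OF that(1)] by blast
  then have "forces w e' (Forall (is_fun_to_two 0 1 \<^bold>\<longrightarrow> \<^bold>\<not> ForallIn 1 ?zero \<^bold>\<longrightarrow> ExistsIn 1 ?one))" if "ok w e'" for w e'
    unfolding forces_Forall_bounded[OF that] by auto
  then show ?thesis
    unfolding MP_def forces_Forall_bounded[OF assms] by auto
qed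

text \<open>Both the disjointness hypothesis and the choice property are bounded, hence absolute, so
  the axiom reduces to classical choice inside each domain.\<close>

lemma forces_AC:
  assumes "ok v e"
  shows "forces v e AC"
proof -
  let ?disj = "ForallIn 0 (ForallIn 1 (\<^bold>\<not> (1 \<^bold>= 0) \<^bold>\<longrightarrow> ForallIn 1 (\<^bold>\<not> (0 \<^bold>\<in> 1))))"
    and ?choice = "ForallIn 1 (ExistsIn 1 (0 \<^bold>\<in> 1 \<^bold>\<and> ForallIn 2 (0 \<^bold>\<in> 2 \<^bold>\<longrightarrow> 0 \<^bold>= 1)))"
  have d1: "delta0 ?disj" and d2: "delta0 ?choice" by (intro delta0.intros)+
  have "\<exists>b. b \<in> A w \<and> forces w (case_nat b (case_nat a e)) ?choice"
    if w: "a \<in> A w" "ok w e" and f: "forces w (case_nat a e) (ForallIn 0 (Exists (0 \<^bold>\<in> 1)) \<^bold>\<and> ?disj)" for w a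
  proof -
    have "els x \<noteq> {}" if "x \<in> els a" for x
    proof -
      have "x \<in> A w" using A_trans[OF ok_le[OF w(2)] w(1)] that by blast
      then show ?thesis using f that w by (auto simp: forces_ForallIn)
    qed
    note nonempty = this
    have "forces w (case_nat a e) ?disj" using f by (simp only: forces.simps(3))
    then have "holds (case_nat a e) ?disj"
      using iffD1[OF delta0_absolute[OF d1, of w "case_nat a e"]] w ok_case_nat by blast
    moreover have "holds (case_nat a e) ?disj \<longleftrightarrow> (\<forall>x\<in>els a. \<forall>y\<in>els a. x \<noteq> y \<longrightarrow> (\<forall>z\<in>els x. z \<notin> els y))"
      by simp
    ultimately have "els x \<inter> els y = {}" if "x \<in> els a" "y \<in> els a" "x \<noteq> y" for x y
      using that by blast
    with nonempty obtain b where b: "b \<in> A w" "\<forall>x\<in>els a. \<exists>!z. z \<in> els b \<and> z \<in> els x"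
      using A_choice[OF ok_le[OF w(2)] w(1)] by blast
    then have "\<forall>x\<in>els a. \<exists>z\<in>els b. z \<in> els x \<and> (\<forall>z'\<in>els b. z' \<in> els x \<longrightarrow> z' = z)" by meson
    then have "holds (case_nat b (case_nat a e)) ?choice" by (simp add: numeral_2_eq_2)
    then have "forces w (case_nat b (case_nat a e)) ?choice"
      using iffD2[OF delta0_absolute[OF d2, of w "case_nat b (case_nat a e)"]] b(1) w ok_case_nat by blast
    then show ?thesis using b(1) by blast
  qed
  then show ?thesis
    unfolding AC_def forces_Forall_bounded[OF assms] forces_Exists by blast
qed

theorem forces_axioms:
  assumes "le v v" "range e \<subseteq> A v" "\<phi> \<in> eq_axioms \<union> (IKP_plus \<union> {MP, AC})"
  shows "forces v e \<phi>"
proof -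
  have ok: "ok v e" and ne: "A v \<noteq> {}" using assms by (auto simp: ok_def)
  have u: "forces v e (uclose \<phi>)" if "\<And>w e. ok w e \<Longrightarrow> forces w e \<phi>" for \<phi>
    unfolding forces_uclose[OF assms(1) ne] using that refl2 by (auto simp: ok_def)
  from assms(3) show ?thesis
    unfolding IKP_plus_def IKP_def
    by (auto simp del: forces.simps intro: ok u forces_eq_axioms forces_ax_empty forces_ax_pairing forces_ax_union
        forces_ax_extensionality forces_ax_infinity forces_set_induction forces_separation
        forces_collections forces_subset_collection forces_MP forces_AC)
qed

end

section \<open>Definability in a countable transitive model\<close>

locale ctm =
  fixes M :: "hcset set"
  assumes ctm: "countable_transitive_model M"

sublocale ctm \<subseteq> transitive_class M
  using ctm by unfold_locales (auto simp: countable_transitive_model_def els_def)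

context ctm
begin

abbreviation F :: "(nat \<Rightarrow> hcset) \<Rightarrow> lset fm \<Rightarrow> bool" where
  "F \<equiv> cl.forces ()"

lemma countable_sub: "S \<subseteq> M \<Longrightarrow> countable S"
  using ctm countable_subset by (auto simp: countable_transitive_model_def)

lemma els_M: "x \<in> M \<Longrightarrow> y \<in> els x \<Longrightarrow> y \<in> M"
  using M_trans by blast

lemma ok_iff [simp]: "cl.ok v e \<longleftrightarrow> range e \<subseteq> M"
  by (simp add: cl.ok_def)

lemma sat_F: "wff set_ar \<phi> \<Longrightarrow> sat M e \<phi> \<longleftrightarrow> F e \<phi>"
proof (induction \<phi> arbitrary: e)
  case (Atom r ts)
  then obtain i j where "ts = [i, j]"
    by (auto simp: set_ar_def numeral_2_eq_2 length_Suc_conv)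
  then show ?case by (cases r) (simp_all add: hcmem_iff)
qed auto

lemma ZFC_F:
  assumes "\<phi> \<in> ZFC" "wff set_ar \<phi>" "range e \<subseteq> M"
  shows "F e \<phi>"
  using assms ctm sat_F by (auto simp: countable_transitive_model_def)

lemma ZFC_uclose:
  assumes "uclose \<phi> \<in> ZFC" "wff set_ar \<phi>" "range e \<subseteq> M"
  shows "F e \<phi>"
  using ZFC_F[OF assms(1) _ assms(3)] assms(2,3) cl.forces_uclose[of "()" e \<phi>] by auto

text \<open>Terms are just variables and parameters from \<open>M\<close>, as the language is
  relational; operations such as pairing enter through their graphs, as in
  \<open>mdef_upair\<close>.\<close>

definition tm :: "((nat \<Rightarrow> hcset) \<Rightarrow> hcset) \<Rightarrow> bool" where
  "tm a \<longleftrightarrow> (\<exists>i. a = (\<lambda>e. e i)) \<or> (\<exists>p\<in>M. a = (\<lambda>_. p))"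

lemma tm_proj: "tm (\<lambda>e. e i)" and tm_const: "p \<in> M \<Longrightarrow> tm (\<lambda>_. p)"
  by (auto simp: tm_def)

lemma tm_case_nat: "tm a \<Longrightarrow> (\<And>j. tm (\<lambda>e. g e j)) \<Longrightarrow> tm (\<lambda>e. case_nat (a e) (g e) i)"
  by (cases i) simp_all

lemma tm_in: "tm a \<Longrightarrow> range e \<subseteq> M \<Longrightarrow> a e \<in> M"
  by (auto simp: tm_def)

text \<open>\<open>Q e\<close> is definable over \<open>M\<close> from the \<open>e i\<close> and parameters in \<open>M\<close>.\<close>

definition mdef :: "((nat \<Rightarrow> hcset) \<Rightarrow> bool) \<Rightarrow> bool" where
  "mdef Q \<longleftrightarrow> (\<exists>\<phi> g. wff set_ar \<phi> \<and> (\<forall>i. tm (\<lambda>e. g e i)) \<and> (\<forall>e. range e \<subseteq> M \<longrightarrow> Q e = F (g e) \<phi>))"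

lemma mdefI: "wff set_ar \<phi> \<Longrightarrow> (\<And>i. tm (\<lambda>e. g e i)) \<Longrightarrow> (\<And>e. range e \<subseteq> M \<Longrightarrow> Q e = F (g e) \<phi>) \<Longrightarrow> mdef Q"
  unfolding mdef_def by blast

lemma mdef_cong: "mdef P \<Longrightarrow> (\<And>e. range e \<subseteq> M \<Longrightarrow> Q e = P e) \<Longrightarrow> mdef Q"
  unfolding mdef_def by auto

lemma M_nonempty: "M \<noteq> {}"
  using ctm by (auto simp: countable_transitive_model_def)

lemma hempty_M: "hempty \<in> M"
proof -
  obtain m where m: "m \<in> M" using M_nonempty by blast
  then have e: "range (\<lambda>_::nat. m) \<subseteq> M" by auto
  have "F (\<lambda>_. m) ax_empty"
    by (rule ZFC_F[OF _ _ e]) (auto simp: ZFC_def ax_empty_def)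
  then obtain x where "x \<in> M" "els x = {}"
    using els_M e by (auto simp: ax_empty_def cl.forces_ForallIn)
  then show ?thesis by (metis els_simps(4) els_inject)
qed

lemma mdef_const: "mdef (\<lambda>_. P)"
proof (cases P)
  case True
  then show ?thesis
    by (intro mdefI[of "\<^bold>\<bottom> \<^bold>\<longrightarrow> \<^bold>\<bottom>" "\<lambda>e. e"]) (auto intro: tm_proj)
next
  case False
  then show ?thesis
    by (intro mdefI[of "\<^bold>\<bottom>" "\<lambda>e. e"]) (auto intro: tm_proj)
qed

lemma mdef_mem: "tm a \<Longrightarrow> tm b \<Longrightarrow> mdef (\<lambda>e. a e \<in> els (b e))"
  by (intro mdefI[of "0 \<^bold>\<in> 1" "\<lambda>e. case_nat (a e) (\<lambda>_. b e)"]) (auto simp: set_ar_def intro: tm_case_nat)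

lemma mdef_eq: "tm a \<Longrightarrow> tm b \<Longrightarrow> mdef (\<lambda>e. a e = b e)"
  by (intro mdefI[of "0 \<^bold>= 1" "\<lambda>e. case_nat (a e) (\<lambda>_. b e)"]) (auto simp: set_ar_def intro: tm_case_nat)

text \<open>Two formulas come with separate parameter assignments; interleaving these at even and
  odd positions gives both a common assignment.\<close>

lemma mdef_pair:
  assumes "mdef P" "mdef Q"
  obtains \<phi> \<psi> g where "wff set_ar \<phi>" "wff set_ar \<psi>" "\<And>i. tm (\<lambda>e. g e i)"
    "\<And>e. range e \<subseteq> M \<Longrightarrow> P e = F (g e) \<phi>" "\<And>e. range e \<subseteq> M \<Longrightarrow> Q e = F (g e) \<psi>"
proof -
  from assms obtain \<phi> \<psi> g h where
    1: "wff set_ar \<phi>" "\<And>i. tm (\<lambda>e. g e i)" "\<And>e. range e \<subseteq> M \<Longrightarrow> P e = F (g e) \<phi>" and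
    2: "wff set_ar \<psi>" "\<And>i. tm (\<lambda>e. h e i)" "\<And>e. range e \<subseteq> M \<Longrightarrow> Q e = F (h e) \<psi>"
    unfolding mdef_def by blast
  let ?k = "\<lambda>e i. if even i then g e (i div 2) else h e (i div 2)"
  have "?k e \<circ> (\<lambda>i. 2 * i) = g e" "?k e \<circ> (\<lambda>i. Suc (2 * i)) = h e" for e
    by (auto simp: fun_eq_iff)
  then have "F (?k e) (ren (\<lambda>i. 2 * i) \<phi>) = F (g e) \<phi>" "F (?k e) (ren (\<lambda>i. Suc (2 * i)) \<psi>) = F (h e) \<psi>" for e
    unfolding cl.forces_ren by metis+
  moreover have "tm (\<lambda>e. ?k e i)" for i using 1(2) 2(2) by (cases "even i") auto
  ultimately show thesis
    using 1 2 by (intro that[of "ren (\<lambda>i. 2 * i) \<phi>" "ren (\<lambda>i. Suc (2 * i)) \<psi>" ?k]) auto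
qed

lemma mdef_conj: "mdef P \<Longrightarrow> mdef Q \<Longrightarrow> mdef (\<lambda>e. P e \<and> Q e)"
  by (erule (1) mdef_pair, rule_tac \<phi> = "\<phi> \<^bold>\<and> \<psi>" and g = g in mdefI) auto

lemma mdef_disj: "mdef P \<Longrightarrow> mdef Q \<Longrightarrow> mdef (\<lambda>e. P e \<or> Q e)"
  by (erule (1) mdef_pair, rule_tac \<phi> = "\<phi> \<^bold>\<or> \<psi>" and g = g in mdefI) auto

lemma mdef_imp: "mdef P \<Longrightarrow> mdef Q \<Longrightarrow> mdef (\<lambda>e. P e \<longrightarrow> Q e)"
  by (erule (1) mdef_pair, rule_tac \<phi> = "\<phi> \<^bold>\<longrightarrow> \<psi>" and g = g in mdefI) auto

lemma mdef_not: "mdef P \<Longrightarrow> mdef (\<lambda>e. \<not> P e)"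
  using mdef_imp[OF _ mdef_const[of False]] by simp

lemma mdef_iff: "mdef P \<Longrightarrow> mdef Q \<Longrightarrow> mdef (\<lambda>e. P e \<longleftrightarrow> Q e)"
  unfolding iff_conv_conj_imp by (intro mdef_conj mdef_imp)

text \<open>Each \<open>g e i\<close> is either the variable \<open>e 0\<close> or independent of
  it. Hence the dependence on a distinguished variable can be made syntactic, by a renaming
  \<open>r\<close> that puts it at index \<open>0\<close>, as quantification and the axiom schemes
  require.\<close>

lemma tm_split:
  fixes g :: "(nat \<Rightarrow> hcset) \<Rightarrow> nat \<Rightarrow> hcset"
  assumes "\<And>i. tm (\<lambda>e. g e i)"
  obtains r h where "\<And>i. tm (\<lambda>e. h e i)" "\<And>x e. case_nat x (h e) \<circ> r = g (case_nat x e)"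
proof -
  have "\<exists>r h. tm h \<and> (\<forall>x e. g (case_nat x e) i = (if r then x else h e))" for i
  proof -
    consider j where "(\<lambda>e. g e i) = (\<lambda>e. e j)" | p where "p \<in> M" "(\<lambda>e. g e i) = (\<lambda>_. p)"
      using assms[of i] unfolding tm_def by blast
    then show ?thesis
    proof cases
      case (1 j)
      show ?thesis
      proof (cases j)
        case 0
        \<comment> \<open>Here \<open>r\<close> selects \<open>x\<close>, so \<open>h\<close> only
          has to be some term, and a constant is taken.\<close>
        then show ?thesis using fun_cong[OF 1] tm_const[OF hempty_M]
          by (intro exI[of _ True] exI[of _ "\<lambda>_. hempty"]) auto
      next
        case (Suc k)
        then show ?thesis using fun_cong[OF 1] tm_proj
          by (intro exI[of _ False] exI[of _ "\<lambda>e. e k"]) auto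
      qed
    next
      case (2 p)
      then show ?thesis using fun_cong[OF 2(2)] tm_const
        by (intro exI[of _ False] exI[of _ "\<lambda>_. p"]) auto
    qed
  qed
  then obtain r h where h: "\<And>i. tm (h i)" "\<And>i x e. g (case_nat x e) i = (if r i then x else h i e)"
    by metis
  show thesis
    by (rule that[of "\<lambda>e i. h i e" "\<lambda>i. if r i then 0 else Suc i"]) (auto simp: fun_eq_iff h)
qed

lemma mdef_ex:
  assumes "mdef (\<lambda>e. Q (e 0) (\<lambda>i. e (Suc i)))"
  shows "mdef (\<lambda>e. \<exists>x\<in>M. Q x e)"
proof -
  obtain \<phi> g where g: "wff set_ar \<phi>" "\<And>i. tm (\<lambda>e. g e i)"
    "\<And>e. range e \<subseteq> M \<Longrightarrow> Q (e 0) (\<lambda>i. e (Suc i)) = F (g e) \<phi>"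
    using assms unfolding mdef_def by blast
  obtain r h where h: "\<And>i. tm (\<lambda>e. h e i)" "\<And>x e. case_nat x (h e) \<circ> r = g (case_nat x e)"
    using tm_split[of g, OF g(2)] by metis
  have "Q x e = F (case_nat x (h e)) (ren r \<phi>)" if "range e \<subseteq> M" "x \<in> M" for x e
    using g(3)[of "case_nat x e"] that by (simp add: cl.forces_ren h)
  then show ?thesis
    by (intro mdefI[of "Exists (ren r \<phi>)" h]) (use g(1) h(1) in auto)
qed

lemma mdef_all: "mdef (\<lambda>e. Q (e 0) (\<lambda>i. e (Suc i))) \<Longrightarrow> mdef (\<lambda>e. \<forall>x\<in>M. Q x e)"
  using mdef_not[OF mdef_ex[OF mdef_not]] by simp

lemma tm_shift: "tm a \<Longrightarrow> tm (\<lambda>e. a (\<lambda>i. e (Suc i)))"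
  by (auto simp: tm_def)

lemma mdef_bex:
  assumes "tm a" "mdef (\<lambda>e. Q (e 0) (\<lambda>i. e (Suc i)))"
  shows "mdef (\<lambda>e. \<exists>x\<in>els (a e). Q x e)"
proof -
  have "mdef (\<lambda>e. \<exists>x\<in>M. x \<in> els (a e) \<and> Q x e)"
    by (intro mdef_ex mdef_conj mdef_mem tm_proj tm_shift assms)
  then show ?thesis by (rule mdef_cong) (use tm_in[OF assms(1)] els_M in blast)
qed

lemma mdef_ball:
  assumes "tm a" "mdef (\<lambda>e. Q (e 0) (\<lambda>i. e (Suc i)))"
  shows "mdef (\<lambda>e. \<forall>x\<in>els (a e). Q x e)"
  using mdef_not[OF mdef_bex[OF assms(1) mdef_not[OF assms(2)]]] by simp

text \<open>The general \<open>mdef_mem\<close> and \<open>mdef_eq\<close> are left out, as they would also match atoms with compound sides.\<close>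

lemmas mdef_basic = mdef_mem[OF tm_proj] mdef_mem[OF tm_const] mdef_eq[OF tm_proj tm_proj] mdef_eq[OF tm_proj tm_const]
  mdef_eq[OF tm_const tm_proj] mdef_conj mdef_disj mdef_imp mdef_not mdef_iff mdef_ex mdef_all
  mdef_bex mdef_ball tm_proj tm_const

section \<open>Closure properties of the model\<close>

lemma eq_iff_M: "x \<in> M \<Longrightarrow> els y \<subseteq> M \<Longrightarrow> x = y \<longleftrightarrow> (\<forall>z\<in>M. z \<in> els x \<longleftrightarrow> z \<in> els y)"
  using els_M[of x] els_inject[of x y] by blast

lemma upair_M:
  assumes "x \<in> M" "y \<in> M"
  shows "upair x y \<in> M"
proof -
  let ?e = "\<lambda>_::nat. x"
  have e: "range ?e \<subseteq> M" using assms by auto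
  have "F ?e ax_pairing" by (rule ZFC_F[OF _ _ e]) (auto simp: ZFC_def ax_pairing_def set_ar_def)
  then have "\<forall>x\<in>M. \<forall>y\<in>M. \<exists>z\<in>M. \<forall>w\<in>M. w \<in> els z \<longleftrightarrow> w = x \<or> w = y"
    by (simp add: ax_pairing_def numeral_eq_Suc iff_conv_conj_imp)
  from bspec[OF bspec[OF this assms(1)] assms(2)]
  obtain z where z: "z \<in> M" "\<forall>w\<in>M. w \<in> els z \<longleftrightarrow> w = x \<or> w = y" ..
  then have "z = upair x y" using assms by (subst eq_iff_M) auto
  then show ?thesis using z(1) by simp
qed

lemma hunion_M:
  assumes "x \<in> M"
  shows "hunion x \<in> M"
proof -
  let ?e = "\<lambda>_::nat. x"
  have e: "range ?e \<subseteq> M" using assms by auto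
  have "F ?e ax_union" by (rule ZFC_F[OF _ _ e]) (auto simp: ZFC_def ax_union_def set_ar_def)
  then have "\<forall>x\<in>M. \<exists>z\<in>M. \<forall>w\<in>M. w \<in> els z \<longleftrightarrow> (\<exists>u\<in>M. u \<in> els x \<and> w \<in> els u)"
    by (simp add: ax_union_def numeral_eq_Suc iff_conv_conj_imp)
  from bspec[OF this assms]
  obtain z where z: "z \<in> M" "\<forall>w\<in>M. w \<in> els z \<longleftrightarrow> (\<exists>u\<in>M. u \<in> els x \<and> w \<in> els u)" ..
  have "els (hunion x) \<subseteq> M" using els_M assms by auto
  then have "z = hunion x" using z els_M[OF assms] by (subst eq_iff_M) auto
  then show ?thesis using z(1) by simp
qed

text \<open>The power set in the sense of \<open>M\<close>. It is countable because \<open>M\<close>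
  is, although the full power set of an infinite set is not.\<close>

definition mpow :: "hcset \<Rightarrow> hcset" where
  "mpow x = hset {y \<in> M. els y \<subseteq> els x}"

lemma els_mpow [simp]: "els (mpow x) = {y \<in> M. els y \<subseteq> els x}"
  unfolding mpow_def by (rule els_hset) (rule countable_sub, auto)

lemma mpow_M:
  assumes "x \<in> M"
  shows "mpow x \<in> M"
proof -
  let ?e = "\<lambda>_::nat. x"
  have e: "range ?e \<subseteq> M" using assms by auto
  have "F ?e ax_power" by (rule ZFC_F[OF _ _ e]) (auto simp: ZFC_def ax_power_def set_ar_def)
  then have "\<forall>x\<in>M. \<exists>z\<in>M. \<forall>w\<in>M. w \<in> els z \<longleftrightarrow> (\<forall>u. u \<in> els w \<longrightarrow> u \<in> M \<longrightarrow> u \<in> els x)"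
    using e by (simp add: ax_power_def numeral_eq_Suc cl.forces_ForallIn iff_conv_conj_imp)
  from bspec[OF this assms]
  obtain z where z: "z \<in> M" "\<forall>w\<in>M. w \<in> els z \<longleftrightarrow> (\<forall>u. u \<in> els w \<longrightarrow> u \<in> M \<longrightarrow> u \<in> els x)" ..
  moreover have "(\<forall>u. u \<in> els w \<longrightarrow> u \<in> M \<longrightarrow> u \<in> els x) \<longleftrightarrow> els w \<subseteq> els x" if "w \<in> M" for w
    using els_M[OF that] by blast
  ultimately have "z = mpow x" by (subst eq_iff_M) auto
  then show ?thesis using z(1) by simp
qed

lemma M_separation:
  assumes "mdef (\<lambda>e. Q (e 0))" "a \<in> M"
  shows "hset {x \<in> els a. Q x} \<in> M"
proof -
  obtain \<phi> g where g: "wff set_ar \<phi>" "\<And>i. tm (\<lambda>e. g e i)"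
    "\<And>e. range e \<subseteq> M \<Longrightarrow> Q (e 0) = F (g e) \<phi>"
    using assms unfolding mdef_def by blast
  obtain r h where h: "\<And>i. tm (\<lambda>e. h e i)" "\<And>x e. case_nat x (h e) \<circ> r = g (case_nat x e)"
    using tm_split[of g, OF g(2)] by metis
  have rng: "range (\<lambda>_. a) \<subseteq> M" using assms by auto
  \<comment> \<open>\<open>Q\<close> depends only on \<open>e 0\<close>, so the other variables may
    take any value in \<open>M\<close>, here \<open>a\<close>.\<close>
  define p where "p = h (\<lambda>_. a)"
  have p: "range p \<subseteq> M" unfolding p_def using tm_in[OF h(1) rng] by auto
  have Q: "Q x = F (case_nat x p) (ren r \<phi>)" if "x \<in> M" for x
    using g(3)[of "case_nat x (\<lambda>_. a)"] that rng by (simp add: cl.forces_ren h p_def)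
  have "F p (separation (ren r \<phi>))"
    by (rule ZFC_uclose[OF _ _ p]) (auto simp: ZFC_def separation_def g(1) set_ar_def args_def)
  then have "\<forall>a\<in>M. \<exists>y\<in>M. \<forall>x\<in>M. x \<in> els y \<longleftrightarrow> x \<in> els a \<and> F (case_nat x p) (ren r \<phi>)"
    by (simp add: separation_def cl.forces_args1[simplified] numeral_2_eq_2 iff_conv_conj_imp)
  from bspec[OF this assms(2)]
  obtain y where y: "y \<in> M" "\<forall>x\<in>M. x \<in> els y \<longleftrightarrow> x \<in> els a \<and> F (case_nat x p) (ren r \<phi>)" ..
  then have S: "els y = {x \<in> els a. Q x}" using Q els_M assms(2) by blast
  then have "y = hset {x \<in> els a. Q x}" by (metis hset_els)
  then show ?thesis using y(1) by simp
qed

lemma els_separation [simp]: "els (hset {x \<in> els a. Q x}) = {x \<in> els a. Q x}"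
  by (rule els_hset) (rule countable_subset[OF _ countable_els[of a]], auto)

lemma M_replacement:
  assumes "mdef (\<lambda>e. R (e 0) (e (Suc 0)))" "a \<in> M"
    and func: "\<And>x. x \<in> els a \<Longrightarrow> \<exists>y\<in>M. R x y \<and> (\<forall>y'\<in>M. R x y' \<longrightarrow> y' = y)"
  obtains b where "b \<in> M" "els b = {y \<in> M. \<exists>x\<in>els a. R x y}"
proof -
  obtain \<phi> g where g: "wff set_ar \<phi>" "\<And>i. tm (\<lambda>e. g e i)"
    "\<And>e. range e \<subseteq> M \<Longrightarrow> R (e 0) (e (Suc 0)) = F (g e) \<phi>"
    using assms unfolding mdef_def by blast
  obtain r h where h: "\<And>i. tm (\<lambda>e. h e i)" "\<And>x e. case_nat x (h e) \<circ> r = g (case_nat x e)"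
    using tm_split[of g, OF g(2)] by metis
  obtain r' h' where h': "\<And>i. tm (\<lambda>e. h' e i)" "\<And>x e. case_nat x (h' e) \<circ> r' = h (case_nat x e)"
    using tm_split[of h, OF h(1)] by metis
  have rng: "range (\<lambda>_. a) \<subseteq> M" using assms by auto
  define p where "p = h' (\<lambda>_. a)"
  have p: "range p \<subseteq> M" unfolding p_def using tm_in[OF h'(1) rng] by auto
  \<comment> \<open>The two splittings are combined: \<open>r\<close> isolates \<open>x\<close> at
    index \<open>0\<close>, and \<open>lift_ren r'\<close> then isolates \<open>y\<close> at index
    \<open>1\<close>.\<close>
  let ?\<phi> = "ren (lift_ren r' \<circ> r) \<phi>"
  have "case_nat x (case_nat y p) \<circ> (lift_ren r' \<circ> r) = g (case_nat x (case_nat y (\<lambda>_. a)))" for x y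
  proof -
    have "case_nat x (case_nat y p) \<circ> lift_ren r' = case_nat x (h (case_nat y (\<lambda>_. a)))"
      unfolding cl.case_nat_lift_ren p_def h' ..
    then show ?thesis by (metis h(2) comp_assoc)
  qed
  then have R: "R x y = F (case_nat x (case_nat y p)) ?\<phi>" if "x \<in> M" "y \<in> M" for x y
    using g(3)[of "case_nat x (case_nat y (\<lambda>_. a))"] that rng by (simp add: cl.forces_ren)
  have "F p (replacement ?\<phi>)"
    by (rule ZFC_uclose[OF _ _ p]) (auto simp: ZFC_def replacement_def g(1) set_ar_def args_def)
  moreover have "F (case_nat a p) (ForallIn 0 (Exists (args [1, 0] 3 ?\<phi> \<^bold>\<and> Forall (args [2, 0] 4 ?\<phi> \<^bold>\<longrightarrow> 0 \<^bold>= 1))))"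
    using func p assms(2) els_M[OF assms(2)] R
    by (simp add: cl.forces_ForallIn cl.forces_args2[simplified])
  ultimately have "F (case_nat a p) (Exists (Forall (0 \<^bold>\<in> 1 \<^bold>\<longleftrightarrow> ExistsIn 2 (args [0, 1] 4 ?\<phi>))))"
    using assms(2) by (simp add: replacement_def)
  then have "\<exists>b\<in>M. \<forall>y\<in>M. y \<in> els b \<longleftrightarrow> (\<exists>x. x \<in> els a \<and> x \<in> M \<and> F (case_nat x (case_nat y p)) ?\<phi>)"
    using assms(2) p
    by (simp add: cl.forces_ExistsIn cl.forces_args2[simplified] numeral_2_eq_2 iff_conv_conj_imp cong: conj_cong)
  then obtain b where b: "b \<in> M" "\<forall>y\<in>M. y \<in> els b \<longleftrightarrow> (\<exists>x. x \<in> els a \<and> x \<in> M \<and> F (case_nat x (case_nat y p)) ?\<phi>)" ..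
  then have "els b = {y \<in> M. \<exists>x\<in>els a. R x y}" using R els_M[OF assms(2)] els_M[OF b(1)] by blast
  then show thesis using b(1) that by blast
qed

lemma M_choice:
  assumes "a \<in> M" "\<And>x. x \<in> els a \<Longrightarrow> els x \<noteq> {}"
    "\<And>x y. x \<in> els a \<Longrightarrow> y \<in> els a \<Longrightarrow> x \<noteq> y \<Longrightarrow> els x \<inter> els y = {}"
  shows "\<exists>b\<in>M. \<forall>x\<in>els a. \<exists>!z. z \<in> els b \<and> z \<in> els x"
proof -
  let ?e = "\<lambda>_::nat. a"
  have e: "range ?e \<subseteq> M" using assms(1) by auto
  let ?hyp = "ForallIn 0 (Exists (0 \<^bold>\<in> 1)) \<^bold>\<and>
      ForallIn 0 (ForallIn 1 (\<^bold>\<not> (1 \<^bold>= 0) \<^bold>\<longrightarrow> ForallIn 1 (\<^bold>\<not> (0 \<^bold>\<in> 1))))"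
    and ?con = "Exists (ForallIn 1 (ExistsIn 1 (0 \<^bold>\<in> 1 \<^bold>\<and> ForallIn 2 (0 \<^bold>\<in> 2 \<^bold>\<longrightarrow> 0 \<^bold>= 1))))"
  have "F ?e AC" by (rule ZFC_F[OF _ _ e]) (auto simp: ZFC_def AC_def set_ar_def)
  moreover have "\<exists>z\<in>M. z \<in> els x" if "x \<in> els a" for x
    using assms(2)[OF that] els_M[OF els_M[OF assms(1) that]] by blast
  then have "F (case_nat a ?e) ?hyp"
    using assms(1,3) e by (auto simp: cl.forces_ForallIn)
  ultimately have "F (case_nat a ?e) ?con" unfolding AC_def using assms(1) by auto
  then obtain b where b: "b \<in> M" "\<And>x. x \<in> els a \<Longrightarrow> x \<in> M \<Longrightarrow>
      \<exists>z. z \<in> els b \<and> z \<in> M \<and> z \<in> els x \<and> (\<forall>z'. z' \<in> els b \<longrightarrow> z' \<in> M \<longrightarrow> z' \<in> els x \<longrightarrow> z' = z)"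
    using e assms(1)
    by (auto simp: cl.forces_ForallIn cl.forces_ExistsIn numeral_2_eq_2 cong: conj_cong)
  then show ?thesis using els_M[OF assms(1)] els_M by (intro bexI[of _ b]) (meson, blast)
qed

lemma mdef_upair: "tm a \<Longrightarrow> tm b \<Longrightarrow> tm c \<Longrightarrow> mdef (\<lambda>e. a e = upair (b e) (c e))"
proof -
  assume tm: "tm a" "tm b" "tm c"
  have "mdef (\<lambda>e. \<forall>z\<in>M. z \<in> els (a e) \<longleftrightarrow> z = b e \<or> z = c e)"
    by (intro mdef_basic mdef_eq[OF tm_proj] tm tm[THEN tm_shift] tm[THEN tm_shift, THEN tm_shift])
  then show ?thesis
    by (rule mdef_cong, subst eq_iff_M) (auto dest: els_M[OF tm_in] simp: tm_in tm)
qed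

lemma mdef_hsucc: "tm a \<Longrightarrow> tm b \<Longrightarrow> mdef (\<lambda>e. a e = hsucc (b e))"
proof -
  assume tm: "tm a" "tm b"
  have "mdef (\<lambda>e. \<forall>z\<in>M. z \<in> els (a e) \<longleftrightarrow> z = b e \<or> z \<in> els (b e))"
    by (intro mdef_basic mdef_eq[OF tm_proj] tm tm[THEN tm_shift] tm[THEN tm_shift, THEN tm_shift])
  then show ?thesis
    by (rule mdef_cong, subst eq_iff_M) (auto dest: els_M[OF tm_in[OF tm(2)]] simp: tm_in tm)
qed

lemma mdef_kpair: "tm a \<Longrightarrow> tm b \<Longrightarrow> tm c \<Longrightarrow> mdef (\<lambda>e. a e = kpair (b e) (c e))"
proof -
  assume tm: "tm a" "tm b" "tm c"
  have "mdef (\<lambda>e. \<exists>u\<in>M. \<exists>v\<in>M. u = upair (b e) (b e) \<and> v = upair (b e) (c e) \<and> a e = upair u v)"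
    by (intro mdef_basic mdef_upair tm tm[THEN tm_shift] tm[THEN tm_shift, THEN tm_shift])
  then show ?thesis
    by (rule mdef_cong) (use tm tm_in upair_M in \<open>simp add: kpair_def\<close>)
qed

lemma kpair_M: "x \<in> M \<Longrightarrow> y \<in> M \<Longrightarrow> kpair x y \<in> M"
  by (simp add: kpair_def upair_M)

lemma kpair_components: "kpair x y \<in> M \<Longrightarrow> x \<in> M" "kpair x y \<in> M \<Longrightarrow> y \<in> M"
proof -
  have "upair x y \<in> M" if "kpair x y \<in> M" using els_M[OF that] by (simp add: kpair_def)
  then show "kpair x y \<in> M \<Longrightarrow> x \<in> M" "kpair x y \<in> M \<Longrightarrow> y \<in> M" by (auto dest: els_M)
qed

lemma mdef_kpair_mem: "tm a \<Longrightarrow> tm b \<Longrightarrow> tm c \<Longrightarrow> mdef (\<lambda>e. kpair (b e) (c e) \<in> els (a e))"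
proof -
  assume tm: "tm a" "tm b" "tm c"
  have "mdef (\<lambda>e. \<exists>p\<in>els (a e). p = kpair (b e) (c e))"
    by (intro mdef_basic mdef_kpair tm tm[THEN tm_shift] tm[THEN tm_shift, THEN tm_shift])
  then show ?thesis by (rule mdef_cong) auto
qed

lemma mdef_mpow: "tm a \<Longrightarrow> tm b \<Longrightarrow> mdef (\<lambda>e. a e = mpow (b e))"
proof -
  assume tm: "tm a" "tm b"
  have "mdef (\<lambda>e. \<forall>z\<in>M. z \<in> els (a e) \<longleftrightarrow> (\<forall>w\<in>els z. w \<in> els (b e)))"
    by (intro mdef_basic mdef_eq[OF tm_proj] tm tm[THEN tm_shift] tm[THEN tm_shift, THEN tm_shift])
  then show ?thesis
    by (rule mdef_cong, subst eq_iff_M) (auto dest: els_M[OF tm_in] simp: tm_in tm)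
qed

lemmas mdef_rules = mdef_basic mdef_upair mdef_hsucc mdef_kpair mdef_kpair_mem mdef_mpow

end

text \<open>Bounded quantifiers suffice to characterize the numerals: \<open>y\<close> and all its
  elements are zero or successors, and well-foundedness excludes anything else. Being absolute, the
  condition can be used in \<open>M\<close> and in every domain.\<close>

definition numlike :: "hcset \<Rightarrow> bool" where
  "numlike y \<longleftrightarrow> (y = hempty \<or> (\<exists>z\<in>els y. y = hsucc z)) \<and>
    (\<forall>u\<in>els y. u = hempty \<or> (\<exists>z\<in>els u. u = hsucc z))"

lemma numlike_iff: "numlike y \<longleftrightarrow> y \<in> range num"
proof
  show "numlike y \<Longrightarrow> y \<in> range num"
  proof (induction y rule: hcset_induct)
    case (step y)
    show ?case
    proof (cases "y = hempty")
      case True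
      then show ?thesis by (metis num.simps(1) rangeI)
    next
      case False
      then obtain z where z: "z \<in> els y" "y = hsucc z" using step.prems by (auto simp: numlike_def)
      then have "numlike z" using step.prems by (auto simp: numlike_def)
      then obtain n where "z = num n" using step.IH z by blast
      then have "y = num (Suc n)" using z by simp
      then show ?thesis by blast
    qed
  qed
next
  have s: "num n = hempty \<or> (\<exists>z\<in>els (num n). num n = hsucc z)" for n by (cases n) auto
  assume "y \<in> range num"
  then obtain n where y: "y = num n" by blast
  have "u = hempty \<or> (\<exists>z\<in>els u. u = hsucc z)" if u: "u \<in> els y" for u
  proof -
    obtain m where "u = num m" using u unfolding y els_num by blast
    then show ?thesis using s[of m] by blast
  qed
  then show "numlike y" using s[of n] unfolding numlike_def y by blast
qed

context ctm
begin

lemma mdef_numlike: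
  assumes "tm a"
  shows "mdef (\<lambda>e. numlike (a e))"
  unfolding numlike_def
  by (intro mdef_basic mdef_hsucc mdef_eq[OF assms tm_const] hempty_M assms assms[THEN tm_shift])

text \<open>The axiom of infinity yields an inductive set, and the numerals are separated from it by
  \<open>numlike\<close>.\<close>

lemma omega_M: "omega \<in> M"
proof -
  let ?e = "\<lambda>_::nat. hempty"
  have e: "range ?e \<subseteq> M" using hempty_M by auto
  have "F ?e ax_infinity"
    by (rule ZFC_F[OF _ _ e]) (auto simp: ZFC_def ax_infinity_def is_inductive_def is_empty_def is_succ_def set_ar_def)
  then obtain x where x: "x \<in> M" "F (case_nat x ?e) (is_inductive 0)"
    by (auto simp: ax_infinity_def)
  have 1: "hempty \<in> els x" "\<And>y. y \<in> els x \<Longrightarrow> hsucc y \<in> els x"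
    using x e els_M[OF x(1)] by (auto simp: is_inductive_def cl.forces_ForallIn cl.forces_ExistsIn)
  have "num n \<in> els x" for n by (induction n) (auto intro: 1)
  then have "{y \<in> els x. numlike y} = els omega" by (auto simp: numlike_iff)
  then have "hset {y \<in> els x. numlike y} = omega" by (metis hset_els)
  moreover have "hset {y \<in> els x. numlike y} \<in> M" by (intro M_separation x mdef_numlike tm_proj)
  ultimately show ?thesis by simp
qed

lemma num_M: "num n \<in> M"
  using els_M[OF omega_M] by simp

end

section \<open>Iterated power sets\<close>

inductive lex_less :: "nat list \<Rightarrow> nat list \<Rightarrow> bool" where
  head: "m < n \<Longrightarrow> length ms = length ns \<Longrightarrow> lex_less (m # ms) (n # ns)"
| tail: "lex_less ms ns \<Longrightarrow> lex_less (n # ms) (n # ns)"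

lemma lex_less_length: "lex_less ms ns \<Longrightarrow> length ms = length ns"
  by (induction rule: lex_less.induct) auto

lemma lex_less_trans: "lex_less ks ms \<Longrightarrow> lex_less ms ns \<Longrightarrow> lex_less ks ns"
proof (induction arbitrary: ns rule: lex_less.induct)
  case (head m n ms ns')
  from head.prems show ?case
    by cases (use head.hyps lex_less_length in \<open>force intro: lex_less.head\<close>)+
next
  case (tail ms ns' n)
  from tail.prems show ?case
    by cases (use tail lex_less_length[OF tail.hyps] in \<open>auto intro: lex_less.intros\<close>)
qed

lemma lex_less_linear: "length ms = length ns \<Longrightarrow> lex_less ms ns \<or> ms = ns \<or> lex_less ns ms"
proof (induction ms arbitrary: ns)
  case (Cons m ms)
  then obtain n ns' where ns: "ns = n # ns'" "length ms = length ns'" by (cases ns) auto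
  then show ?case using Cons.IH[OF ns(2)] by (cases m n rule: linorder_cases) (auto intro: lex_less.intros)
qed simp

text \<open>An approximation to the recursion: each pair is the initial one or is justified by a
  pair of \<open>f\<close> one step below. Membership induction on the first component then shows
  that every pair of \<open>f\<close> is correct.\<close>

definition iter_graph :: "(hcset \<Rightarrow> hcset) \<Rightarrow> hcset \<Rightarrow> hcset \<Rightarrow> bool" where
  "iter_graph g X f \<longleftrightarrow> (\<forall>p\<in>els f. p = kpair hempty X \<or>
    (\<exists>m Z Z'. p = kpair (hsucc m) Z \<and> kpair m Z' \<in> els f \<and> Z = g Z'))"

lemma iter_graph_sound:
  assumes "iter_graph g X f" "kpair n Y \<in> els f"
  shows "\<exists>k. n = num k \<and> Y = (g ^^ k) X"
  using assms(2)
proof (induction n arbitrary: Y rule: hcset_induct)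
  case (step n)
  consider "n = hempty" "Y = X" | m Z' where "n = hsucc m" "kpair m Z' \<in> els f" "Y = g Z'"
    using assms(1) step.prems unfolding iter_graph_def by fastforce
  then show ?case
  proof cases
    case 1
    then show ?thesis by (intro exI[of _ 0]) simp
  next
    case (2 m Z')
    then obtain k where "m = num k" "Z' = (g ^^ k) X" using step.IH[of m Z'] by auto
    then show ?thesis using 2 by (intro exI[of _ "Suc k"]) simp
  qed
qed

definition iter_fun :: "(hcset \<Rightarrow> hcset) \<Rightarrow> hcset \<Rightarrow> nat \<Rightarrow> hcset" where
  "iter_fun g X k = hset ((\<lambda>j. kpair (num j) ((g ^^ j) X)) ` {..k})"

lemma els_iter_fun: "els (iter_fun g X k) = (\<lambda>j. kpair (num j) ((g ^^ j) X)) ` {..k}"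
  unfolding iter_fun_def by (rule els_hset) simp

lemma iter_graph_complete: "iter_graph g X (iter_fun g X k)" "kpair (num k) ((g ^^ k) X) \<in> els (iter_fun g X k)"
proof -
  have "kpair (num j) ((g ^^ j) X) = kpair hempty X \<or> (\<exists>m Z Z'. kpair (num j) ((g ^^ j) X) = kpair (hsucc m) Z \<and>
      kpair m Z' \<in> els (iter_fun g X k) \<and> Z = g Z')" if "j \<le> k" for j
  proof (cases j)
    case (Suc i)
    have "kpair (num i) ((g ^^ i) X) \<in> els (iter_fun g X k)"
      using that Suc by (auto simp: els_iter_fun)
    then show ?thesis using Suc by auto
  qed simp
  then show "iter_graph g X (iter_fun g X k)" by (auto simp: iter_graph_def els_iter_fun)
qed (auto simp: els_iter_fun)

lemma iter_fun_Suc: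
  "iter_fun g X (Suc k) = hunion (upair (iter_fun g X k) (upair (kpair (num (Suc k)) ((g ^^ Suc k) X)) (kpair (num (Suc k)) ((g ^^ Suc k) X))))"
  by (rule hcset_ext) (auto simp: els_iter_fun atMost_Suc simp del: num.simps)

text \<open>The finite graph is built by pairing and union alone. This is applied both to
  \<open>M\<close> and to the domains of the nodes.\<close>

lemma iter_fun_in:
  assumes upair: "\<And>x y. x \<in> A \<Longrightarrow> y \<in> A \<Longrightarrow> upair x y \<in> A" and hunion: "\<And>x. x \<in> A \<Longrightarrow> hunion x \<in> A"
    and num: "\<And>j. num j \<in> A" and it: "\<And>j. j \<le> k \<Longrightarrow> (g ^^ j) X \<in> A"
  shows "iter_fun g X k \<in> A"
  using it
proof (induction k)
  case 0
  have "iter_fun g X 0 = upair (kpair (num 0) X) (kpair (num 0) X)"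
    by (rule hcset_ext) (auto simp: els_iter_fun)
  then show ?case using 0[of 0] num[of 0] by (auto simp: kpair_def intro!: upair)
next
  case (Suc k)
  have "kpair (num (Suc k)) ((g ^^ Suc k) X) \<in> A"
    unfolding kpair_def by (intro upair num Suc.prems order_refl)
  then show ?case unfolding iter_fun_Suc using Suc by (intro hunion upair) auto
qed

section \<open>The hierarchy of iterated power sets inside \<open>M\<close>\<close>

context ctm
begin

text \<open>\<open>G (Suc i)\<close> is the limit of the iterates of \<open>G i\<close>, so a single step at a more significant position of a
  level exceeds any number of steps at the positions after it.\<close>

primrec G :: "nat \<Rightarrow> hcset \<Rightarrow> hcset" where
  "G 0 = (\<lambda>X. hunion (upair X (mpow X)))"
| "G (Suc i) = (\<lambda>X. hset (\<Union>n. els ((G i ^^ n) X)))"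

declare G.simps [simp del]

text \<open>The definition asserts an approximating graph. Any such graph is correct by
  \<open>iter_graph_sound\<close>, and the graph up to \<open>k\<close> is in \<open>M\<close> by
  \<open>iter_fun_in\<close>; the quantifiers may be restricted to \<open>M\<close> since the
  components of a pair in \<open>M\<close> are in \<open>M\<close>.\<close>

lemma mdef_iter:
  assumes "\<And>a b. tm a \<Longrightarrow> tm b \<Longrightarrow> mdef (\<lambda>e. a e = g (b e))" and g: "\<And>X. X \<in> M \<Longrightarrow> g X \<in> M"
    and tm: "tm n" "tm a" "tm b"
  shows "mdef (\<lambda>e. \<exists>k. n e = num k \<and> a e = (g ^^ k) (b e))"
proof -
  note tms = tm tm[THEN tm_shift] tm[THEN tm_shift, THEN tm_shift]
  have "mdef (\<lambda>e. \<exists>f\<in>M. kpair (n e) (a e) \<in> els f \<and> (\<forall>p\<in>els f. p = kpair hempty (b e) \<or>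
      (\<exists>m\<in>M. \<exists>Z\<in>M. \<exists>Z'\<in>M. \<exists>s\<in>M. s = hsucc m \<and> p = kpair s Z \<and> kpair m Z' \<in> els f \<and> Z = g Z')))"
    by (intro mdef_rules assms(1) hempty_M tms)
  then show ?thesis
  proof (rule mdef_cong)
    fix e :: "nat \<Rightarrow> hcset" assume e: "range e \<subseteq> M"
    let ?graph = "\<lambda>f. \<forall>p\<in>els f. p = kpair hempty (b e) \<or>
      (\<exists>m\<in>M. \<exists>Z\<in>M. \<exists>Z'\<in>M. \<exists>s\<in>M. s = hsucc m \<and> p = kpair s Z \<and> kpair m Z' \<in> els f \<and> Z = g Z')"
    have eq: "?graph f \<longleftrightarrow> iter_graph g (b e) f" if "f \<in> M" for f
    proof -
      have 1: "m \<in> M \<and> Z \<in> M \<and> Z' \<in> M \<and> s \<in> M" if "kpair s Z \<in> els f" "s = hsucc m" "kpair m Z' \<in> els f" for m Z Z' s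
        using that \<open>f \<in> M\<close> els_M kpair_components by metis
      show ?thesis unfolding iter_graph_def
      proof (intro ball_cong refl)
        fix p assume "p \<in> els f"
        then show "(p = kpair hempty (b e) \<or>
            (\<exists>m\<in>M. \<exists>Z\<in>M. \<exists>Z'\<in>M. \<exists>s\<in>M. s = hsucc m \<and> p = kpair s Z \<and> kpair m Z' \<in> els f \<and> Z = g Z')) \<longleftrightarrow>
          (p = kpair hempty (b e) \<or> (\<exists>m Z Z'. p = kpair (hsucc m) Z \<and> kpair m Z' \<in> els f \<and> Z = g Z'))"
          using 1 by blast
      qed
    qed
    have b: "b e \<in> M" by (rule tm_in[OF tm(3) e])
    have "(g ^^ k) (b e) \<in> M" for k by (induction k) (auto intro: b g)
    then have fM: "iter_fun g (b e) k \<in> M" for k by (intro iter_fun_in upair_M hunion_M num_M)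
    have "\<exists>f\<in>M. kpair (n e) (a e) \<in> els f \<and> iter_graph g (b e) f" if "n e = num k" "a e = (g ^^ k) (b e)" for k
      using fM[of k] iter_graph_complete[where g = g and X = "b e" and k = k] that by auto
    moreover have "\<exists>k. n e = num k \<and> a e = (g ^^ k) (b e)" if "kpair (n e) (a e) \<in> els f" "iter_graph g (b e) f" for f
      using iter_graph_sound that by blast
    ultimately have "(\<exists>k. n e = num k \<and> a e = (g ^^ k) (b e)) \<longleftrightarrow>
        (\<exists>f\<in>M. kpair (n e) (a e) \<in> els f \<and> iter_graph g (b e) f)" by blast
    also have "\<dots> \<longleftrightarrow> (\<exists>f\<in>M. kpair (n e) (a e) \<in> els f \<and> ?graph f)"
      by (rule bex_cong[OF refl]) (simp only: eq)
    finally show "(\<exists>k. n e = num k \<and> a e = (g ^^ k) (b e)) \<longleftrightarrow> (\<exists>f\<in>M. kpair (n e) (a e) \<in> els f \<and> ?graph f)" .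
  qed
qed

text \<open>Definability of the iteration of \<open>G i\<close> lets replacement collect all
  iterates into a set of \<open>M\<close>, whose union is the limit.\<close>

lemma G_Suc:
  assumes "\<And>a b. tm a \<Longrightarrow> tm b \<Longrightarrow> mdef (\<lambda>e. a e = G i (b e))" "\<And>X. X \<in> M \<Longrightarrow> G i X \<in> M" and X: "X \<in> M"
  shows "G (Suc i) X \<in> M" "els (G (Suc i) X) = (\<Union>n. els ((G i ^^ n) X))"
proof -
  have it: "(G i ^^ k) X \<in> M" for k by (induction k) (auto intro: X assms(2))
  have "countable (\<Union>n. els ((G i ^^ n) X))" by (rule countable_sub) (use els_M it in blast)
  then show els: "els (G (Suc i) X) = (\<Union>n. els ((G i ^^ n) X))" by (simp add: els_hset G.simps(2))
  have "mdef (\<lambda>e. \<exists>k. e 0 = num k \<and> e (Suc 0) = (G i ^^ k) X)"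
    by (intro mdef_iter assms tm_proj tm_const X)
  then obtain b where b: "b \<in> M" "els b = {Y \<in> M. \<exists>n\<in>els omega. \<exists>k. n = num k \<and> Y = (G i ^^ k) X}"
    by (rule M_replacement[OF _ omega_M]) (use it in auto)
  have "G (Suc i) X = hunion b"
    by (rule hcset_ext, subst els) (use b(2) it in auto)
  then show "G (Suc i) X \<in> M" using hunion_M[OF b(1)] by simp
qed

text \<open>Closure and definability go by one induction: replacement at stage \<open>Suc i\<close>
  needs a definition of \<open>G i\<close>, and a definition of \<open>G (Suc i)\<close> needs the
  iterates of \<open>G i\<close> to lie in \<open>M\<close>.\<close>

lemma G_M_mdef:
  "X \<in> M \<Longrightarrow> G i X \<in> M" "tm a \<Longrightarrow> tm b \<Longrightarrow> mdef (\<lambda>e. a e = G i (b e))"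
proof (induction i arbitrary: X a b)
  case 0
  have G0: "G 0 X \<in> M" if "X \<in> M" for X
    using that by (simp add: G.simps mpow_M upair_M hunion_M)
  { case 1 then show ?case by (rule G0) }
  { case 2
    note tms = 2 2[THEN tm_shift] 2[THEN tm_shift, THEN tm_shift]
    have "mdef (\<lambda>e. \<forall>z\<in>M. z \<in> els (a e) \<longleftrightarrow> z \<in> els (b e) \<or> (\<forall>w\<in>els z. w \<in> els (b e)))"
      by (intro mdef_basic tms)
    then show ?case
    proof (rule mdef_cong)
      fix e :: "nat \<Rightarrow> hcset" assume e: "range e \<subseteq> M"
      have "a e \<in> M" "els (G 0 (b e)) \<subseteq> M" using 2 tm_in[OF _ e] G0 els_M by blast+
      then show "(a e = G 0 (b e)) \<longleftrightarrow>
          (\<forall>z\<in>M. z \<in> els (a e) \<longleftrightarrow> z \<in> els (b e) \<or> (\<forall>w\<in>els z. w \<in> els (b e)))"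
        by (subst eq_iff_M) (auto simp: G.simps)
    qed }
next
  case (Suc i)
  { case 1 show ?case by (rule G_Suc(1)[OF Suc.IH(2) Suc.IH(1) 1]) }
  { case 2
    note tms = 2 2[THEN tm_shift] 2[THEN tm_shift, THEN tm_shift] 2[THEN tm_shift, THEN tm_shift, THEN tm_shift]
    have "mdef (\<lambda>e. \<forall>z\<in>M. z \<in> els (a e) \<longleftrightarrow> (\<exists>n\<in>M. \<exists>W\<in>M. (\<exists>k. n = num k \<and> W = (G i ^^ k) (b e)) \<and> z \<in> els W))"
      by (intro mdef_basic mdef_iter Suc.IH tms)
    then show ?case
    proof (rule mdef_cong)
      fix e :: "nat \<Rightarrow> hcset" assume e: "range e \<subseteq> M"
      have ab: "a e \<in> M" "b e \<in> M" using 2 tm_in e by blast+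
      have G: "G (Suc i) (b e) \<in> M" "els (G (Suc i) (b e)) = (\<Union>n. els ((G i ^^ n) (b e)))"
        by (rule G_Suc[OF Suc.IH(2) Suc.IH(1) ab(2)]; assumption)+
      have it: "(G i ^^ k) (b e) \<in> M" for k by (induction k) (auto intro: ab Suc.IH)
      have W: "(\<exists>n\<in>M. \<exists>W\<in>M. (\<exists>k. n = num k \<and> W = (G i ^^ k) (b e)) \<and> z \<in> els W) \<longleftrightarrow>
          (\<exists>k. z \<in> els ((G i ^^ k) (b e)))" for z
        using it num_M by blast
      show "(a e = G (Suc i) (b e)) \<longleftrightarrow>
          (\<forall>z\<in>M. z \<in> els (a e) \<longleftrightarrow> (\<exists>n\<in>M. \<exists>W\<in>M. (\<exists>k. n = num k \<and> W = (G i ^^ k) (b e)) \<and> z \<in> els W))"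
        by (subst eq_iff_M[OF ab(1)], use els_M[OF G(1)] in blast, unfold G(2)) (simp add: W)
    qed }
qed

lemma els_G_Suc: "X \<in> M \<Longrightarrow> els (G (Suc i) X) = (\<Union>n. els ((G i ^^ n) X))"
  by (rule G_Suc(2)[OF G_M_mdef(2,1)])

lemma iterate_G_M: "X \<in> M \<Longrightarrow> (G i ^^ n) X \<in> M"
  by (induction n) (auto intro: G_M_mdef)

definition tr :: "hcset \<Rightarrow> bool" where "tr t \<longleftrightarrow> (\<forall>y\<in>els t. els y \<subseteq> els t)"

lemma G_increasing: "X \<in> M \<Longrightarrow> els X \<union> els (mpow X) \<subseteq> els (G i X)"
proof (induction i arbitrary: X)
  case 0
  then show ?case by (auto simp: G.simps)
next
  case (Suc i)
  have "els X \<union> els (mpow X) \<subseteq> els ((G i ^^ 1) X)" using Suc by simp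
  then show ?case unfolding els_G_Suc[OF Suc.prems] by blast
qed

lemma subset_G: "X \<in> M \<Longrightarrow> els X \<subseteq> els (G i X)" and mpow_subset_G: "X \<in> M \<Longrightarrow> els (mpow X) \<subseteq> els (G i X)"
  using G_increasing by blast+

lemma G_tr: "X \<in> M \<Longrightarrow> tr X \<Longrightarrow> tr (G i X)"
proof (induction i arbitrary: X)
  case 0
  then show ?case using els_M by (auto simp: G.simps tr_def)
next
  case (Suc i)
  have "tr ((G i ^^ n) X)" for n
    using Suc by (induction n) (auto intro: iterate_G_M)
  then show ?case unfolding els_G_Suc[OF Suc.prems(1)] tr_def by blast
qed

lemma iterate_G_mono:
  assumes "X \<in> M" "m \<le> n"
  shows "els ((G i ^^ m) X) \<subseteq> els ((G i ^^ n) X)"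
  using assms(2) by (rule lift_Suc_mono_le[rotated]) (simp add: subset_G iterate_G_M assms)

text \<open>A good set plays the role of an infinite cardinal: containing its own ordered pairs
  replaces the equality of an infinite cardinal with its square, and the numerals provide tags. Thus
  no theory of cardinals inside \<open>M\<close> has to be developed.\<close>

definition good :: "hcset \<Rightarrow> bool" where
  "good U \<longleftrightarrow> U \<in> M \<and> tr U \<and> (\<forall>u\<in>els U. \<forall>v\<in>els U. kpair u v \<in> els U) \<and> range num \<subseteq> els U"

text \<open>Both sets occur in a common iterate; their pair is a subset of it and so belongs to the
  next one. This argument takes a limit, hence the index \<open>Suc i\<close>.\<close>

lemma upair_G_Suc:
  assumes X: "X \<in> M" and xy: "x \<in> els (G (Suc i) X)" "y \<in> els (G (Suc i) X)"
  shows "upair x y \<in> els (G (Suc i) X)"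
proof -
  obtain m n where "x \<in> els ((G i ^^ m) X)" "y \<in> els ((G i ^^ n) X)"
    using xy unfolding els_G_Suc[OF X] by blast
  then have 1: "x \<in> els ((G i ^^ max m n) X)" "y \<in> els ((G i ^^ max m n) X)"
    using iterate_G_mono[OF X, of m "max m n"] iterate_G_mono[OF X, of n "max m n"] by auto
  then have "x \<in> M" "y \<in> M" using els_M iterate_G_M X by blast+
  then have "upair x y \<in> els (mpow ((G i ^^ max m n) X))" using 1 by (simp add: upair_M)
  then have "upair x y \<in> els ((G i ^^ Suc (max m n)) X)"
    using mpow_subset_G[OF iterate_G_M[OF X], where i = i] by (simp add: subset_iff)
  then show ?thesis unfolding els_G_Suc[OF X] by blast
qed

lemma good_G:
  assumes "X \<in> M" "tr X" "range num \<subseteq> els X"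
  shows "good (G (Suc i) X)"
  unfolding good_def
  using assms upair_G_Suc[OF assms(1)] G_tr[OF assms(1,2)] subset_G[OF assms(1)] G_M_mdef(1)[OF assms(1)]
  by (simp add: kpair_def) blast

lemma good_iterate_G: "good X \<Longrightarrow> good ((G (Suc i) ^^ n) X)"
  by (induction n) (simp_all add: good_G good_def[of "(G (Suc i) ^^ _) X"])

section \<open>Lexicographically ordered levels\<close>

definition base :: hcset where "base = G 1 omega"

lemma tr_omega: "tr omega"
  by (auto simp: tr_def els_num)

text \<open>\<open>omega\<close> is transitive and contains the numerals, but lacks their ordered
  pairs; one limit step adds the pairs.\<close>

lemma good_base: "good base"
  unfolding base_def One_nat_def by (rule good_G) (auto simp: omega_M tr_omega)

text \<open>An entry followed by \<open>k\<close> entries counts steps of \<open>G (Suc k)\<close>.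
  The index is \<open>Suc k\<close> instead of \<open>k\<close> so that even the last entry moves by
  limit steps and all levels stay good.\<close>

primrec U :: "nat list \<Rightarrow> hcset \<Rightarrow> hcset" where
  "U [] X = X"
| "U (n # ns) X = U ns ((G (Suc (length ns)) ^^ n) X)"

lemma good_U: "good X \<Longrightarrow> good (U ns X)"
  by (induction ns arbitrary: X) (auto intro: good_iterate_G)

text \<open>All entries of \<open>ns\<close> together, followed by a power set, stay within a single
  step at the position in front of them, since that step is the limit of arbitrarily many steps at
  the first position of \<open>ns\<close>.\<close>

lemma U_step: "good X \<Longrightarrow> els (mpow (U ns X)) \<subseteq> els (G (Suc (length ns)) X)"
proof (induction ns arbitrary: X)
  case Nil
  then show ?case using mpow_subset_G[of X 1] by (simp add: good_def)
next
  case (Cons n ns)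
  let ?i = "Suc (length ns)"
  have X: "X \<in> M" using Cons.prems by (simp add: good_def)
  have "els (mpow (U (n # ns) X)) \<subseteq> els ((G ?i ^^ Suc n) X)"
    using Cons.IH[OF good_iterate_G[OF Cons.prems]] by simp
  also have "\<dots> \<subseteq> els (G (Suc ?i) X)" unfolding els_G_Suc[OF X] by blast
  finally show ?case by simp
qed

lemma subset_U: "X \<in> M \<Longrightarrow> els X \<subseteq> els (U ns X)"
proof (induction ns arbitrary: X)
  case (Cons n ns)
  have "els X \<subseteq> els ((G (Suc (length ns)) ^^ n) X)"
    using iterate_G_mono[OF Cons.prems, of 0 n] by simp
  also have "\<dots> \<subseteq> els (U (n # ns) X)" using Cons.IH[OF iterate_G_M[OF Cons.prems]] by simp
  finally show ?case .
qed simp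

lemma U_lex_less: "lex_less ms ns \<Longrightarrow> good X \<Longrightarrow> els (mpow (U ms X)) \<subseteq> els (U ns X)"
proof (induction arbitrary: X rule: lex_less.induct)
  case (head m n ms ns)
  let ?i = "Suc (length ns)"
  have X: "X \<in> M" using head.prems by (simp add: good_def)
  have "els (mpow (U (m # ms) X)) \<subseteq> els ((G ?i ^^ Suc m) X)"
    using U_step[OF good_iterate_G[OF head.prems], of ms] head.hyps by simp
  also have "\<dots> \<subseteq> els ((G ?i ^^ n) X)" using iterate_G_mono[OF X] head.hyps by (metis Suc_leI)
  also have "\<dots> \<subseteq> els (U (n # ns) X)" using subset_U[OF iterate_G_M[OF X]] by simp
  finally show ?case .
next
  case (tail ms ns n)
  then show ?case using good_iterate_G lex_less_length[OF tail.hyps] by simp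
qed

end

section \<open>Sets of bounded hereditary cardinality\<close>

context ctm
begin

text \<open>\<open>f\<close> restricts to a partial map from \<open>K\<close> onto \<open>t\<close>.\<close>

definition cov :: "hcset \<Rightarrow> hcset \<Rightarrow> hcset \<Rightarrow> bool" where
  "cov K t f \<longleftrightarrow> (\<forall>y\<in>els t. \<exists>u\<in>els K. kpair u y \<in> els f) \<and>
    (\<forall>y\<in>els t. \<forall>y'\<in>els t. \<forall>u\<in>els K. kpair u y \<in> els f \<longrightarrow> kpair u y' \<in> els f \<longrightarrow> y = y')"

definition small :: "hcset \<Rightarrow> hcset \<Rightarrow> bool" where
  "small K t \<longleftrightarrow> (\<exists>f\<in>M. cov K t f)"

text \<open>A transitive \<open>t\<close> of \<open>M\<close> that includes \<open>x\<close> takes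
  the place of the transitive closure, which thus need not be constructed.\<close>

definition HC :: "hcset \<Rightarrow> hcset set" where
  "HC K = {x \<in> M. \<exists>t\<in>M. tr t \<and> els x \<subseteq> els t \<and> small K t}"

lemma cov_subset: "cov K t f \<Longrightarrow> els t' \<subseteq> els t \<Longrightarrow> cov K t' f"
  unfolding cov_def by blast

lemma small_subset: "small K t \<Longrightarrow> els t' \<subseteq> els t \<Longrightarrow> small K t'"
  unfolding small_def using cov_subset by blast

lemma M_product:
  assumes "a \<in> M" "b \<in> M"
  obtains c where "c \<in> M" "els c = {kpair x y | x y. x \<in> els a \<and> y \<in> els b}"
proof -
  let ?P = "mpow (mpow (hunion (upair a b)))"
  let ?c = "hset {p \<in> els ?P. \<exists>x\<in>els a. \<exists>y\<in>els b. p = kpair x y}"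
  have "?c \<in> M"
    by (intro M_separation mdef_rules) (intro assms mpow_M hunion_M upair_M)+
  moreover have "kpair x y \<in> els ?P" if "x \<in> els a" "y \<in> els b" for x y
  proof -
    have "x \<in> M" "y \<in> M" using that assms els_M by blast+
    then show ?thesis using that by (simp add: kpair_def upair_M)
  qed
  then have "els ?c = {kpair x y | x y. x \<in> els a \<and> y \<in> els b}" unfolding els_separation by blast
  ultimately show thesis using that by blast
qed

lemma small_subset_self:
  assumes K: "good K" and t: "els t \<subseteq> els K"
  shows "small K t"
proof -
  have KM: "K \<in> M" using K by (simp add: good_def)
  let ?f = "hset {p \<in> els K. \<exists>u\<in>els K. p = kpair u u}"
  have "?f \<in> M" by (intro M_separation mdef_rules KM)
  moreover have "cov K t ?f"
    using K t unfolding cov_def good_def els_separation by (auto simp: subset_iff)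
  ultimately show ?thesis unfolding small_def by blast
qed

text \<open>A union of at most \<open>K\<close> many sets of size at most \<open>K\<close> has size
  at most \<open>K\<close>: an element of \<open>T\<close> is reached from the pair of an index for
  \<open>x\<close> and an index within \<open>f\<close>, and this pair belongs to \<open>K\<close>
  again. The map \<open>f\<close> is determined by \<open>x\<close> through \<open>R\<close>, so all
  choices have to be made beforehand.\<close>

lemma small_family:
  assumes K: "good K" and a: "a \<in> M" "small K a" and T: "T \<in> M"
    and R: "\<And>a b. tm a \<Longrightarrow> tm b \<Longrightarrow> mdef (\<lambda>e. R (a e) (b e))"
    and func: "\<And>x f f'. x \<in> els a \<Longrightarrow> f \<in> M \<Longrightarrow> f' \<in> M \<Longrightarrow> R x f \<Longrightarrow> R x f' \<Longrightarrow> f = f'"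
    and onto: "\<And>y. y \<in> els T \<Longrightarrow> \<exists>x\<in>els a. \<exists>f\<in>M. R x f \<and> (\<exists>u\<in>els K. kpair u y \<in> els f)"
    and single: "\<And>x f u y y'. x \<in> els a \<Longrightarrow> f \<in> M \<Longrightarrow> R x f \<Longrightarrow> u \<in> els K \<Longrightarrow> y \<in> els T \<Longrightarrow> y' \<in> els T \<Longrightarrow>
      kpair u y \<in> els f \<Longrightarrow> kpair u y' \<in> els f \<Longrightarrow> y = y'"
  shows "small K T"
proof -
  have KM: "K \<in> M" and Kp: "\<And>u v. u \<in> els K \<Longrightarrow> v \<in> els K \<Longrightarrow> kpair u v \<in> els K"
    using K by (auto simp: good_def)
  obtain h where h: "h \<in> M" "cov K a h" using a(2) by (auto simp: small_def)
  obtain c where c: "c \<in> M" "els c = {kpair x y | x y. x \<in> els K \<and> y \<in> els T}"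
    using M_product[OF KM T] .
  let ?Q = "\<lambda>u v y. \<exists>x\<in>els a. \<exists>f\<in>M. kpair u x \<in> els h \<and> R x f \<and> kpair v y \<in> els f"
  let ?g = "hset {p \<in> els c. \<exists>u\<in>els K. \<exists>v\<in>els K. \<exists>w\<in>els K. \<exists>y\<in>els T. w = kpair u v \<and> p = kpair w y \<and> ?Q u v y}"
  have "?g \<in> M" by (intro M_separation mdef_rules KM T a(1) h(1) c(1) R)
  moreover have mem: "kpair (kpair u v) y \<in> els ?g \<longleftrightarrow> ?Q u v y" if "u \<in> els K" "v \<in> els K" "y \<in> els T" for u v y
    unfolding els_separation unfolding c(2) using that Kp by auto
  have "cov K T ?g" unfolding cov_def
  proof (intro HOL.conjI ballI impI)
    fix y assume y: "y \<in> els T"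
    then obtain x f v where *: "x \<in> els a" "f \<in> M" "R x f" "v \<in> els K" "kpair v y \<in> els f" using onto by blast
    then obtain u where "u \<in> els K" "kpair u x \<in> els h" using h(2) unfolding cov_def by blast
    then show "\<exists>u\<in>els K. kpair u y \<in> els ?g" using * y mem Kp by blast
  next
    fix y y' w assume y: "y \<in> els T" "y' \<in> els T" "w \<in> els K" "kpair w y \<in> els ?g" "kpair w y' \<in> els ?g"
    then obtain u v where uv: "u \<in> els K" "v \<in> els K" "w = kpair u v" unfolding els_separation by auto
    then obtain x f x' f' where *: "x \<in> els a" "f \<in> M" "kpair u x \<in> els h" "R x f" "kpair v y \<in> els f"
        "x' \<in> els a" "f' \<in> M" "kpair u x' \<in> els h" "R x' f'" "kpair v y' \<in> els f'"
      using mem[OF uv(1,2) y(1)] mem[OF uv(1,2) y(2)] y(4,5) unfolding uv(3) by blast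
    then have "x = x'" using h(2) uv(1) unfolding cov_def by blast
    then have "f = f'" using func * by blast
    then show "y = y'" using single[OF *(1,2,4) uv(2) y(1,2)] * by blast
  qed
  ultimately show ?thesis unfolding small_def by blast
qed

lemma good_hempty_num1: "good K \<Longrightarrow> hempty \<in> els K" "good K \<Longrightarrow> num 1 \<in> els K"
  using rangeI[of num 0] rangeI[of num 1] by (auto simp: good_def subset_iff simp del: One_nat_def)

lemma num1_neq: "num 1 \<noteq> hempty"
  using num_inject[of 1 0] by simp

lemma els_hunion_upair: "els (hunion (upair x y)) = els x \<union> els y"
  by simp

lemma small_union:
  assumes K: "good K" and "s \<in> M" "t \<in> M" "small K s" "small K t"
  shows "small K (hunion (upair s t))"
proof -
  obtain f1 f2 where f: "f1 \<in> M" "cov K s f1" "f2 \<in> M" "cov K t f2" using assms by (auto simp: small_def)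
  \<comment> \<open>\<open>f1\<close> is single-valued only towards elements of \<open>s\<close> and
    may have values in \<open>t\<close> as well, so it is restricted to values in \<open>s\<close>;
    likewise \<open>f2\<close> to \<open>t\<close>.\<close>
  obtain f1' where f1: "f1' \<in> M" "els f1' = {p \<in> els f1. \<exists>u\<in>els K. \<exists>y\<in>els s. p = kpair u y}"
  proof -
    have KM: "K \<in> M" using K by (simp add: good_def)
    have "hset {p \<in> els f1. \<exists>u\<in>els K. \<exists>y\<in>els s. p = kpair u y} \<in> M"
      by (intro M_separation mdef_rules f KM assms)
    then show ?thesis by (rule that[OF _ els_separation])
  qed
  obtain f2' where f2: "f2' \<in> M" "els f2' = {p \<in> els f2. \<exists>u\<in>els K. \<exists>y\<in>els t. p = kpair u y}"
  proof -
    have KM: "K \<in> M" using K by (simp add: good_def)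
    have "hset {p \<in> els f2. \<exists>u\<in>els K. \<exists>y\<in>els t. p = kpair u y} \<in> M"
      by (intro M_separation mdef_rules f KM assms)
    then show ?thesis by (rule that[OF _ els_separation])
  qed
  let ?R = "\<lambda>x f. (x = hempty \<and> f = f1') \<or> (x = num 1 \<and> f = f2')"
  have M: "num 1 \<in> M" "hempty \<in> M" "upair hempty (num 1) \<in> M" using num_M hempty_M upair_M by blast+
  show ?thesis
  proof (rule small_family[OF K, where a = "upair hempty (num 1)" and R = ?R])
    show "small K (upair hempty (num 1))"
      by (rule small_subset_self[OF K]) (use good_hempty_num1[OF K] in auto)
    show "mdef (\<lambda>e. ?R (a e) (b e))" if "tm a" "tm b" for a b
      by (intro mdef_disj mdef_conj mdef_eq tm_const that M f1 f2)
    show "\<exists>x\<in>els (upair hempty (num 1)). \<exists>f\<in>M. ?R x f \<and> (\<exists>u\<in>els K. kpair u y \<in> els f)"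
      if "y \<in> els (hunion (upair s t))" for y
      using that f f1 f2 unfolding cov_def els_hunion_upair by (auto simp del: num.simps One_nat_def)
    fix x f u y y'
    assume *: "x \<in> els (upair hempty (num 1))" "?R x f" "u \<in> els K" "kpair u y \<in> els f" "kpair u y' \<in> els f"
    then consider "f = f1'" | "f = f2'" by blast
    then show "y = y'"
    proof cases
      case 1
      then have "y \<in> els s" "y' \<in> els s" "kpair u y \<in> els f1" "kpair u y' \<in> els f1"
        using *(4,5) unfolding 1 f1(2) by auto
      then show ?thesis using f(2) *(3) unfolding cov_def by blast
    next
      case 2
      then have "y \<in> els t" "y' \<in> els t" "kpair u y \<in> els f2" "kpair u y' \<in> els f2"
        using *(4,5) unfolding 2 f2(2) by auto
      then show ?thesis using f(4) *(3) unfolding cov_def by blast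
    qed
  qed (use num1_neq M upair_M hunion_M assms in auto)
qed

lemma small_upair:
  assumes K: "good K" and "x \<in> M" "y \<in> M"
  shows "small K (upair x y)"
proof (cases "x = y")
  case True
  have "cov K (upair x y) (upair (kpair hempty x) (kpair hempty x))"
    using good_hempty_num1[OF K] True by (auto simp: cov_def)
  moreover have "upair (kpair hempty x) (kpair hempty x) \<in> M" by (intro upair_M kpair_M hempty_M assms)
  ultimately show ?thesis unfolding small_def by blast
next
  case False
  have "cov K (upair x y) (upair (kpair hempty x) (kpair (num 1) y))"
    using good_hempty_num1[OF K] num1_neq by (auto simp: cov_def simp del: num.simps One_nat_def)
  moreover have "upair (kpair hempty x) (kpair (num 1) y) \<in> M" by (intro upair_M kpair_M hempty_M num_M assms)
  ultimately show ?thesis unfolding small_def by blast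
qed

section \<open>Closure properties of \<open>HC\<close>\<close>

lemma HC_subset_M: "HC K \<subseteq> M"
  by (auto simp: HC_def)

lemma HC_subset: "x \<in> HC K \<Longrightarrow> y \<in> M \<Longrightarrow> els y \<subseteq> els x \<Longrightarrow> y \<in> HC K"
  unfolding HC_def by blast

lemma HC_trans: "x \<in> HC K \<Longrightarrow> els x \<subseteq> HC K"
  using els_M unfolding HC_def tr_def by blast

lemma HC_subset_self: "good K \<Longrightarrow> x \<in> M \<Longrightarrow> els x \<subseteq> els K \<Longrightarrow> x \<in> HC K"
  unfolding HC_def using small_subset_self[of K K] by (auto simp: good_def)

lemma HC_self: "good K \<Longrightarrow> K \<in> HC K"
  by (rule HC_subset_self) (auto simp: good_def)

lemma HC_omega: "good K \<Longrightarrow> omega \<in> HC K"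
  by (rule HC_subset_self) (auto simp: good_def omega_M)

lemma HC_hempty: "good K \<Longrightarrow> hempty \<in> HC K"
  by (rule HC_subset_self) (auto simp: hempty_M)

lemma HC_hunion: "x \<in> HC K \<Longrightarrow> hunion x \<in> HC K"
  unfolding HC_def tr_def using hunion_M by auto

lemma HC_witness:
  assumes "good K" "x \<in> HC K" "y \<in> HC K"
  obtains t where "t \<in> M" "tr t" "x \<in> els t" "y \<in> els t" "small K t"
proof -
  obtain t1 t2 where t: "t1 \<in> M" "tr t1" "els x \<subseteq> els t1" "small K t1" "t2 \<in> M" "tr t2" "els y \<subseteq> els t2" "small K t2"
    using assms by (auto simp: HC_def)
  have xy: "x \<in> M" "y \<in> M" using assms HC_subset_M by blast+
  let ?t = "hunion (upair (hunion (upair t1 t2)) (upair x y))"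
  have "?t \<in> M" using t xy by (intro hunion_M upair_M)
  moreover have "small K ?t"
    using t xy by (intro small_union small_upair assms(1) hunion_M upair_M)
  moreover have "els ?t = els t1 \<union> els t2 \<union> {x, y}" by auto
  moreover have "tr ?t" using t(2,3,6,7) unfolding tr_def \<open>els ?t = _\<close> by blast
  ultimately show thesis by (intro that[of ?t]) auto
qed

lemma HC_upair:
  assumes "good K" "x \<in> HC K" "y \<in> HC K"
  shows "upair x y \<in> HC K"
proof -
  obtain t where "t \<in> M" "tr t" "x \<in> els t" "y \<in> els t" "small K t" using HC_witness[OF assms] .
  then show ?thesis unfolding HC_def using upair_M els_M[of t] by auto
qed

text \<open>\<open>f\<close> maps \<open>K\<close> onto a transitive set, and \<open>c\<close> is the membership relation pulled back along \<open>f\<close>. By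
  Mostowski's argument \<open>c\<close> determines \<open>f\<close>, so that witnesses can be chosen as subsets of \<open>K\<close>.\<close>

definition enum :: "hcset \<Rightarrow> hcset \<Rightarrow> bool" where
  "enum K f \<longleftrightarrow> (\<forall>p\<in>els f. \<exists>u\<in>els K. \<exists>y\<in>M. p = kpair u y) \<and>
    (\<forall>u\<in>els K. \<exists>y\<in>M. kpair u y \<in> els f) \<and>
    (\<forall>u\<in>els K. \<forall>y\<in>M. \<forall>y'\<in>M. kpair u y \<in> els f \<longrightarrow> kpair u y' \<in> els f \<longrightarrow> y = y') \<and>
    (\<forall>u\<in>els K. \<forall>y\<in>M. kpair u y \<in> els f \<longrightarrow> (\<forall>z\<in>els y. \<exists>v\<in>els K. kpair v z \<in> els f))"

definition coded :: "hcset \<Rightarrow> hcset \<Rightarrow> hcset \<Rightarrow> bool" where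
  "coded K f c \<longleftrightarrow> (\<forall>u\<in>els K. \<forall>v\<in>els K. kpair v u \<in> els c \<longleftrightarrow>
    (\<exists>y\<in>M. \<exists>z\<in>M. kpair u y \<in> els f \<and> kpair v z \<in> els f \<and> z \<in> els y))"

lemma mdef_enum: "K \<in> M \<Longrightarrow> tm a \<Longrightarrow> mdef (\<lambda>e. enum K (a e))"
proof -
  assume K: "K \<in> M" and a: "tm a"
  note as = a a[THEN tm_shift] a[THEN tm_shift, THEN tm_shift] a[THEN tm_shift, THEN tm_shift, THEN tm_shift]
    a[THEN tm_shift, THEN tm_shift, THEN tm_shift, THEN tm_shift]
  show ?thesis unfolding enum_def by (intro mdef_rules K as)
qed

lemma mdef_coded: "K \<in> M \<Longrightarrow> tm a \<Longrightarrow> tm b \<Longrightarrow> mdef (\<lambda>e. coded K (a e) (b e))"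
proof -
  assume K: "K \<in> M" and t: "tm a" "tm b"
  note ts = t t[THEN tm_shift] t[THEN tm_shift, THEN tm_shift] t[THEN tm_shift, THEN tm_shift, THEN tm_shift]
    t[THEN tm_shift, THEN tm_shift, THEN tm_shift, THEN tm_shift]
  show ?thesis unfolding coded_def by (intro mdef_rules K ts)
qed

text \<open>By induction on \<open>y\<close>: the elements of the value of \<open>f\<close> at
  \<open>u\<close> are its values at those \<open>v\<close> with \<open>kpair v u\<close> in
  \<open>c\<close>, and the same is true of \<open>f'\<close> with the same \<open>c\<close>. The
  induction hypothesis makes the two maps agree at these \<open>v\<close>.\<close>

lemma coded_subset:
  assumes f: "enum K f" "enum K f'" "coded K f c" "coded K f' c" and M: "f \<in> M" "f' \<in> M"
  shows "u \<in> els K \<Longrightarrow> kpair u y \<in> els f \<Longrightarrow> kpair u y \<in> els f'"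
proof (induction y arbitrary: u rule: hcset_induct)
  case (step y)
  have yM: "y \<in> M" using step.prems(2) M els_M kpair_components by blast
  obtain y' where y': "y' \<in> M" "kpair u y' \<in> els f'" using f(2) step.prems(1) unfolding enum_def by blast
  have "y = y'"
  proof (rule hcset_ext, rule set_eqI, rule iffI)
    fix z assume z: "z \<in> els y"
    then have zM: "z \<in> M" using yM els_M by blast
    obtain v where v: "v \<in> els K" "kpair v z \<in> els f" using f(1) step.prems yM z unfolding enum_def by blast
    then have "kpair v u \<in> els c" using f(3) step.prems yM zM z unfolding coded_def by blast
    then obtain w w' where w: "w \<in> M" "w' \<in> M" "kpair u w' \<in> els f'" "kpair v w \<in> els f'" "w \<in> els w'"
      using f(4) step.prems(1) v(1) unfolding coded_def by blast
    have "w' = y'" using f(2) step.prems(1) w y' unfolding enum_def by blast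
    moreover have "w = z" using f(2) v(1) w zM step.IH[OF z v] unfolding enum_def by blast
    ultimately show "z \<in> els y'" using w by simp
  next
    fix z assume z: "z \<in> els y'"
    then have zM: "z \<in> M" using y' els_M by blast
    obtain v where v: "v \<in> els K" "kpair v z \<in> els f'" using f(2) step.prems y' z unfolding enum_def by blast
    then have "kpair v u \<in> els c" using f(4) step.prems y' zM z unfolding coded_def by blast
    then obtain w w' where w: "w \<in> M" "w' \<in> M" "kpair u w' \<in> els f" "kpair v w \<in> els f" "w \<in> els w'"
      using f(3) step.prems(1) v(1) unfolding coded_def by blast
    have "w' = y" using f(1) step.prems w yM unfolding enum_def by blast
    then have "w \<in> els y" using w by simp
    then have "kpair v w \<in> els f'" using step.IH[of w v] w v by blast
    then have "w = z" using f(2) v w zM unfolding enum_def by blast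
    then show "z \<in> els y" using \<open>w \<in> els y\<close> by simp
  qed
  then show ?case using y' by simp
qed

lemma coded_unique:
  assumes "enum K f" "enum K f'" "coded K f c" "coded K f' c" "f \<in> M" "f' \<in> M"
  shows "f = f'"
proof -
  have "els f \<subseteq> els f'" if f: "enum K f" "enum K f'" "coded K f c" "coded K f' c" "f \<in> M" "f' \<in> M" for f f'
  proof
    fix p assume p: "p \<in> els f"
    then obtain u y where "u \<in> els K" "p = kpair u y" using f(1) unfolding enum_def by blast
    then show "p \<in> els f'" using coded_subset[OF f] p by blast
  qed
  then show ?thesis using assms by (intro hcset_ext subset_antisym) blast+
qed

lemma enum_exists:
  assumes K: "good K" and y: "y \<in> HC K"
  obtains f c where "f \<in> M" "enum K f" "c \<in> els (mpow K)" "coded K f c" "\<exists>u\<in>els K. kpair u y \<in> els f"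
proof -
  have KM: "K \<in> M" using K by (simp add: good_def)
  obtain t where t: "t \<in> M" "tr t" "y \<in> els t" "small K t" using HC_witness[OF K y y] .
  have yM: "y \<in> M" using t els_M by blast
  obtain f0 where f0: "f0 \<in> M" "cov K t f0" using t(4) by (auto simp: small_def)
  obtain p where p: "p \<in> M" "els p = {kpair x y | x y. x \<in> els K \<and> y \<in> els t}" using M_product[OF KM t(1)] .
  text \<open>The partial map \<open>f0\<close> is made total with the default value \<open>y\<close>.\<close>
  let ?Q = "\<lambda>u z. kpair u z \<in> els f0 \<or> (\<not> (\<exists>z'\<in>els t. kpair u z' \<in> els f0) \<and> z = y)"
  define f where "f = hset {q \<in> els p. \<exists>u\<in>els K. \<exists>z\<in>els t. q = kpair u z \<and> ?Q u z}"
  have fM: "f \<in> M" unfolding f_def by (intro M_separation mdef_rules KM t(1) f0(1) p(1) yM)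
  have f: "kpair u z \<in> els f \<longleftrightarrow> u \<in> els K \<and> z \<in> els t \<and> ?Q u z" for u z
    unfolding f_def els_separation unfolding p(2) by auto
  have en: "enum K f" unfolding enum_def
  proof (intro HOL.conjI ballI impI)
    show "\<exists>u\<in>els K. \<exists>y\<in>M. q = kpair u y" if "q \<in> els f" for q
      using that els_M[OF t(1)] unfolding f_def els_separation by blast
    show "\<exists>y\<in>M. kpair u y \<in> els f" if "u \<in> els K" for u
      unfolding f using that t(3) yM els_M[OF t(1)] by blast
    show "z = z'" if "u \<in> els K" "kpair u z \<in> els f" "kpair u z' \<in> els f" for u z z'
      using that f0(2) unfolding f cov_def by blast
    fix u z x assume "kpair u z \<in> els f" "x \<in> els z"
    then have "x \<in> els t" using t(2) unfolding f tr_def by blast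
    then show "\<exists>v\<in>els K. kpair v x \<in> els f" using f0(2) unfolding f cov_def by blast
  qed
  let ?c = "hset {q \<in> els K. \<exists>u\<in>els K. \<exists>v\<in>els K. q = kpair v u \<and>
    (\<exists>y\<in>M. \<exists>z\<in>M. kpair u y \<in> els f \<and> kpair v z \<in> els f \<and> z \<in> els y)}"
  have "?c \<in> M" by (intro M_separation mdef_rules KM fM)
  then have "?c \<in> els (mpow K)" by auto
  moreover have "coded K f ?c"
    using K unfolding coded_def good_def els_separation by auto
  moreover have "\<exists>u\<in>els K. kpair u y \<in> els f" using t(3) f0(2) unfolding f cov_def by blast
  ultimately show thesis using that fM en by blast
qed

text \<open>For each \<open>x\<close> a witness must be chosen, but \<open>HC K\<close> is available
  only as a class of \<open>M\<close>. Instead one chooses a code, a subset of \<open>K\<close>,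
  among the codes of enumerations whose transitive range contains a witness. The code determines its
  enumeration, so the ranges of the chosen ones can be collected; their union \<open>B\<close> is
  transitive and, by \<open>small_family\<close>, of size at most \<open>K\<close>.\<close>

lemma HC_collection:
  assumes K: "good K" and a: "a \<in> HC K"
    and R: "\<And>a b. tm a \<Longrightarrow> tm b \<Longrightarrow> mdef (\<lambda>e. R (a e) (b e))"
    and ex: "\<And>x. x \<in> els a \<Longrightarrow> \<exists>y\<in>HC K. R x y"
  shows "\<exists>b\<in>HC K. \<forall>x\<in>els a. \<exists>y\<in>els b. R x y"
proof -
  have KM: "K \<in> M" and aM: "a \<in> M" using K a by (auto simp: good_def HC_def)
  have PM: "mpow K \<in> M" by (rule mpow_M[OF KM])
  have sa: "small K a" using a small_subset unfolding HC_def by blast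
  have aM': "x \<in> M" if "x \<in> els a" for x using that aM els_M by blast
  define W where "W x f c \<longleftrightarrow> enum K f \<and> coded K f c \<and> (\<exists>u\<in>els K. \<exists>y\<in>M. kpair u y \<in> els f \<and> R x y)" for x f c
  have mdef_W: "mdef (\<lambda>e. W (x e) (f e) (c e))" if t: "tm x" "tm f" "tm c" for x f c
  proof -
    note ts = t t[THEN tm_shift] t[THEN tm_shift, THEN tm_shift]
    show ?thesis unfolding W_def by (intro mdef_rules mdef_enum mdef_coded R KM ts)
  qed
  define S where "S x = hset {c \<in> els (mpow K). \<exists>f\<in>M. W x f c}" for x
  have S_ne: "els (S x) \<noteq> {}" if x: "x \<in> els a" for x
  proof -
    obtain y where y: "y \<in> HC K" "R x y" using ex x by blast
    obtain f c where "f \<in> M" "enum K f" "c \<in> els (mpow K)" "coded K f c" "\<exists>u\<in>els K. kpair u y \<in> els f"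
      using enum_exists[OF K y(1)] .
    then have "c \<in> els (S x)" using y HC_subset_M unfolding S_def els_separation W_def by blast
    then show ?thesis by blast
  qed
  obtain P where P: "P \<in> M" "els P = {kpair x c | x c. x \<in> els a \<and> c \<in> els (mpow K)}"
    using M_product[OF aM PM] .
  \<comment> \<open>The axiom of choice speaks of disjoint families, so the codes are tagged with
    \<open>x\<close>.\<close>
  define T where "T x = hset {p \<in> els P. \<exists>c\<in>els (mpow K). p = kpair x c \<and> (\<exists>f\<in>M. W x f c)}" for x
  have els_T: "els (T x) = kpair x ` els (S x)" if "x \<in> els a" for x
    using that unfolding T_def S_def els_separation unfolding P(2) by blast
  have TM: "T x \<in> M" if "x \<in> els a" for x
    unfolding T_def by (intro M_separation mdef_rules mdef_W PM P(1) aM'[OF that])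
  \<comment> \<open>The equation \<open>y = T x\<close>, spelled out by membership so that
    replacement applies.\<close>
  define \<Phi> where "\<Phi> x y \<longleftrightarrow>
    (\<forall>p\<in>M. p \<in> els y \<longleftrightarrow> p \<in> els P \<and> (\<exists>c\<in>els (mpow K). p = kpair x c \<and> (\<exists>f\<in>M. W x f c)))" for x y
  have eqT: "\<Phi> x y \<longleftrightarrow> y = T x" if y: "y \<in> M" and x: "x \<in> els a" for x y
    unfolding eq_iff_M[OF y M_trans[OF TM[OF x]]] unfolding T_def \<Phi>_def els_separation mem_Collect_eq ..
  have "mdef (\<lambda>e. \<Phi> (e 0) (e (Suc 0)))"
    unfolding \<Phi>_def by (intro mdef_rules mdef_W PM P(1))
  then obtain F where F: "F \<in> M" "els F = {y \<in> M. \<exists>x\<in>els a. \<Phi> x y}"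
  proof (rule M_replacement[OF _ aM])
    fix x assume x: "x \<in> els a"
    show "\<exists>y\<in>M. \<Phi> x y \<and> (\<forall>y'\<in>M. \<Phi> x y' \<longrightarrow> y' = y)"
      by (rule bexI[of _ "T x"]) (simp_all add: eqT[OF _ x] TM[OF x])
  qed
  have els_F: "els F = T ` els a"
    unfolding F(2) by (auto simp: eqT TM)
  have "\<exists>b\<in>M. \<forall>t\<in>els F. \<exists>!z. z \<in> els b \<and> z \<in> els t"
  proof (rule M_choice[OF F(1)])
    show "els t \<noteq> {}" if "t \<in> els F" for t using that els_T S_ne unfolding els_F by auto
    show "els s \<inter> els t = {}" if "s \<in> els F" "t \<in> els F" "s \<noteq> t" for s t
      using that els_T unfolding els_F by auto
  qed
  then obtain b where b: "b \<in> M" "\<forall>t\<in>els F. \<exists>!z. z \<in> els b \<and> z \<in> els t" ..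
  have b': "\<exists>!c. c \<in> els (S x) \<and> kpair x c \<in> els b" if x: "x \<in> els a" for x
  proof -
    have "T x \<in> els F" using x by (simp add: els_F)
    from bspec[OF b(2) this] obtain z where z: "z \<in> els b" "z \<in> kpair x ` els (S x)"
      "\<And>z'. z' \<in> els b \<Longrightarrow> z' \<in> kpair x ` els (S x) \<Longrightarrow> z' = z"
      unfolding els_T[OF x] by (elim ex1E) blast
    from z(2) obtain c where c: "c \<in> els (S x)" "z = kpair x c" by blast
    show ?thesis
    proof (rule ex1I[of _ c])
      show "c' = c" if "c' \<in> els (S x) \<and> kpair x c' \<in> els b" for c'
        using z(3)[of "kpair x c'"] that c(2) by simp
    qed (use z(1) c in simp)
  qed
  define R' where "R' x f \<longleftrightarrow> (\<exists>c\<in>els (mpow K). kpair x c \<in> els b \<and> W x f c)" for x f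
  have mdef_R': "mdef (\<lambda>e. R' (x e) (f e))" if t: "tm x" "tm f" for x f
  proof -
    note ts = t t[THEN tm_shift]
    show ?thesis unfolding R'_def by (intro mdef_rules mdef_W PM b(1) ts)
  qed
  have R'_unique: "f = f'" if x: "x \<in> els a" and f: "f \<in> M" "f' \<in> M" and R: "R' x f" "R' x f'" for x f f'
  proof -
    obtain c c' where c: "c \<in> els (mpow K)" "kpair x c \<in> els b" "W x f c" "c' \<in> els (mpow K)" "kpair x c' \<in> els b" "W x f' c'"
      using R unfolding R'_def by blast
    then have "c \<in> els (S x)" "c' \<in> els (S x)" using f unfolding S_def els_separation by blast+
    then have "c = c'" using b'[OF x] c by blast
    then show ?thesis using c f coded_unique unfolding W_def by blast
  qed
  have R'_ex: "\<exists>f\<in>M. R' x f" if "x \<in> els a" for x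
    using b'[OF that] unfolding R'_def S_def els_separation by blast
  have "mdef (\<lambda>e. R' (e 0) (e (Suc 0)))" by (intro mdef_R' tm_proj)
  then obtain FF where FF: "FF \<in> M" "els FF = {f \<in> M. \<exists>x\<in>els a. R' x f}"
  proof (rule M_replacement[OF _ aM])
    fix x assume x: "x \<in> els a"
    then obtain f where "f \<in> M" "R' x f" using R'_ex by blast
    then show "\<exists>f\<in>M. R' x f \<and> (\<forall>f'\<in>M. R' x f' \<longrightarrow> f' = f)"
      using R'_unique[OF x] by (intro bexI[of _ f]) simp_all
  qed
  \<comment> \<open>Values of the maps lie three unions down: from maps to ordered pairs, to
    unordered pairs, to components.\<close>
  let ?UU = "hunion (hunion (hunion FF))"
  define B where "B = hset {y \<in> els ?UU. \<exists>f\<in>els FF. \<exists>u\<in>els K. kpair u y \<in> els f}"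
  have BM: "B \<in> M" unfolding B_def by (intro M_separation mdef_rules hunion_M FF(1) KM)
  have B: "y \<in> els B \<longleftrightarrow> (\<exists>x\<in>els a. \<exists>f\<in>M. R' x f \<and> (\<exists>u\<in>els K. kpair u y \<in> els f))" for y
  proof -
    have "y \<in> els ?UU" if "f \<in> els FF" "kpair u y \<in> els f" for f u
    proof -
      have "kpair u y \<in> els (hunion FF)" using that by auto
      moreover have "upair u y \<in> els (kpair u y)" "y \<in> els (upair u y)" by (auto simp: kpair_def)
      ultimately show ?thesis unfolding els_simps(2)[of "hunion (hunion FF)"] els_simps(2)[of "hunion FF"] by blast
    qed
    then show ?thesis unfolding B_def els_separation FF(2) by blast
  qed
  have "tr B" unfolding tr_def
  proof (intro ballI subsetI)
    fix y z assume "y \<in> els B" "z \<in> els y"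
    moreover from this have "y \<in> M" using BM els_M by blast
    ultimately show "z \<in> els B" unfolding B R'_def W_def enum_def by blast
  qed
  moreover have "small K B"
  proof (rule small_family[OF K aM sa BM mdef_R' R'_unique])
    show "\<exists>x\<in>els a. \<exists>f\<in>M. R' x f \<and> (\<exists>u\<in>els K. kpair u y \<in> els f)" if "y \<in> els B" for y
      using that unfolding B .
    show "y = y'" if "R' x f" "u \<in> els K" "y \<in> els B" "y' \<in> els B" "kpair u y \<in> els f" "kpair u y' \<in> els f" for x f u y y'
    proof -
      have "y \<in> M" "y' \<in> M" using that BM els_M by blast+
      then show ?thesis using that unfolding R'_def W_def enum_def by blast
    qed
  qed
  ultimately have "B \<in> HC K" unfolding HC_def using BM by blast
  moreover have "\<exists>y\<in>els B. R x y" if "x \<in> els a" for x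
    using R'_ex[OF that] that B unfolding R'_def W_def by blast
  ultimately show ?thesis by blast
qed

text \<open>A choice set of \<open>M\<close> may be too large for \<open>HC K\<close>, but its part
  inside the union of \<open>a\<close> is a subset of a member of \<open>HC K\<close>.\<close>

lemma HC_choice:
  assumes "a \<in> HC K" "\<And>x. x \<in> els a \<Longrightarrow> els x \<noteq> {}"
    "\<And>x y. x \<in> els a \<Longrightarrow> y \<in> els a \<Longrightarrow> x \<noteq> y \<Longrightarrow> els x \<inter> els y = {}"
  shows "\<exists>b\<in>HC K. \<forall>x\<in>els a. \<exists>!z. z \<in> els b \<and> z \<in> els x"
proof -
  have aM: "a \<in> M" using assms(1) HC_subset_M by blast
  obtain b where b: "b \<in> M" "\<forall>x\<in>els a. \<exists>!z. z \<in> els b \<and> z \<in> els x"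
    using M_choice[OF aM assms(2,3)] by blast
  let ?b = "hset {z \<in> els (hunion a). z \<in> els b}"
  have "?b \<in> M" by (intro M_separation mdef_rules hunion_M aM b(1))
  then have "?b \<in> HC K" by (rule HC_subset[OF HC_hunion[OF assms(1)]]) (simp add: els_separation del: els_simps)
  moreover have "\<exists>!z. z \<in> els ?b \<and> z \<in> els x" if "x \<in> els a" for x
  proof -
    have "z \<in> els ?b \<and> z \<in> els x \<longleftrightarrow> z \<in> els b \<and> z \<in> els x" for z
      unfolding els_separation using that by auto
    then show ?thesis using b(2) that by simp
  qed
  ultimately show ?thesis by blast
qed

lemma mpow_not_small:
  assumes "K \<in> M"
  shows "\<not> small K (mpow K)"
proof
  assume "small K (mpow K)"
  then obtain f where f: "f \<in> M" "cov K (mpow K) f" by (auto simp: small_def)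
  \<comment> \<open>Cantor's diagonal set. As \<open>f\<close> is only a relation, the condition
    quantifies over all values of \<open>f\<close> at \<open>u\<close>.\<close>
  define D where "D = hset {u \<in> els K. \<forall>y\<in>els (mpow K). kpair u y \<in> els f \<longrightarrow> u \<notin> els y}"
  have els_D: "els D = {u \<in> els K. \<forall>y\<in>els (mpow K). kpair u y \<in> els f \<longrightarrow> u \<notin> els y}"
    unfolding D_def by (rule els_separation)
  have "D \<in> M" unfolding D_def by (intro M_separation mdef_rules assms mpow_M f(1))
  then have D: "D \<in> els (mpow K)" by (auto simp: els_D)
  then obtain u where u: "u \<in> els K" "kpair u D \<in> els f" using f(2) unfolding cov_def by blast
  have eq: "y = D" if "y \<in> els (mpow K)" "kpair u y \<in> els f" for y
    using f(2) D u that unfolding cov_def by blast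
  have "u \<notin> els D"
  proof
    assume a: "u \<in> els D"
    then have "\<forall>y\<in>els (mpow K). kpair u y \<in> els f \<longrightarrow> u \<notin> els y" by (subst (asm) els_D) blast
    then show False using D u(2) a by blast
  qed
  moreover from this have "u \<in> els D" by (subst els_D) (use u(1) eq in blast)
  ultimately show False by blast
qed

text \<open>A cover of \<open>x\<close> exists in \<open>M\<close> but may contain unrelated
  elements of any size. Collecting a pair for each element of \<open>x\<close>, and keeping what
  belongs to the given cover, yields a cover inside the domain, where \<open>fm_cov\<close> can see
  it.\<close>

lemma HC_cov:
  assumes K: "good K" and x: "x \<in> HC K"
  obtains f where "f \<in> HC K" "cov K x f"
proof -
  obtain t where t: "els x \<subseteq> els t" "small K t" using x by (auto simp: HC_def)
  then obtain f0 where f0: "f0 \<in> M" "cov K x f0" using cov_subset unfolding small_def by blast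
  have KH: "els K \<subseteq> HC K" by (rule HC_trans[OF HC_self[OF K]])
  have KM: "K \<in> M" using K by (simp add: good_def)
  let ?R = "\<lambda>y p. \<exists>u\<in>els K. p = kpair u y \<and> kpair u y \<in> els f0"
  have "\<exists>b\<in>HC K. \<forall>y\<in>els x. \<exists>p\<in>els b. ?R y p"
  proof (rule HC_collection[OF K x])
    show "mdef (\<lambda>e. ?R (a e) (b e))" if t: "tm a" "tm b" for a b
    proof -
      note ts = t t[THEN tm_shift]
      show ?thesis by (intro mdef_rules ts KM f0(1))
    qed
    fix y assume y: "y \<in> els x"
    then obtain u where u: "u \<in> els K" "kpair u y \<in> els f0" using f0(2) unfolding cov_def by blast
    moreover have "kpair u y \<in> HC K"
      unfolding kpair_def using u(1) KH y HC_trans[OF x] by (intro HC_upair K) auto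
    ultimately show "\<exists>p\<in>HC K. ?R y p" by blast
  qed
  then obtain b where b: "b \<in> HC K" "\<forall>y\<in>els x. \<exists>p\<in>els b. ?R y p" by blast
  let ?f = "hset {p \<in> els b. p \<in> els f0}"
  have "b \<in> M" using b HC_subset_M by blast
  then have "?f \<in> M" by (intro M_separation mdef_rules f0(1))
  then have "?f \<in> HC K" by (rule HC_subset[OF b(1)]) (auto simp: els_separation)
  moreover have mem: "p \<in> els ?f \<longleftrightarrow> p \<in> els b \<and> p \<in> els f0" for p unfolding els_separation by blast
  have "cov K x ?f" unfolding cov_def mem
  proof (intro HOL.conjI)
    show "\<forall>y\<in>els x. \<exists>u\<in>els K. kpair u y \<in> els b \<and> kpair u y \<in> els f0" using b(2) by blast
  qed (use f0(2) in \<open>unfold cov_def, blast\<close>)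
  ultimately show thesis using that by blast
qed

lemma HC_mono:
  assumes "good K" "good L" "els K \<subseteq> els L"
  shows "HC K \<subseteq> HC L"
proof -
  have "small L t" if t: "t \<in> M" "small K t" for t
  proof -
    obtain f where f: "f \<in> M" "cov K t f" using t by (auto simp: small_def)
    have KM: "K \<in> M" using assms by (simp add: good_def)
    \<comment> \<open>Without this restriction, pairs of \<open>f\<close> whose index is in
      \<open>L\<close> but not in \<open>K\<close> could violate single-valuedness.\<close>
    let ?f = "hset {p \<in> els f. \<exists>u\<in>els K. \<exists>y\<in>els t. p = kpair u y}"
    have "?f \<in> M" by (intro M_separation mdef_rules f(1) KM t(1))
    moreover have mem: "kpair u y \<in> els ?f \<longleftrightarrow> kpair u y \<in> els f \<and> u \<in> els K \<and> y \<in> els t" for u y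
      unfolding els_separation by auto
    have "cov L t ?f" unfolding cov_def mem
    proof (intro HOL.conjI)
      show "\<forall>y\<in>els t. \<exists>u\<in>els L. kpair u y \<in> els f \<and> u \<in> els K \<and> y \<in> els t"
        using f(2) assms(3) unfolding cov_def by blast
    qed (use f(2) in \<open>unfold cov_def, blast\<close>)
    ultimately show ?thesis unfolding small_def by blast
  qed
  then show ?thesis unfolding HC_def by blast
qed

text \<open>\<open>M\<close> is transitive and evaluates the bounded formula correctly, so its
  separation yields the set; \<open>HC K\<close> is closed under subsets from
  \<open>M\<close>.\<close>

lemma HC_delta0_separation:
  assumes "range e \<subseteq> HC K" "a \<in> HC K" "wff set_ar \<phi>" "delta0 \<phi>"
  shows "hset {x \<in> els a. holds (case_nat x e) \<phi>} \<in> HC K"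
proof -
  have eM: "range e \<subseteq> M" and aM: "a \<in> M" using assms HC_subset_M by blast+
  have "mdef (\<lambda>e'. F (case_nat (e' 0) e) \<phi>)"
  proof (rule mdefI[OF assms(3)])
    show "tm (\<lambda>e'. case_nat (e' 0) e i)" for i
      using eM by (intro tm_case_nat tm_proj tm_const) auto
  qed simp
  from M_separation[OF this aM] have "hset {x \<in> els a. F (case_nat x e) \<phi>} \<in> M" .
  moreover have "F (case_nat x e) \<phi> \<longleftrightarrow> holds (case_nat x e) \<phi>" if "x \<in> els a" for x
    using cl.delta0_absolute[OF assms(4)] eM els_M[OF aM that] by simp
  then have "{x \<in> els a. F (case_nat x e) \<phi>} = {x \<in> els a. holds (case_nat x e) \<phi>}" by blast
  ultimately have "hset {x \<in> els a. holds (case_nat x e) \<phi>} \<in> M" by simp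
  then show ?thesis by (rule HC_subset[OF assms(2)]) (auto simp: els_separation)
qed

lemma HC_delta0_collection:
  assumes K: "good K" and "range e \<subseteq> HC K" "a \<in> HC K" "wff set_ar \<phi>" "delta0 \<phi>"
    and ex: "\<And>x. x \<in> els a \<Longrightarrow> \<exists>y\<in>HC K. holds (case_nat x (case_nat y e)) \<phi>"
  shows "\<exists>b\<in>HC K. \<forall>x\<in>els a. \<exists>y\<in>els b. holds (case_nat x (case_nat y e)) \<phi>"
proof -
  have eM: "range e \<subseteq> M" and aM: "a \<in> M" using assms HC_subset_M by blast+
  have abs: "F (case_nat x (case_nat y e)) \<phi> \<longleftrightarrow> holds (case_nat x (case_nat y e)) \<phi>" if "x \<in> M" "y \<in> M" for x y
    using cl.delta0_absolute[OF assms(5)] eM that by simp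
  have "\<exists>b\<in>HC K. \<forall>x\<in>els a. \<exists>y\<in>els b. F (case_nat x (case_nat y e)) \<phi>"
  proof (rule HC_collection[OF K assms(3)])
    show "mdef (\<lambda>e'. F (case_nat (a e') (case_nat (b e') e)) \<phi>)" if "tm a" "tm b" for a b
    proof (rule mdefI[OF assms(4)])
      show "tm (\<lambda>e'. case_nat (a e') (case_nat (b e') e) i)" for i
        using eM that by (intro tm_case_nat tm_const) auto
    qed simp
    show "\<exists>y\<in>HC K. F (case_nat x (case_nat y e)) \<phi>" if "x \<in> els a" for x
      using ex[OF that] abs els_M[OF aM that] HC_subset_M by blast
  qed
  then show ?thesis using abs els_M[OF aM] els_M HC_subset_M by (meson subsetD)
qed

end

section \<open>Formulas describing the levels\<close>

lemma fv_ForallIn [simp]: "fv (ForallIn a \<phi>) = insert a {n. Suc n \<in> fv \<phi>}"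
  by (auto simp: ForallIn_def)

lemma fv_ExistsIn [simp]: "fv (ExistsIn a \<phi>) = insert a {n. Suc n \<in> fv \<phi>}"
  by (auto simp: ExistsIn_def)

definition fm_numlike :: "nat \<Rightarrow> lset fm" where
  "fm_numlike x = ((is_empty x \<^bold>\<or> ExistsIn x (is_succ (Suc x) 0)) \<^bold>\<and>
    ForallIn x (is_empty 0 \<^bold>\<or> ExistsIn 0 (is_succ 1 0)))"

definition fm_iter :: "(nat \<Rightarrow> nat \<Rightarrow> lset fm) \<Rightarrow> nat \<Rightarrow> nat \<Rightarrow> nat \<Rightarrow> lset fm" where
  "fm_iter step n x y = Exists (pair_in (Suc n) (Suc y) 0 \<^bold>\<and> ForallIn 0
    (Exists (is_empty 0 \<^bold>\<and> is_pair 1 0 (x + 3)) \<^bold>\<or>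
     Exists (Exists (Exists (Exists (is_succ 0 3 \<^bold>\<and> is_pair 4 0 2 \<^bold>\<and> pair_in 3 1 5 \<^bold>\<and> step 1 2))))))"

text \<open>The first conjunct of the successor clause says that all iterates exist in the domain.
  Without it the second would describe the union of just those iterates that happen to exist
  there.\<close>

primrec fm_G :: "nat \<Rightarrow> nat \<Rightarrow> nat \<Rightarrow> lset fm" where
  "fm_G 0 = (\<lambda>x y. Forall (0 \<^bold>\<in> Suc y \<^bold>\<longleftrightarrow> (0 \<^bold>\<in> Suc x \<^bold>\<or> ForallIn 0 (0 \<^bold>\<in> x + 2))))"
| "fm_G (Suc i) = (\<lambda>x y. Forall (fm_numlike 0 \<^bold>\<longrightarrow> Exists (fm_iter (fm_G i) 1 (x + 2) 0)) \<^bold>\<and>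
    Forall (0 \<^bold>\<in> Suc y \<^bold>\<longleftrightarrow> Exists (Exists (fm_iter (fm_G i) 1 (x + 3) 0 \<^bold>\<and> 2 \<^bold>\<in> 0))))"

definition fm_base :: "nat \<Rightarrow> lset fm" where
  "fm_base x = Exists (Forall (0 \<^bold>\<in> 1 \<^bold>\<longleftrightarrow> fm_numlike 0) \<^bold>\<and> fm_G 1 0 (Suc x))"

text \<open>The variables of the list are shifted by \<open>k\<close>.\<close>

primrec fm_U :: "nat list \<Rightarrow> nat \<Rightarrow> nat \<Rightarrow> nat \<Rightarrow> lset fm" where
  "fm_U [] k x y = (x \<^bold>= y)"
| "fm_U (n # ns) k x y =
    Exists (fm_iter (fm_G (Suc (length ns))) (Suc (n + k)) (Suc x) 0 \<^bold>\<and> fm_U ns (Suc k) 0 (Suc y))"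

definition fm_cov :: "nat \<Rightarrow> nat \<Rightarrow> nat \<Rightarrow> lset fm" where
  "fm_cov a t f = (ForallIn t (ExistsIn (Suc a) (pair_in 0 1 (f + 2))) \<^bold>\<and>
    ForallIn t (ForallIn (Suc t) (ForallIn (a + 2)
      (pair_in 0 2 (f + 3) \<^bold>\<longrightarrow> pair_in 0 1 (f + 3) \<^bold>\<longrightarrow> 2 \<^bold>= 1))))"

text \<open>Applied to numerals \<open>ns\<close>, this is forced where no later node has a level of the form \<open>j # ns\<close>: such a level
  \<open>t\<close> would be that of a node whose domain contains \<open>U\<^sub>t\<close> and only sets covered by it.\<close>

definition fm_level :: "nat list \<Rightarrow> lset fm" where
  "fm_level vs = Forall (Forall
    (Exists (fm_base 0 \<^bold>\<and> fm_U (2 # map (\<lambda>n. n + 3) vs) 0 0 1) \<^bold>\<longrightarrow>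
     Exists (Forall (\<^bold>\<not> fm_cov 2 1 0))))"

primrec fm_num :: "nat \<Rightarrow> nat \<Rightarrow> lset fm" where
  "fm_num 0 x = is_empty x"
| "fm_num (Suc c) x = Exists (fm_num c 0 \<^bold>\<and> is_succ (Suc x) 0)"

text \<open>Arguments are padded with zeros to length \<open>L\<close>, so that all atoms are coded
  by lists of equal length and the levels are comparable.\<close>

definition fm_atom :: "nat \<Rightarrow> nat \<Rightarrow> nat \<Rightarrow> lset fm" where
  "fm_atom L c k = Exists (Exists (fm_num c 1 \<^bold>\<and> is_empty 0 \<^bold>\<and>
    fm_level (1 # map (\<lambda>i. i + 2) [0..<k] @ replicate (L - k) 0)))"

subsection \<open>Well-formedness and free variables\<close>

declare set_ar_def [simp] fm_G.simps [simp del]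

lemmas fm_defs = is_empty_def is_one_def is_upair_def is_pair_def is_succ_def pair_in_def

lemma wff_fm [simp]:
  "wff set_ar (is_empty x)" "wff set_ar (is_one x)" "wff set_ar (is_upair x u v)" "wff set_ar (is_pair x u v)"
  "wff set_ar (is_succ x u)" "wff set_ar (pair_in u v h)" "wff set_ar (fm_numlike x)" "wff set_ar (fm_cov a t f)"
  by (simp_all add: fm_defs fm_numlike_def fm_cov_def)

lemma wff_fm_iter: "(\<And>a b. wff set_ar (step a b)) \<Longrightarrow> wff set_ar (fm_iter step n x y)"
  by (simp add: fm_iter_def)

lemma wff_fm_G [simp]: "wff set_ar (fm_G i x y)"
  by (induction i arbitrary: x y) (simp_all add: fm_G.simps wff_fm_iter)

lemma wff_fm_U [simp]: "wff set_ar (fm_U ns k x y)"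
  by (induction ns arbitrary: k x y) (simp_all add: wff_fm_iter)

lemma wff_fm_num [simp]: "wff set_ar (fm_num c x)"
  by (induction c arbitrary: x) simp_all

lemma wff_fm_atom [simp]: "wff set_ar (fm_atom L c k)"
  by (simp add: fm_atom_def fm_level_def fm_base_def del: fm_U.simps)

lemma fv_fm [simp]:
  "fv (is_empty x) = {x}" "fv (is_succ x u) = {x, u}" "fv (is_upair x u v) = {x, u, v}"
  "fv (is_pair x u v) = {x, u, v}" "fv (pair_in u v h) = {u, v, h}" "fv (fm_numlike x) = {x}"
  by (auto simp: fm_defs fm_numlike_def)

lemma fv_fm_iter: "(\<And>a b. fv (step a b) \<subseteq> {a, b}) \<Longrightarrow> fv (fm_iter step n x y) \<subseteq> {n, x, y}"
  by (fastforce simp: fm_iter_def numeral_eq_Suc)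

lemma fv_fm_G: "fv (fm_G i x y) \<subseteq> {x, y}"
proof (induction i arbitrary: x y)
  case (Suc i)
  have "fv (fm_iter (fm_G i) n x y) \<subseteq> {n, x, y}" for n x y by (rule fv_fm_iter[OF Suc.IH])
  from this[of 1 "x + 2" 0] this[of 1 "x + 3" 0] show ?case by (auto simp: fm_G.simps numeral_eq_Suc)
qed (auto simp: fm_G.simps)

lemma fv_fm_U: "fv (fm_U ns k x y) \<subseteq> insert x (insert y ((\<lambda>n. n + k) ` set ns))"
proof (induction ns arbitrary: k x y)
  case (Cons n ns)
  have "fv (fm_iter (fm_G (Suc (length ns))) (Suc (n + k)) (Suc x) 0) \<subseteq> {Suc (n + k), Suc x, 0}"
    by (rule fv_fm_iter[OF fv_fm_G])
  with Cons.IH[of "Suc k" 0 "Suc y"] show ?case by fastforce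
qed auto

lemma fv_fm_level: "fv (fm_level vs) \<subseteq> set vs"
proof -
  have "fv (fm_base 0) \<subseteq> {0}" using fv_fm_G[of 1 0 "Suc 0"] by (auto simp: fm_base_def)
  moreover have "fv (fm_cov 2 1 0) \<subseteq> {0, 1, 2}" by (auto simp: fm_cov_def numeral_eq_Suc)
  ultimately show ?thesis
    using fv_fm_U[of "2 # map (\<lambda>n. n + 3) vs" 0 0 1]
    by (fastforce simp: fm_level_def numeral_eq_Suc simp del: fm_U.simps)
qed

lemma fv_fm_num: "fv (fm_num c x) \<subseteq> {x}"
proof (induction c arbitrary: x)
  case (Suc c)
  from Suc.IH[of 0] show ?case by auto
qed simp

lemma fv_fm_atom: "fv (fm_atom L c k) \<subseteq> {..<k}"
  using fv_fm_num[of c 1] fv_fm_level[of "1 # map (\<lambda>i. i + 2) [0..<k] @ replicate (L - k) 0"]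
  by (fastforce simp: fm_atom_def numeral_eq_Suc)

subsection \<open>Their meaning in Kripke models\<close>

context kp_kripke
begin

lemma A_kpair_components: "le v v \<Longrightarrow> kpair x y \<in> A v \<Longrightarrow> x \<in> A v \<and> y \<in> A v"
  using A_trans[of v "kpair x y"] A_trans[of v "upair x y"] by (auto simp: kpair_def)

lemma A_num: "le v v \<Longrightarrow> num n \<in> A v"
  using A_trans[OF _ A_omega, of v] by auto

lemma forces_is_pair' [simp]: "ok v e \<Longrightarrow> forces v e (is_pair x y z) \<longleftrightarrow> e x = kpair (e y) (e z)"
  by (rule forces_is_pair) (auto intro: A_upair ok_in ok_le)

lemma forces_pair_in [simp]: "ok v e \<Longrightarrow> forces v e (pair_in x y h) \<longleftrightarrow> kpair (e x) (e y) \<in> els (e h)"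
  unfolding pair_in_def by (auto simp: forces_ExistsIn dest: ok_els cong: conj_cong)

lemma forces_fm_numlike [simp]: "ok v e \<Longrightarrow> forces v e (fm_numlike x) \<longleftrightarrow> numlike (e x)"
proof -
  assume ok: "ok v e"
  have "els u \<subseteq> A v" if "u \<in> A v" for u using A_trans[OF ok_le[OF ok] that] .
  then have sub: "els u \<subseteq> A v" if "u = e x \<or> u \<in> els (e x)" for u
    using that ok_in[OF ok] ok_els[OF ok] by blast
  have "forces v e (fm_numlike x) \<longleftrightarrow>
      (e x = hempty \<or> (\<exists>z. z \<in> els (e x) \<and> z \<in> A v \<and> e x = hsucc z)) \<and>
      (\<forall>u. u \<in> els (e x) \<longrightarrow> u \<in> A v \<longrightarrow> u = hempty \<or> (\<exists>z. z \<in> els u \<and> z \<in> A v \<and> u = hsucc z))"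
    using ok by (simp add: fm_numlike_def forces_ForallIn forces_ExistsIn cong: conj_cong)
  also have "\<dots> \<longleftrightarrow> numlike (e x)"
    unfolding numlike_def using sub by blast
  finally show ?thesis .
qed

lemma forces_Impl_stable:
  assumes "ok v e" "\<And>w. le v w \<Longrightarrow> ok w e \<Longrightarrow> forces w e \<phi> \<longleftrightarrow> P" "\<And>w. le v w \<Longrightarrow> ok w e \<Longrightarrow> forces w e \<psi> \<longleftrightarrow> Q"
  shows "forces v e (\<phi> \<^bold>\<longrightarrow> \<psi>) \<longleftrightarrow> (P \<longrightarrow> Q)"
  using assms ok_le[OF assms(1)] ok_mono by auto

text \<open>A final value in the domain must bring the approximating graph with it:
  \<open>mono\<close> puts the earlier iterates into the domain, and then the finite graph is there
  too. Conversely, any graph in the domain is correct.\<close>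

lemma forces_fm_iter:
  assumes step: "\<And>v e a b. ok v e \<Longrightarrow> forces v e (step a b) \<longleftrightarrow> e b = g (e a)"
    and ok: "ok v e"
    and mono: "\<And>j k. j \<le> k \<Longrightarrow> (g ^^ k) (e x) \<in> A v \<Longrightarrow> (g ^^ j) (e x) \<in> A v"
  shows "forces v e (fm_iter step n x y) \<longleftrightarrow> (\<exists>k. e n = num k \<and> e y = (g ^^ k) (e x))"
proof -
  note le = ok_le[OF ok]
  have comp: "m \<in> A v \<and> z \<in> A v" if "kpair m z \<in> els f" "f \<in> A v" for m z f
    using that A_trans[OF le] A_kpair_components[OF le] by blast
  have graph: "forces v (case_nat f e) (ForallIn 0
      (Exists (is_empty 0 \<^bold>\<and> is_pair 1 0 (x + 3)) \<^bold>\<or>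
       Exists (Exists (Exists (Exists (is_succ 0 3 \<^bold>\<and> is_pair 4 0 2 \<^bold>\<and> pair_in 3 1 5 \<^bold>\<and> step 1 2)))))) \<longleftrightarrow>
    iter_graph g (e x) f" (is "?l \<longleftrightarrow> _") if f: "f \<in> A v" for f
  proof -
    have 1: "forces v (case_nat u (case_nat p (case_nat f e))) (is_empty 0 \<^bold>\<and> is_pair 1 0 (x + 3)) \<longleftrightarrow>
        u = hempty \<and> p = kpair u (e x)" if "u \<in> A v" "p \<in> A v" for u p
      using that ok f by (simp add: numeral_eq_Suc)
    have 2: "forces v (case_nat s (case_nat z' (case_nat z (case_nat m (case_nat p (case_nat f e))))))
        (is_succ 0 3 \<^bold>\<and> is_pair 4 0 2 \<^bold>\<and> pair_in 3 1 5 \<^bold>\<and> step 1 2) \<longleftrightarrow>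
        s = hsucc m \<and> p = kpair s z \<and> kpair m z' \<in> els f \<and> z = g z'"
      if "s \<in> A v" "z' \<in> A v" "z \<in> A v" "m \<in> A v" "p \<in> A v" for s z' z m p
      using that ok f step by (simp add: numeral_eq_Suc)
    have "?l \<longleftrightarrow> (\<forall>p. p \<in> els f \<longrightarrow> p \<in> A v \<longrightarrow> (\<exists>u. u \<in> A v \<and> u = hempty \<and> p = kpair u (e x)) \<or>
        (\<exists>m. m \<in> A v \<and> (\<exists>z. z \<in> A v \<and> (\<exists>z'. z' \<in> A v \<and> (\<exists>s. s \<in> A v \<and> s = hsucc m \<and> p = kpair s z \<and>
          kpair m z' \<in> els f \<and> z = g z')))))"
      using ok f unfolding One_nat_def
      by (simp add: forces_ForallIn forces_Exists 1[unfolded One_nat_def] 2[unfolded One_nat_def]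
          del: forces.simps(3,5,6,7) cong: conj_cong)
    also have "\<dots> \<longleftrightarrow> iter_graph g (e x) f" (is "?r \<longleftrightarrow> _")
    proof
      assume ?r
      moreover have "p \<in> A v" if "p \<in> els f" for p using A_trans[OF le f] that by blast
      ultimately show "iter_graph g (e x) f" unfolding iter_graph_def by metis
    next
      assume r: "iter_graph g (e x) f"
      show ?r
      proof (intro allI impI)
        fix p assume p: "p \<in> els f"
        then consider "p = kpair hempty (e x)" | m z z' where "p = kpair (hsucc m) z" "kpair m z' \<in> els f" "z = g z'"
          using r unfolding iter_graph_def by blast
        then show "(\<exists>u. u \<in> A v \<and> u = hempty \<and> p = kpair u (e x)) \<or>
          (\<exists>m. m \<in> A v \<and> (\<exists>z. z \<in> A v \<and> (\<exists>z'. z' \<in> A v \<and> (\<exists>s. s \<in> A v \<and> s = hsucc m \<and> p = kpair s z \<and>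
            kpair m z' \<in> els f \<and> z = g z'))))"
        proof cases
          case 1
          then show ?thesis using A_hempty[OF le] by blast
        next
          case 2
          then show ?thesis using comp[OF _ f] p by metis
        qed
      qed
    qed
    finally show ?thesis .
  qed
  have "forces v e (fm_iter step n x y) \<longleftrightarrow> (\<exists>f. f \<in> A v \<and> kpair (e n) (e y) \<in> els f \<and> iter_graph g (e x) f)"
    unfolding fm_iter_def forces_Exists forces.simps(3)
    using ok by (simp add: graph[unfolded One_nat_def] del: forces.simps(5,6,7) cong: conj_cong)
  also have "\<dots> \<longleftrightarrow> (\<exists>k. e n = num k \<and> e y = (g ^^ k) (e x))"
  proof
    assume "\<exists>f. f \<in> A v \<and> kpair (e n) (e y) \<in> els f \<and> iter_graph g (e x) f"
    then show "\<exists>k. e n = num k \<and> e y = (g ^^ k) (e x)" using iter_graph_sound by blast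
  next
    assume "\<exists>k. e n = num k \<and> e y = (g ^^ k) (e x)"
    then obtain k where k: "e n = num k" "e y = (g ^^ k) (e x)" by blast
    have gk: "(g ^^ k) (e x) \<in> A v" using ok_in[OF ok, of y] k by simp
    have "iter_fun g (e x) k \<in> A v"
      by (rule iter_fun_in) (use A_upair A_hunion A_num le mono[OF _ gk] in blast)+
    then show "\<exists>f. f \<in> A v \<and> kpair (e n) (e y) \<in> els f \<and> iter_graph g (e x) f"
      using iter_graph_complete[where g = g and X = "e x" and k = k] k by auto
  qed
  finally show ?thesis .
qed

lemma forces_fm_num [simp]: "ok v e \<Longrightarrow> forces v e (fm_num c x) \<longleftrightarrow> e x = num c"
proof (induction c arbitrary: x e)
  case (Suc c)
  then show ?case using A_num[OF ok_le[OF Suc.prems], of c] by auto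
qed simp

end

text \<open>A Kripke model with domains \<open>HC (U s base)\<close> given by a map from the nodes to levels.\<close>

locale level_kripke = ctm +
  fixes le :: "'w \<Rightarrow> 'w \<Rightarrow> bool" and lev :: "'w \<Rightarrow> nat list"
  assumes le_trans: "le u v \<Longrightarrow> le v w \<Longrightarrow> le u w"
    and le_refl1: "le u v \<Longrightarrow> le u u"
    and le_refl2: "le u v \<Longrightarrow> le v v"
    and lev_mono: "le u v \<Longrightarrow> lev u = lev v \<or> lex_less (lev u) (lev v)"
begin

abbreviation A :: "'w \<Rightarrow> hcset set" where
  "A v \<equiv> HC (U (lev v) base)"

lemma good_lev [simp]: "good (U s base)"
  by (rule good_U[OF good_base])

lemma U_lex_less_subset: "lex_less s t \<Longrightarrow> els (U s base) \<subseteq> els (U t base)"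
proof -
  assume s: "lex_less s t"
  have "els (U s base) \<subseteq> els (mpow (U s base))"
    using good_lev[of s] els_M unfolding good_def tr_def by auto
  then show ?thesis using U_lex_less[OF s good_base] by blast
qed

end

sublocale level_kripke \<subseteq> kr: kp_kripke le A
proof
  show "le u v \<Longrightarrow> le v w \<Longrightarrow> le u w" "le u v \<Longrightarrow> le u u" "le u v \<Longrightarrow> le v v" for u v w
    using le_trans le_refl1 le_refl2 by blast+
  show "A u \<subseteq> A v" if "le u v" for u v
    using lev_mono[OF that] HC_mono[OF good_lev good_lev U_lex_less_subset] by auto
  show "els y \<subseteq> A v" if "y \<in> A v" for v y by (rule HC_trans[OF that])
  show "hempty \<in> A v" "omega \<in> A v" for v by (auto intro: HC_hempty HC_omega)
  show "upair x y \<in> A v" if "x \<in> A v" "y \<in> A v" for v x y using that by (intro HC_upair) auto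
  show "hunion x \<in> A v" if "x \<in> A v" for v x using that by (rule HC_hunion)
  show "hset {x \<in> els a. holds (case_nat x e) \<phi>} \<in> A v"
    if "range e \<subseteq> A v" "a \<in> A v" "wff set_ar \<phi>" "delta0 \<phi>" for v e a \<phi>
    using that by (rule HC_delta0_separation)
  show "\<exists>b\<in>A v. \<forall>x\<in>els a. \<exists>y\<in>els b. holds (case_nat x (case_nat y e)) \<phi>"
    if "range e \<subseteq> A v" "a \<in> A v" "wff set_ar \<phi>" "delta0 \<phi>"
      "\<And>x. x \<in> els a \<Longrightarrow> \<exists>y\<in>A v. holds (case_nat x (case_nat y e)) \<phi>" for v e a \<phi>
    using that by (rule HC_delta0_collection[OF good_lev])
  show "\<exists>b\<in>A v. \<forall>x\<in>els a. \<exists>!z. z \<in> els b \<and> z \<in> els x"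
    if "a \<in> A v" "\<And>x. x \<in> els a \<Longrightarrow> els x \<noteq> {}"
      "\<And>x y. x \<in> els a \<Longrightarrow> y \<in> els a \<Longrightarrow> x \<noteq> y \<Longrightarrow> els x \<inter> els y = {}" for v a
    using that by (rule HC_choice)
qed

section \<open>Meaning of the level formulas in the domains \<open>HC (U t base)\<close>\<close>

context level_kripke
begin

lemma A_M: "x \<in> A v \<Longrightarrow> x \<in> M"
  using HC_subset_M by blast

text \<open>Earlier iterates are subsets of later ones, and a domain is closed under subsets from
  \<open>M\<close>.\<close>

lemma iterate_G_in_A:
  assumes "X \<in> A v" "j \<le> k" "(G i ^^ k) X \<in> A v"
  shows "(G i ^^ j) X \<in> A v"
  by (rule HC_subset[OF assms(3)]) (use assms iterate_G_M iterate_G_mono A_M in auto)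

text \<open>The formula is not bounded, but a domain contains all subsets in \<open>M\<close> of its
  members, so it recognizes power sets as \<open>M\<close> does.\<close>

lemma forces_fm_G: "kr.ok v e \<Longrightarrow> kr.forces v e (fm_G i x y) \<longleftrightarrow> e y = G i (e x)"
proof (induction i arbitrary: v e x y)
  case 0
  have X: "e x \<in> A v" "e x \<in> M" using kr.ok_in[OF 0] A_M by blast+
  have sub: "els (G 0 (e x)) \<subseteq> A v"
    using HC_trans[OF X(1)] HC_subset[OF X(1)] by (auto simp: G.simps)
  have "kr.forces v e (fm_G 0 x y) \<longleftrightarrow> els (e y) = els (G 0 (e x))"
    unfolding fm_G.simps
  proof (rule kr.forces_comprehension[OF 0 _ sub])
    fix w z assume z: "le v w" "z \<in> A w" "kr.ok w e"
    then have "z \<in> M" "els z \<subseteq> A w" using A_M HC_trans by blast+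
    then show "kr.forces w (case_nat z e) (0 \<^bold>\<in> Suc x \<^bold>\<or> ForallIn 0 (0 \<^bold>\<in> x + 2)) \<longleftrightarrow> z \<in> els (G 0 (e x))"
      using z X(2) els_M by (auto simp: G.simps kr.forces_ForallIn)
  qed
  then show ?case by (simp only: els_inject)
next
  case (Suc i)
  note ok = Suc.prems and le = kr.ok_le[OF Suc.prems]
  have X: "e x \<in> A v" "e x \<in> M" using kr.ok_in[OF ok] A_M by blast+
  have iter: "kr.forces w e' (fm_iter (fm_G i) n a b) \<longleftrightarrow> (\<exists>k. e' n = num k \<and> e' b = (G i ^^ k) (e' a))"
    if "kr.ok w e'" for w e' n a b
    by (rule kr.forces_fm_iter[OF Suc.IH that]) (auto intro: iterate_G_in_A kr.ok_in[OF that])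
  let ?all = "\<forall>k. (G i ^^ k) (e x) \<in> A v"
  have 1: "kr.forces v e (Forall (fm_numlike 0 \<^bold>\<longrightarrow> Exists (fm_iter (fm_G i) 1 (x + 2) 0))) \<longleftrightarrow> ?all"
  proof -
    have "kr.forces w (case_nat n e) (Exists (fm_iter (fm_G i) 1 (x + 2) 0)) \<longleftrightarrow>
        (\<exists>k. n = num k \<and> (G i ^^ k) (e x) \<in> A w)" if "kr.ok w e" "n \<in> A w" for w n
      using that by (auto simp: kr.forces_Exists iter simp del: kr.forces.simps(7))
    then have "kr.forces v e (Forall (fm_numlike 0 \<^bold>\<longrightarrow> Exists (fm_iter (fm_G i) 1 (x + 2) 0))) \<longleftrightarrow>
        (\<forall>w n. le v w \<longrightarrow> n \<in> A w \<longrightarrow> kr.ok w e \<longrightarrow> n \<in> range num \<longrightarrow> (\<exists>k. n = num k \<and> (G i ^^ k) (e x) \<in> A w))"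
      unfolding kr.forces_Forall_bounded[OF ok] by (simp add: numlike_iff del: kr.forces.simps(7))
    also have "\<dots> \<longleftrightarrow> ?all"
    proof
      assume *: "\<forall>w n. le v w \<longrightarrow> n \<in> A w \<longrightarrow> kr.ok w e \<longrightarrow> n \<in> range num \<longrightarrow> (\<exists>k. n = num k \<and> (G i ^^ k) (e x) \<in> A w)"
      show ?all
      proof
        fix k
        from *[rule_format, OF le kr.A_num[OF le] ok rangeI, of k] show "(G i ^^ k) (e x) \<in> A v" by auto
      qed
    next
      assume ?all
      then show "\<forall>w n. le v w \<longrightarrow> n \<in> A w \<longrightarrow> kr.ok w e \<longrightarrow> n \<in> range num \<longrightarrow> (\<exists>k. n = num k \<and> (G i ^^ k) (e x) \<in> A w)"
        using kr.A_mono by blast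
    qed
    finally show ?thesis .
  qed
  have 2: "kr.forces v e (Forall (0 \<^bold>\<in> Suc y \<^bold>\<longleftrightarrow> Exists (Exists (fm_iter (fm_G i) 1 (x + 3) 0 \<^bold>\<and> 2 \<^bold>\<in> 0)))) \<longleftrightarrow>
      els (e y) = els (G (Suc i) (e x))" if all: ?all
  proof (rule kr.forces_comprehension[OF ok])
    show "els (G (Suc i) (e x)) \<subseteq> A v"
      unfolding els_G_Suc[OF X(2)] using all HC_trans by blast
    fix w z assume z: "le v w" "z \<in> A w" "kr.ok w e"
    have "(G i ^^ k) (e x) \<in> A w" "num k \<in> A w" for k
      using all kr.A_mono[OF z(1)] kr.A_num[OF kr.ok_le[OF z(3)]] by blast+
    then show "kr.forces w (case_nat z e) (Exists (Exists (fm_iter (fm_G i) 1 (x + 3) 0 \<^bold>\<and> 2 \<^bold>\<in> 0))) \<longleftrightarrow>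
        z \<in> els (G (Suc i) (e x))"
      unfolding els_G_Suc[OF X(2)] using z
      by (auto simp: kr.forces_Exists iter numeral_eq_Suc simp del: kr.forces.simps(7) cong: conj_cong)
  qed
  show ?case
  proof
    assume "kr.forces v e (fm_G (Suc i) x y)"
    then have "els (e y) = els (G (Suc i) (e x))" using 1 2 by (simp add: fm_G.simps del: kr.forces.simps(5,6,7))
    then show "e y = G (Suc i) (e x)" by (rule hcset_ext)
  next
    assume eq: "e y = G (Suc i) (e x)"
    \<comment> \<open>If the limit is in the domain, so are the iterates, being subsets of
      it.\<close>
    have ?all
    proof
      fix k
      have "els ((G i ^^ k) (e x)) \<subseteq> els (e y)" unfolding eq els_G_Suc[OF X(2)] by blast
      then show "(G i ^^ k) (e x) \<in> A v" using HC_subset kr.ok_in[OF ok] iterate_G_M[OF X(2)] by blast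
    qed
    then show "kr.forces v e (fm_G (Suc i) x y)" using 1 2 eq by (simp add: fm_G.simps del: kr.forces.simps(5,6,7))
  qed
qed

lemma forces_fm_iter_G:
  "kr.ok v e \<Longrightarrow> kr.forces v e (fm_iter (fm_G i) n x y) \<longleftrightarrow> (\<exists>k. e n = num k \<and> e y = (G i ^^ k) (e x))"
  by (rule kr.forces_fm_iter[OF forces_fm_G]) (auto intro: iterate_G_in_A kr.ok_in)

lemma forces_fm_base: "kr.ok v e \<Longrightarrow> kr.forces v e (fm_base x) \<longleftrightarrow> e x = base"
proof -
  assume ok: "kr.ok v e"
  have "kr.forces v (case_nat w e) (Forall (0 \<^bold>\<in> 1 \<^bold>\<longleftrightarrow> fm_numlike 0)) \<longleftrightarrow> w = omega" if w: "w \<in> A v" for w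
  proof -
    have "kr.forces v (case_nat w e) (Forall (0 \<^bold>\<in> Suc 0 \<^bold>\<longleftrightarrow> fm_numlike 0)) \<longleftrightarrow>
        els (case_nat w e 0) = els omega"
      using ok w kr.A_num[OF kr.ok_le[OF ok]]
      by (intro kr.forces_comprehension) (auto simp: numlike_iff)
    then show ?thesis by (simp add: els_inject del: els_simps kr.forces.simps(5,6))
  qed
  then have "kr.forces v e (fm_base x) \<longleftrightarrow> e x = G 1 omega"
    using ok kr.A_omega[OF kr.ok_le[OF ok]]
    by (simp add: fm_base_def kr.forces_Exists forces_fm_G del: kr.forces.simps(5,6,7) cong: conj_cong)
  then show ?thesis using base_def by metis
qed

text \<open>The intermediate sets quantified by the formula are subsets of \<open>e y\<close>, so
  the domain contains them as soon as it contains the final set.\<close>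

lemma forces_fm_U:
  "kr.ok v e \<Longrightarrow> kr.forces v e (fm_U ns k x y) \<longleftrightarrow> (\<exists>ms. map (\<lambda>n. e (n + k)) ns = map num ms \<and> e y = U ms (e x))"
proof (induction ns arbitrary: k x y e)
  case Nil
  then show ?case by auto
next
  case (Cons n ns)
  have X: "e x \<in> M" using kr.ok_in[OF Cons.prems] A_M by blast
  have "kr.forces v e (fm_U (n # ns) k x y) \<longleftrightarrow> (\<exists>Z. Z \<in> A v \<and>
      (\<exists>m. e (n + k) = num m \<and> Z = (G (Suc (length ns)) ^^ m) (e x)) \<and>
      (\<exists>ms. map (\<lambda>n. e (n + k)) ns = map num ms \<and> e y = U ms Z))"
    using Cons by (simp add: kr.forces_Exists forces_fm_iter_G del: kr.forces.simps(5,6,7) cong: conj_cong)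
  also have "\<dots> \<longleftrightarrow> (\<exists>ms. map (\<lambda>n. e (n + k)) (n # ns) = map num ms \<and> e y = U ms (e x))"
  proof
    assume "\<exists>Z. Z \<in> A v \<and> (\<exists>m. e (n + k) = num m \<and> Z = (G (Suc (length ns)) ^^ m) (e x)) \<and>
      (\<exists>ms. map (\<lambda>n. e (n + k)) ns = map num ms \<and> e y = U ms Z)"
    then obtain m ms where *: "e (n + k) = num m" "map (\<lambda>n. e (n + k)) ns = map num ms"
      "e y = U ms ((G (Suc (length ns)) ^^ m) (e x))" by blast
    have "length ns = length ms" using arg_cong[OF *(2), of length] by simp
    then show "\<exists>ms. map (\<lambda>n. e (n + k)) (n # ns) = map num ms \<and> e y = U ms (e x)"
      using * by (intro exI[of _ "m # ms"]) simp
  next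
    assume "\<exists>ms. map (\<lambda>n. e (n + k)) (n # ns) = map num ms \<and> e y = U ms (e x)"
    then obtain ms' where ms': "map (\<lambda>n. e (n + k)) (n # ns) = map num ms'" "e y = U ms' (e x)" by blast
    then obtain m ms where ms: "ms' = m # ms" by (cases ms') auto
    have len: "length ns = length ms" using arg_cong[OF ms'(1), of length] ms by simp
    let ?Z = "(G (Suc (length ns)) ^^ m) (e x)"
    have ZM: "?Z \<in> M" by (rule iterate_G_M[OF X])
    have "els ?Z \<subseteq> els (e y)" using ms'(2) subset_U[OF ZM] by (simp add: ms len)
    then have "?Z \<in> A v" using HC_subset kr.ok_in[OF Cons.prems] ZM by blast
    then show "\<exists>Z. Z \<in> A v \<and> (\<exists>m. e (n + k) = num m \<and> Z = (G (Suc (length ns)) ^^ m) (e x)) \<and>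
      (\<exists>ms. map (\<lambda>n. e (n + k)) ns = map num ms \<and> e y = U ms Z)"
      using ms' len by (intro exI[of _ ?Z] HOL.conjI exI[of _ m] exI[of _ ms]) (simp_all add: ms)
  qed
  finally show ?case .
qed

lemma forces_fm_cov: "kr.ok v e \<Longrightarrow> kr.forces v e (fm_cov a t f) \<longleftrightarrow> cov (e a) (e t) (e f)"
proof -
  assume ok: "kr.ok v e"
  have sub: "els (e i) \<subseteq> A v" for i using HC_trans kr.ok_in[OF ok] by blast
  have 1: "kr.forces v e (ForallIn t (ExistsIn (Suc a) (pair_in 0 1 (f + 2)))) \<longleftrightarrow>
      (\<forall>y\<in>els (e t). \<exists>u\<in>els (e a). kpair u y \<in> els (e f))"
    using ok sub by (auto simp: kr.forces_ForallIn kr.forces_ExistsIn numeral_eq_Suc subset_iff cong: conj_cong)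
  have 2: "kr.forces v (case_nat u (case_nat y' (case_nat y e))) (pair_in 0 2 (f + 3) \<^bold>\<longrightarrow> pair_in 0 1 (f + 3) \<^bold>\<longrightarrow> 2 \<^bold>= 1) \<longleftrightarrow>
      (kpair u y \<in> els (e f) \<longrightarrow> kpair u y' \<in> els (e f) \<longrightarrow> y = y')" if "u \<in> A v" "y \<in> A v" "y' \<in> A v" for u y y'
    using ok that by (intro kr.forces_Impl_stable) (auto simp: numeral_eq_Suc)
  show ?thesis
    unfolding fm_cov_def cov_def kr.forces.simps(3) 1
    using ok sub by (auto simp: kr.forces_ForallIn 2[unfolded One_nat_def] subset_iff simp del: kr.forces.simps(5))
qed

text \<open>The \<open>U\<close> of a higher level would include the power set of
  \<open>U (lev v) base\<close> and, being in the domain, still be covered by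
  \<open>U (lev v) base\<close>, contrary to \<open>mpow_not_small\<close>.\<close>

lemma level_in_A: "length s = length (lev v) \<Longrightarrow> U s base \<in> A v \<Longrightarrow> s = lev v \<or> lex_less s (lev v)"
proof (rule ccontr)
  assume len: "length s = length (lev v)" and A: "U s base \<in> A v" and "\<not> (s = lev v \<or> lex_less s (lev v))"
  then have "lex_less (lev v) s" using lex_less_linear[OF len] by blast
  then have "els (mpow (U (lev v) base)) \<subseteq> els (U s base)" by (rule U_lex_less[OF _ good_base])
  moreover have "small (U (lev v) base) (U s base)" using A small_subset unfolding HC_def by blast
  ultimately have "small (U (lev v) base) (mpow (U (lev v) base))" by (blast intro: small_subset)
  then show False using mpow_not_small good_lev[of "lev v"] by (simp add: good_def)
qed

text \<open>A node of level \<open>j # map ns vs\<close> refutes the formula, since by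
  \<open>HC_cov\<close> every set of its domain is covered within the domain. If no such node lies
  ahead, any later node that contains a \<open>U\<close> of this form has a strictly higher level by
  \<open>level_in_A\<close>; so it contains the power set of this \<open>U\<close>, which is not
  covered even in \<open>M\<close>.\<close>

lemma forces_fm_level:
  assumes ok: "kr.ok v e" and ns: "\<And>i. i \<in> set vs \<Longrightarrow> e i = num (ns i)"
    and len: "\<And>w. le v w \<Longrightarrow> length (lev w) = Suc (length vs)"
  shows "kr.forces v e (fm_level vs) \<longleftrightarrow> (\<forall>w j. le v w \<longrightarrow> lev w \<noteq> j # map ns vs)"
proof -
  let ?\<phi> = "Exists (fm_base 0 \<^bold>\<and> fm_U (2 # map (\<lambda>n. n + 3) vs) 0 0 1)"
    and ?\<psi> = "Exists (Forall (\<^bold>\<not> fm_cov 2 1 0))"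
  have \<phi>: "kr.forces w (case_nat K (case_nat j e)) ?\<phi> \<longleftrightarrow> (\<exists>i. j = num i \<and> K = U (i # map ns vs) base)"
    if "kr.ok w e" "j \<in> A w" "K \<in> A w" for w j K
  proof -
    have base_A: "base \<in> A w"
      by (rule HC_subset_self[OF good_lev _ subset_U]) (use good_base in \<open>simp_all add: good_def\<close>)
    then have "kr.forces w (case_nat K (case_nat j e)) ?\<phi> \<longleftrightarrow> kr.forces w (case_nat base (case_nat K (case_nat j e)))
        (fm_U (2 # map (\<lambda>n. n + 3) vs) 0 0 1)"
      using that by (simp add: kr.forces_Exists forces_fm_base del: fm_U.simps kr.forces.simps(5,6,7) cong: conj_cong)
    also have "\<dots> \<longleftrightarrow> (\<exists>ms. map (\<lambda>n. case_nat base (case_nat K (case_nat j e)) (n + 0)) (2 # map (\<lambda>n. n + 3) vs) =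
        map num ms \<and> K = U ms base)"
      using that \<open>base \<in> A w\<close> by (subst forces_fm_U) simp_all
    also have "map (\<lambda>n. case_nat base (case_nat K (case_nat j e)) (n + 0)) (2 # map (\<lambda>n. n + 3) vs) =
        j # map num (map ns vs)"
      using ns by (simp add: numeral_eq_Suc)
    also have "(\<exists>ms. j # map num (map ns vs) = map num ms \<and> K = U ms base) \<longleftrightarrow> (\<exists>i. j = num i \<and> K = U (i # map ns vs) base)"
    proof -
      have inj: "map num ms = map num ms' \<longleftrightarrow> ms = ms'" for ms ms'
        by (rule inj_map_eq_map) (simp add: inj_def)
      show ?thesis
      proof
        assume "\<exists>ms. j # map num (map ns vs) = map num ms \<and> K = U ms base"
        then obtain ms where ms: "j # map num (map ns vs) = map num ms" "K = U ms base" by metis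
        then obtain i ms' where "ms = i # ms'" by (cases ms) auto
        then show "\<exists>i. j = num i \<and> K = U (i # map ns vs) base"
          using ms inj[of "map ns vs" ms'] by auto
      next
        assume "\<exists>i. j = num i \<and> K = U (i # map ns vs) base"
        then show "\<exists>ms. j # map num (map ns vs) = map num ms \<and> K = U ms base"
          by (metis list.simps(9))
      qed
    qed
    finally show ?thesis .
  qed
  have \<psi>: "kr.forces w (case_nat K (case_nat j e)) ?\<psi> \<longleftrightarrow> (\<exists>x. x \<in> A w \<and> (\<forall>u f. le w u \<longrightarrow> f \<in> A u \<longrightarrow> \<not> cov K x f))"
    if "kr.ok w e" "j \<in> A w" "K \<in> A w" for w j K
  proof -
    have neg: "kr.forces u e' (\<^bold>\<not> fm_cov 2 1 0) \<longleftrightarrow> \<not> cov (e' 2) (e' 1) (e' 0)" if "kr.ok u e'" for u e'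
      using kr.forces_Impl_stable[OF that, of "fm_cov 2 1 0" "cov (e' 2) (e' 1) (e' 0)" "\<^bold>\<bottom>" False]
      by (simp add: forces_fm_cov del: kr.forces.simps(5))
    have "kr.forces w (case_nat x (case_nat K (case_nat j e))) (Forall (\<^bold>\<not> fm_cov 2 1 0)) \<longleftrightarrow>
        (\<forall>u f. le w u \<longrightarrow> f \<in> A u \<longrightarrow> \<not> cov K x f)" if "x \<in> A w" for x
    proof -
      have ok': "kr.ok w (case_nat x (case_nat K (case_nat j e)))" using that \<open>kr.ok w e\<close> \<open>j \<in> A w\<close> \<open>K \<in> A w\<close> by simp
      have ok'': "kr.ok u (case_nat f (case_nat x (case_nat K (case_nat j e))))" if "le w u" "f \<in> A u" for u f
        using kr.ok_mono[OF ok' that(1)] that(2) by simp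
      show ?thesis
        unfolding kr.forces_Forall[OF ok'] using neg[OF ok''] kr.ok_mono[OF ok']
        by (auto simp: numeral_2_eq_2 simp del: kr.forces.simps(5) kr.ok_case_nat)
    qed
    then show ?thesis by (auto simp: kr.forces_Exists simp del: kr.forces.simps(5,6,7))
  qed
  show ?thesis
  proof
    assume forced: "kr.forces v e (fm_level vs)"
    show "\<forall>w j. le v w \<longrightarrow> lev w \<noteq> j # map ns vs"
    proof (intro allI impI notI)
      fix w j assume w: "le v w" and lev: "lev w = j # map ns vs"
      let ?K = "U (lev w) base" and ?j = "num j"
      have ww: "le w w" and okw: "kr.ok w e" using le_refl2[OF w] kr.ok_mono[OF ok w] by blast+
      have K: "?K \<in> A w" and j: "?j \<in> A w" using HC_self[OF good_lev] kr.A_num[OF ww] by blast+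
      have "kr.forces w (case_nat ?K (case_nat ?j e)) (?\<phi> \<^bold>\<longrightarrow> ?\<psi>)"
        using forced w K j okw unfolding fm_level_def kr.forces_Forall2[OF ok] by blast
      then have "kr.forces w (case_nat ?K (case_nat ?j e)) ?\<phi> \<longrightarrow> kr.forces w (case_nat ?K (case_nat ?j e)) ?\<psi>"
        using ww by (simp only: kr.forces.simps(5)) blast
      then have "kr.forces w (case_nat ?K (case_nat ?j e)) ?\<psi>"
        using \<phi>[OF okw j K] lev by auto
      then obtain x where "x \<in> A w" "\<forall>u f. le w u \<longrightarrow> f \<in> A u \<longrightarrow> \<not> cov ?K x f" using \<psi>[OF okw j K] by blast
      then show False using HC_cov[OF good_lev, of x "lev w"] ww by blast
    qed
  next
    assume R: "\<forall>w j. le v w \<longrightarrow> lev w \<noteq> j # map ns vs"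
    show "kr.forces v e (fm_level vs)"
      unfolding fm_level_def kr.forces_Forall2[OF ok]
    proof (intro allI impI)
      fix w j K assume w: "le v w" "j \<in> A w" "K \<in> A w" "kr.ok w e"
      then have ok': "kr.ok w (case_nat K (case_nat j e))" by simp
      show "kr.forces w (case_nat K (case_nat j e)) (?\<phi> \<^bold>\<longrightarrow> ?\<psi>)"
        unfolding kr.forces_Impl[OF ok']
      proof (intro allI impI)
        fix u assume u: "le w u" "kr.ok u (case_nat K (case_nat j e))"
          and f: "kr.forces u (case_nat K (case_nat j e)) ?\<phi>"
        have jK: "j \<in> A u" "K \<in> A u" "kr.ok u e" using u(2) by simp_all
        have vu: "le v u" by (rule le_trans[OF w(1) u(1)])
        obtain i where K: "K = U (i # map ns vs) base" using f \<phi>[OF jK(3,1,2)] by blast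
        have "lev u \<noteq> i # map ns vs" using R vu by blast
        then have "lex_less (i # map ns vs) (lev u)"
          using level_in_A[of "i # map ns vs" u] jK(2) len[OF vu] unfolding K by auto
        then have "els (mpow K) \<subseteq> els (U (lev u) base)" unfolding K by (rule U_lex_less[OF _ good_base])
        moreover have KM: "K \<in> M" using jK(2) by (rule A_M)
        ultimately have "mpow K \<in> A u" by (intro HC_subset_self good_lev mpow_M)
        moreover have "\<not> cov K (mpow K) f" if "f \<in> A t" for f t
          using mpow_not_small[OF KM] A_M[OF that] unfolding small_def by blast
        ultimately show "kr.forces u (case_nat K (case_nat j e)) ?\<psi>" using \<psi>[OF jK(3,1,2)] by blast
      qed
    qed
  qed
qed

end

section \<open>Realizing Kripke models\<close>

text \<open>\<open>tv v (c # ns)\<close> is the truth value at \<open>v\<close> of the atom with code \<open>c\<close> and arguments \<open>ns\<close>. A node \<open>v\<close> is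
  copied once for each level whose tail codes an atom that is not true at \<open>v\<close>. The atom \<open>z\<close>, never true,
  ensures that copies of every node exist above every level.\<close>

locale realization = ctm +
  fixes kle :: "'v \<Rightarrow> 'v \<Rightarrow> bool" and tv :: "'v \<Rightarrow> nat list \<Rightarrow> bool" and L :: nat and z :: "nat list"
  assumes kle_trans: "kle u v \<Longrightarrow> kle v w \<Longrightarrow> kle u w"
    and kle_refl1: "kle u v \<Longrightarrow> kle u u"
    and kle_refl2: "kle u v \<Longrightarrow> kle v v"
    and tv_mono: "kle u v \<Longrightarrow> tv u ns \<Longrightarrow> tv v ns"
    and z: "length z = Suc L" "\<not> tv v z"
begin

definition node :: "'v \<times> nat list \<Rightarrow> bool" where
  "node p \<longleftrightarrow> kle (fst p) (fst p) \<and> length (snd p) = Suc (Suc L) \<and> \<not> tv (fst p) (tl (snd p))"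

definition nle :: "'v \<times> nat list \<Rightarrow> 'v \<times> nat list \<Rightarrow> bool" where
  "nle p q \<longleftrightarrow> node p \<and> node q \<and> kle (fst p) (fst q) \<and> (snd p = snd q \<or> lex_less (snd p) (snd q))"

end

sublocale realization \<subseteq> level_kripke M nle snd
  by unfold_locales (auto simp: nle_def node_def intro: kle_trans lex_less_trans)

context realization
begin

text \<open>A larger leading entry makes a level higher whatever follows it, so the code of every
  untrue atom can still occur ahead.\<close>

lemma above:
  assumes p: "nle p p" and w: "kle (fst p) w" and ns: "length ns = Suc L" "\<not> tv w ns"
  shows "nle p (w, Suc (hd (snd p)) # ns)"
proof -
  obtain n ns' where "snd p = n # ns'" using p by (cases "snd p") (auto simp: nle_def node_def)
  then show ?thesis using assms kle_refl2[OF w]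
    by (auto simp: nle_def node_def intro!: lex_less.head)
qed

lemma lift: "nle p p \<Longrightarrow> kle (fst p) w \<Longrightarrow> \<exists>q. nle p q \<and> fst q = w"
  using above[OF _ _ z] by (metis fst_conv)

text \<open>If the atom is not true, \<open>above\<close> yields a later node with this tail. If it
  is true, it remains true, and \<open>node\<close> forbids its code as a tail at all later
  nodes.\<close>

lemma forces_level_iff:
  assumes ok: "kr.ok p e" and e: "\<And>i. i \<in> set vs \<Longrightarrow> e i = num (ns i)" and len: "length vs = Suc L"
  shows "kr.forces p e (fm_level vs) \<longleftrightarrow> tv (fst p) (map ns vs)"
proof -
  have p: "nle p p" by (rule kr.ok_le[OF ok])
  have "kr.forces p e (fm_level vs) \<longleftrightarrow> (\<forall>q j. nle p q \<longrightarrow> snd q \<noteq> j # map ns vs)"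
    by (rule forces_fm_level[OF ok e]) (auto simp: nle_def node_def len)
  also have "\<dots> \<longleftrightarrow> tv (fst p) (map ns vs)"
  proof
    assume *: "\<forall>q j. nle p q \<longrightarrow> snd q \<noteq> j # map ns vs"
    show "tv (fst p) (map ns vs)"
    proof (rule ccontr)
      assume "\<not> tv (fst p) (map ns vs)"
      moreover have "kle (fst p) (fst p)" using p by (simp add: nle_def)
      ultimately show False using above[OF p, of "fst p" "map ns vs"] * len by fastforce
    qed
  next
    assume "tv (fst p) (map ns vs)"
    then show "\<forall>q j. nle p q \<longrightarrow> snd q \<noteq> j # map ns vs"
      using tv_mono by (auto simp: nle_def node_def)
  qed
  finally show ?thesis .
qed

lemma forces_fm_atom:
  assumes ok: "kr.ok p e" and e: "\<And>i. i < k \<Longrightarrow> e i = num (ns i)" and k: "k \<le> L"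
  shows "kr.forces p e (fm_atom L c k) \<longleftrightarrow> tv (fst p) (c # map ns [0..<k] @ replicate (L - k) 0)"
proof -
  let ?vs = "1 # map (\<lambda>i. i + 2) [0..<k] @ replicate (L - k) 0"
  let ?ns = "case_nat 0 (case_nat c ns)"
  have A: "num c \<in> A p" "hempty \<in> A p" using kr.A_num[OF kr.ok_le[OF ok]] kr.A_hempty[OF kr.ok_le[OF ok]] by blast+
  have "kr.forces p (case_nat hempty (case_nat (num c) e)) (fm_level ?vs) \<longleftrightarrow> tv (fst p) (map ?ns ?vs)"
    by (rule forces_level_iff) (use ok A e k in \<open>auto simp: numeral_2_eq_2\<close>)
  also have "map ?ns ?vs = c # map ns [0..<k] @ replicate (L - k) 0"
    by (simp add: numeral_2_eq_2)
  finally show ?thesis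
    using ok A by (simp add: fm_atom_def kr.forces_Exists del: kr.forces.simps(7) cong: conj_cong)
qed

end

section \<open>The relative first-order logic is intuitionistic\<close>

lemma uclose_map_fm: "map_fm f (uclose \<phi>) = uclose (map_fm f \<phi>)"
proof -
  have "fv (map_fm f \<phi>) = fv \<phi>" by (induction \<phi>) auto
  moreover have "map_fm f ((Forall ^^ n) \<phi>) = (Forall ^^ n) (map_fm f \<phi>)" for n by (induction n) auto
  ultimately show ?thesis by (simp add: uclose_def)
qed

lemma set_fm_uclose: "set_fm (uclose \<phi>) = set_fm \<phi>"
proof -
  have "set_fm ((Forall ^^ n) \<phi>) = set_fm \<phi>" for n by (induction n) auto
  then show ?thesis by (simp add: uclose_def)
qed

lemma derives_map_fm_inj:
  assumes "inj_on f (set_fm \<phi>)" "{} \<turnstile> map_fm f \<phi>"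
  shows "{} \<turnstile> \<phi>"
proof -
  let ?g = "inv_into (set_fm \<phi>) f"
  have "map_fm ?g (map_fm f \<phi>) = map_fm id \<phi>"
    unfolding fm.map_comp by (rule fm.map_cong0) (simp add: assms(1))
  then show ?thesis using derives_map_fm[OF assms(2), of ?g] by (simp add: fm.map_id)
qed

text \<open>A formula mentions finitely many symbols, so completeness applies after numbering them;
  symbols outside \<open>\<phi>\<close> are translated to falsity. An individual \<open>d\<close> is
  represented by \<open>num d\<close>.\<close>

lemma countermodel_translation:
  fixes \<phi> :: "'r fm"
  assumes M: "countable_transitive_model M" and wff: "wff ar \<phi>" and nd: "\<not> ({} \<turnstile> \<phi>)"
  obtains \<sigma> where "translation (ext_ar ar) \<sigma>"
    "\<not> (IKP_plus \<union> {MP, AC} \<turnstile>\<^sub>= translate \<sigma> (Exists (E_fm 0) \<^bold>\<longrightarrow> relativize (uclose \<phi>)))"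
proof -
  interpret ctm M by unfold_locales (rule M)
  note split_paired_All [simp del] split_paired_Ex [simp del]
  define S where "S = set_fm \<phi>"
  have fin: "finite S" by (simp add: S_def)
  obtain N f where f: "f ` S = {i::nat. i < N}" "inj_on f S"
    using finite_imp_inj_to_nat_seg[OF fin] by blast
  define ark where "ark c = ar (inv_into S f c)" for c
  have ark: "ark (f r) = ar r" if "r \<in> S" for r using that f(2) by (simp add: ark_def)
  \<comment> \<open>One more than the largest arity, so that \<open>L\<close> is positive in any
    case: the predicate \<open>E\<close> needs one argument place.\<close>
  define L where "L = Suc (Max (insert 0 (ar ` S)))"
  have L: "ar r \<le> L" if "r \<in> S" for r
    using that fin unfolding L_def by (intro le_SucI Max_ge) auto
  obtain v0 e0 where v0: "theory_le v0 v0" "range e0 \<subseteq> fst v0" "\<not> canonical.forces v0 e0 (map_fm f \<phi>)"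
    using completeness[of "map_fm f \<phi>"] derives_map_fm_inj[of f \<phi>] f(2) nd unfolding S_def by metis
  text \<open>Code \<open>0\<close> stands for the predicate \<open>E\<close>, and the codes above \<open>N\<close> are unused.\<close>
  define tv where "tv v t = (case t of [] \<Rightarrow> False | c # ns \<Rightarrow> (case c of 0 \<Rightarrow> hd ns \<in> fst v
    | Suc c \<Rightarrow> c < N \<and> Atom c (take (ark c) ns) \<in> snd v))" for v :: "nat set \<times> nat fm set" and t
  interpret realization M theory_le tv L "Suc N # replicate L 0"
  proof
    show "tv u ns \<Longrightarrow> tv v ns" if "theory_le u v" for u v ns
      using that by (auto simp: tv_def theory_le_def split: list.splits nat.splits)
  qed (auto simp: tv_def intro: canonical.le_trans canonical.le_refl1 canonical.le_refl2)
  \<comment> \<open>The meaning of \<open>fm_atom\<close> is known only at numerals, so the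
    translation of \<open>E\<close> demands a numeral explicitly; the other symbols are then
    evaluated only at elements of \<open>E\<close>.\<close>
  define \<sigma> where "\<sigma> s = (case s of None \<Rightarrow> fm_numlike 0 \<^bold>\<and> fm_atom L 0 1
    | Some r \<Rightarrow> if r \<in> S then fm_atom L (Suc (f r)) (ar r) else \<^bold>\<bottom>)" for s
  have trans: "translation (ext_ar ar) \<sigma>"
    unfolding translation_def using fv_fm_atom[of L 0 1] fv_fm_atom[of L]
    by (auto simp: \<sigma>_def ext_ar_def split: option.split)
  have num_ok: "kr.ok p (num \<circ> e)" if "nle p p" for p e
  proof -
    have "num (e i) \<in> A p" for i using that by (rule kr.A_num)
    then have "range (num \<circ> e) \<subseteq> A p" by (simp only: image_subset_iff comp_apply Ball_def) blast
    with that show ?thesis unfolding kr.ok_def by (rule HOL.conjI)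
  qed
  have E: "kr.forces p e (translate \<sigma> (E_fm 0)) \<longleftrightarrow> (\<exists>d\<in>fst (fst p). e 0 = num d)" if ok: "kr.ok p e" for p e
  proof -
    have "kr.forces p e (fm_atom L 0 1) \<longleftrightarrow> d \<in> fst (fst p)" if "e 0 = num d" for d
      using forces_fm_atom[OF ok, of 1 "\<lambda>_. d" 0] that by (simp add: tv_def L_def)
    moreover have "numlike (e 0) \<longleftrightarrow> (\<exists>d. e 0 = num d)" by (auto simp: numlike_iff)
    moreover have "kr.forces p e (translate \<sigma> (E_fm 0)) \<longleftrightarrow> kr.forces p e (fm_numlike 0) \<and> kr.forces p e (fm_atom L 0 1)"
    proof -
      have "kr.forces p (e \<circ> (\<lambda>n. [0] ! n)) (fm_numlike 0 \<^bold>\<and> fm_atom L 0 1) = kr.forces p e (fm_numlike 0 \<^bold>\<and> fm_atom L 0 1)"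
        by (rule kr.forces_cong) (use fv_fm_atom[of L 0 1] in auto)
      then show ?thesis by (simp add: \<sigma>_def kr.forces_ren)
    qed
    ultimately show ?thesis using ok by auto
  qed
  \<comment> \<open>The two models match under the first projection: a later pair projects to a
    later node of \<open>K\<close>, and \<open>lift\<close> provides a copy of every later node
    above a given pair.\<close>
  have main: "kr.forces p (num \<circ> e) (translate \<sigma> (relativize \<psi>)) \<longleftrightarrow> canonical.forces (fst p) e (map_fm f \<psi>)"
    if "nle p p" "range e \<subseteq> fst (fst p)" "wff ar \<psi>" "set_fm \<psi> \<subseteq> S" for p e \<psi>
    using that
  proof (induction \<psi> arbitrary: p e)
    case (Atom r ts)
    have r: "r \<in> S" "length ts = ar r" using Atom.prems by auto
    have "f r < N" using f(1) r by auto
    have "kr.forces p (num \<circ> e) (translate \<sigma> (relativize (Atom r ts))) \<longleftrightarrow>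
        kr.forces p (num \<circ> (\<lambda>n. e (ts ! n))) (fm_atom L (Suc (f r)) (ar r))"
      using r by (simp add: \<sigma>_def kr.forces_ren comp_def)
    also have "\<dots> \<longleftrightarrow> tv (fst p) (Suc (f r) # map (\<lambda>i. e (ts ! i)) [0..<ar r] @ replicate (L - ar r) 0)"
      by (rule forces_fm_atom) (use num_ok Atom.prems L r in \<open>auto simp: comp_def\<close>)
    also have "map (\<lambda>i. e (ts ! i)) [0..<ar r] = map e ts"
      by (rule nth_equalityI) (use r in auto)
    also have "tv (fst p) (Suc (f r) # map e ts @ replicate (L - ar r) 0) \<longleftrightarrow> Atom (f r) (map e ts) \<in> snd (fst p)"
      using r \<open>f r < N\<close> by (simp add: tv_def ark)
    finally show ?case
      by (simp only: fm.map canonical.forces.simps(1)) (simp only: theory_int_def)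
  next
    case (Impl \<phi> \<psi>)
    have IH: "kr.forces q (num \<circ> e) (translate \<sigma> (relativize \<chi>)) \<longleftrightarrow> canonical.forces (fst q) e (map_fm f \<chi>)"
      if "nle p q" "\<chi> \<in> {\<phi>, \<psi>}" for q \<chi>
    proof -
      have "nle q q" "range e \<subseteq> fst (fst q)"
        using that le_refl2 Impl.prems(2) by (auto simp: nle_def theory_le_def)
      moreover have "wff ar \<chi>" "set_fm \<chi> \<subseteq> S" using that(2) Impl.prems(3,4) by auto
      ultimately show ?thesis using that(2) Impl.IH(1)[of q e] Impl.IH(2)[of q e] by blast
    qed
    show ?case
    proof
      assume *: "kr.forces p (num \<circ> e) (translate \<sigma> (relativize (\<phi> \<^bold>\<longrightarrow> \<psi>)))"
      have "canonical.forces w e (map_fm f \<psi>)" if w: "theory_le (fst p) w" "canonical.forces w e (map_fm f \<phi>)" for w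
      proof -
        obtain q where "nle p q" "fst q = w" using lift[OF Impl.prems(1) w(1)] by blast
        moreover have "kr.forces q (num \<circ> e) (translate \<sigma> (relativize \<psi>))"
          if "kr.forces q (num \<circ> e) (translate \<sigma> (relativize \<phi>))"
          using * \<open>nle p q\<close> that by simp
        ultimately show ?thesis using w(2) IH[of q \<phi>] IH[of q \<psi>] by blast
      qed
      then show "canonical.forces (fst p) e (map_fm f (\<phi> \<^bold>\<longrightarrow> \<psi>))" by simp
    next
      assume "canonical.forces (fst p) e (map_fm f (\<phi> \<^bold>\<longrightarrow> \<psi>))"
      then show "kr.forces p (num \<circ> e) (translate \<sigma> (relativize (\<phi> \<^bold>\<longrightarrow> \<psi>)))"
        using IH by (auto simp: nle_def)
    qed
  next
    case (Forall \<psi>)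
    have IH: "kr.forces q (case_nat (num d) (num \<circ> e)) (translate \<sigma> (relativize \<psi>)) \<longleftrightarrow>
        canonical.forces (fst q) (case_nat d e) (map_fm f \<psi>)"
      if "nle p q" "d \<in> fst (fst q)" for q d
    proof -
      have "case_nat (num d) (num \<circ> e) = num \<circ> case_nat d e" by (auto simp: fun_eq_iff split: nat.split)
      moreover have "nle q q" "range e \<subseteq> fst (fst q)"
        using that le_refl2 Forall.prems(2) by (auto simp: nle_def theory_le_def)
      moreover have "range (case_nat d e) \<subseteq> fst (fst q)"
        using \<open>range e \<subseteq> fst (fst q)\<close> that(2) by (auto split: nat.splits)
      ultimately show ?thesis using Forall.IH[of q "case_nat d e"] Forall.prems by (simp only: wff.simps fm.set)
    qed
    have ok: "kr.ok p (num \<circ> e)" by (rule num_ok[OF Forall.prems(1)])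
    have "kr.forces p (num \<circ> e) (translate \<sigma> (relativize (Forall \<psi>))) \<longleftrightarrow>
        (\<forall>q x. nle p q \<longrightarrow> x \<in> A q \<longrightarrow> kr.ok q (num \<circ> e) \<longrightarrow> (\<exists>d\<in>fst (fst q). x = num d) \<longrightarrow>
          kr.forces q (case_nat x (num \<circ> e)) (translate \<sigma> (relativize \<psi>)))"
      unfolding relativize.simps translate.simps(5,6) kr.forces_Forall_bounded[OF ok]
      using E by (simp del: translate.simps kr.forces.simps)
    also have "\<dots> \<longleftrightarrow> (\<forall>q d. nle p q \<longrightarrow> d \<in> fst (fst q) \<longrightarrow>
        kr.forces q (case_nat (num d) (num \<circ> e)) (translate \<sigma> (relativize \<psi>)))"
      using num_ok le_refl2 kr.A_num by blast
    also have "\<dots> \<longleftrightarrow> (\<forall>q d. nle p q \<longrightarrow> d \<in> fst (fst q) \<longrightarrow> canonical.forces (fst q) (case_nat d e) (map_fm f \<psi>))"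
      using IH by blast
    also have "\<dots> \<longleftrightarrow> (\<forall>w. theory_le (fst p) w \<longrightarrow> (\<forall>d\<in>fst w. canonical.forces w (case_nat d e) (map_fm f \<psi>)))"
      using lift[OF Forall.prems(1)] by (metis nle_def)
    finally show ?case by (simp only: fm.map canonical.forces.simps)
  next
    case (Exists \<psi>)
    have IH: "kr.forces p (case_nat (num d) (num \<circ> e)) (translate \<sigma> (relativize \<psi>)) \<longleftrightarrow>
        canonical.forces (fst p) (case_nat d e) (map_fm f \<psi>)" if "d \<in> fst (fst p)" for d
    proof -
      have "case_nat (num d) (num \<circ> e) = num \<circ> case_nat d e" by (auto simp: fun_eq_iff split: nat.split)
      moreover have "range (case_nat d e) \<subseteq> fst (fst p)"
        using Exists.prems(2) that by (auto split: nat.splits)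
      ultimately show ?thesis using Exists.IH[of p "case_nat d e"] Exists.prems by (simp only: wff.simps fm.set)
    qed
    have ok: "kr.ok p (num \<circ> e)" by (rule num_ok[OF Exists.prems(1)])
    have "kr.forces p (num \<circ> e) (translate \<sigma> (relativize (Exists \<psi>))) \<longleftrightarrow>
        (\<exists>x. x \<in> A p \<and> (\<exists>d\<in>fst (fst p). x = num d) \<and>
          kr.forces p (case_nat x (num \<circ> e)) (translate \<sigma> (relativize \<psi>)))"
      unfolding relativize.simps translate.simps(3,7) kr.forces_Exists kr.forces.simps(3)
      using E ok by (simp del: translate.simps kr.forces.simps cong: conj_cong)
    also have "\<dots> \<longleftrightarrow> (\<exists>d\<in>fst (fst p). kr.forces p (case_nat (num d) (num \<circ> e)) (translate \<sigma> (relativize \<psi>)))"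
      using kr.A_num[OF Exists.prems(1)] by blast
    also have "\<dots> \<longleftrightarrow> canonical.forces (fst p) e (map_fm f (Exists \<psi>))"
      using IH by (simp only: fm.map canonical.forces.simps cong: bex_cong)
    finally show ?case .
  qed (simp_all add: comp_def)
  \<comment> \<open>The tail is the code that is never true, so this pair is a node.\<close>
  define p0 where "p0 = (v0, 0 # Suc N # replicate L 0)"
  have p0: "nle p0 p0" using v0 by (simp add: p0_def nle_def node_def tv_def)
  have "\<not> (IKP_plus \<union> {MP, AC} \<turnstile>\<^sub>= translate \<sigma> (Exists (E_fm 0) \<^bold>\<longrightarrow> relativize (uclose \<phi>)))"
  proof
    assume "IKP_plus \<union> {MP, AC} \<turnstile>\<^sub>= translate \<sigma> (Exists (E_fm 0) \<^bold>\<longrightarrow> relativize (uclose \<phi>))"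
    then have d: "eq_axioms \<union> (IKP_plus \<union> {MP, AC}) \<turnstile> translate \<sigma> (Exists (E_fm 0) \<^bold>\<longrightarrow> relativize (uclose \<phi>))"
      by (simp add: set_derives_def)
    have ok: "kr.ok p0 (num \<circ> e0)" by (rule num_ok[OF p0])
    then have rng: "range (num \<circ> e0) \<subseteq> A p0" by (simp add: kr.ok_def)
    have "kr.forces p0 (num \<circ> e0) (translate \<sigma> (Exists (E_fm 0) \<^bold>\<longrightarrow> relativize (uclose \<phi>)))"
      by (rule kr.soundness[OF d p0 rng]) (rule kr.forces_axioms[OF p0 rng])
    moreover have "kr.forces p0 (num \<circ> e0) (translate \<sigma> (Exists (E_fm 0)))"
    proof -
      have "kr.forces p0 (case_nat (num (e0 0)) (num \<circ> e0)) (translate \<sigma> (E_fm 0))"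
        using E[of p0 "case_nat (num (e0 0)) (num \<circ> e0)"] ok kr.A_num[OF p0] v0(2)
        by (auto simp: p0_def simp del: translate.simps)
      then show ?thesis using kr.A_num[OF p0] by (auto simp: kr.forces_Exists simp del: kr.forces.simps(7))
    qed
    ultimately have "kr.forces p0 (num \<circ> e0) (translate \<sigma> (relativize (uclose \<phi>)))"
      using p0 by (simp only: translate.simps(5) kr.forces.simps(5))
    then have "canonical.forces (fst p0) e0 (map_fm f (uclose \<phi>))"
      using main[OF p0, of e0 "uclose \<phi>"] v0(2) wff by (simp add: p0_def set_fm_uclose S_def)
    then have "canonical.forces v0 e0 (uclose (map_fm f \<phi>))" by (simp add: p0_def uclose_map_fm)
    moreover have "fst v0 \<noteq> {}" using v0(2) by auto
    ultimately show False using v0 canonical.forces_uclose[OF v0(1)] by blast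
  qed
  with trans show thesis by (rule that)
qed

text \<open>\<open>derives_cut\<close> removes one hypothesis at a time, so the hypotheses are first
  reduced to a finite set. It is needed because \<open>T\<close> consists of consequences of the
  strongest theory, not of its axioms.\<close>

lemma derives_trans:
  assumes "\<Gamma> \<turnstile> \<phi>" "\<And>\<gamma>. \<gamma> \<in> \<Gamma> \<Longrightarrow> \<Delta> \<turnstile> \<gamma>"
  shows "\<Delta> \<turnstile> \<phi>"
proof -
  obtain G where G: "G \<subseteq> \<Gamma>" "finite G" "G \<turnstile> \<phi>" using derives_finite[OF assms(1)] by blast
  have "G \<union> \<Delta> \<turnstile> \<phi>" by (rule derives_weaken[OF G(3)]) blast
  with G(2,1) show ?thesis
  proof (induction G)
    case (insert \<gamma> G)
    have "insert \<gamma> (G \<union> \<Delta>) \<turnstile> \<phi>" using insert.prems by simp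
    moreover have "G \<union> \<Delta> \<turnstile> \<gamma>" by (rule derives_weaken[OF assms(2)]) (use insert.prems in auto)
    ultimately show ?case using insert.IH insert.prems derives_cut by blast
  qed simp
qed

lemma derives_theorems:
  assumes "T \<subseteq> theorems S" "T \<turnstile>\<^sub>= \<phi>"
  shows "S \<turnstile>\<^sub>= \<phi>"
  using derives_trans[OF assms(2)[unfolded set_derives_def]] assms(1)
  unfolding set_derives_def theorems_def by (blast intro: derives.assm)

lemma IKP_sentences: "set_theory IKP"
  unfolding set_theory_def IKP_def sentence_def
  by (auto simp: fv_uclose ax_empty_def ax_pairing_def ax_union_def ax_extensionality_def ax_infinity_def
      is_inductive_def set_induction_def separation_def collection_def args_def numeral_eq_Suc)

lemma IKP_theorems: "IKP \<subseteq> theorems (IKP_plus \<union> {MP, AC})"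
  using IKP_sentences unfolding set_theory_def theorems_def set_derives_def IKP_plus_def
  by (auto intro: derives.assm)

theorem corollary46:
  fixes ar :: "'r \<Rightarrow> nat"
  assumes "\<exists>M. countable_transitive_model M"
  shows "(\<forall>T. set_theory T \<and> T \<subseteq> theorems (IKP_plus \<union> {MP, AC}) \<longrightarrow> QL_E ar T = IQC ar)
    \<and> QL_E ar IKP = IQC ar"
proof -
  obtain M where M: "countable_transitive_model M" using assms by blast
  have *: "QL_E ar T = IQC ar" if "T \<subseteq> theorems (IKP_plus \<union> {MP, AC})" for T
  proof (rule equalityI[OF subsetI IQC_subset_QL_E], rule ccontr)
    fix \<phi> assume \<phi>: "\<phi> \<in> QL_E ar T" "\<phi> \<notin> IQC ar"
    then have "wff ar \<phi>" "\<not> ({} \<turnstile> \<phi>)" by (auto simp: QL_E_def IQC_def)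
    then obtain \<sigma> where "translation (ext_ar ar) \<sigma>"
      "\<not> (IKP_plus \<union> {MP, AC} \<turnstile>\<^sub>= translate \<sigma> (Exists (E_fm 0) \<^bold>\<longrightarrow> relativize (uclose \<phi>)))"
      by (rule countermodel_translation[OF M])
    then show False using \<phi>(1) derives_theorems[OF that] unfolding QL_E_def by blast
  qed
  then show ?thesis using IKP_theorems by blast
qed

end
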